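(* Let $W_i=(Y_i,M_i,C_i,Z_i,A_i,X_i,U_i)$ be i.i.d. with law $P$, with associated ground truth binary treatment $M_i^*\in\{0,1\}$ and potential outcomes $Y_i^{m}$, and let $\theta=E[Y_i^{m=1}-Y_i^{m=0}]$, where the linear instrumental variable identifying conditions listed in the context hold, so that $\theta=E[Z_i^\perp M_i^*]^{-1}E[Z_i^\perp Y_i]$. Here $Z_i^\perp$ is the residual from the linear projection of $Z_i$ on $C_i$, treated as known and bounded almost surely. Put $\tilde X_i=(X_i,U_i,Z_i,C_i)$, $\mu(\tilde x)=E[M_i\mid A_i=1,\tilde X_i=\tilde x]$, $\theta_{\mathrm{num}}=E[Z_i^\perp Y_i]$, $\theta_{\mathrm{den}}=E[Z_i^\perp\mu(\tilde X_i)]$, so that $\theta=\theta_{\mathrm{den}}^{-1}\theta_{\mathrm{num}}$. Let $\mathcal I,\mathcal I'$ be the disjoint index sets of a random sample split, $\hat\mu$ an estimator of $\mu$ that is a function of $\{W_{i'}\}_{i'\in\mathcal I'}$ only, and \[ \hat\theta=\frac{\sum_{i\in\mathcal I}Z_i^\perp Y_i}{\sum_{i\in\mathcal I}Z_i^\perp\bigl[\hat\mu(\tilde X_i)+\frac{A_i}{\pi(X_i)}(M_i-\hat\mu(\tilde X_i))\bigr]}. \] Assume: (0) $(C_i,Z_i)$ is conditionally independent of $A_i$ given $(X_i,U_i,M_i^* )$; (1) $M_i=A_iM_i^*$ with $A_i\in\{0,1\}$; (2) $(U_i,M_i^* )$ is conditionally independent of $A_i$ given $X_i$; (3) $\pi(x)=P(A_i=1\mid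 X_i=x)$ is fixed, known, and $\pi(x)\in[\eta,1]$ for all $x$, for some $0<\eta<1$; (4) $E\bigl[\int(\hat\mu(\tilde x)-\mu(\tilde x))^2\,dP_{\tilde X}(\tilde x)\bigr]=o(1)$ as $|\mathcal I'|\to\infty$. Then, as $|\mathcal I|,|\mathcal I'|\to\infty$, \[ \sqrt{|\mathcal I|}\,(\hat\theta-\theta)\xrightarrow{d}N\bigl(0,\mathrm{Var}(\varphi(W_i))\bigr), \] where \[ \varphi(W_i)=\theta_{\mathrm{den}}^{-1}\bigl(\varphi_{\mathrm{num}}(W_i)-\theta\,\varphi_{\mathrm{den}}(W_i)\bigr) \] is the efficient influence function for $\theta$, with \[ \varphi_{\mathrm{num}}(W_i)=Z_i^\perp Y_i-\theta_{\mathrm{num}},\qquad \varphi_{\mathrm{den}}(W_i)=Z_i^\perp\Bigl[\mu(\tilde X_i)+\frac{A_i}{\pi(X_i)}(M_i-\mu(\tilde X_i))\Bigr]-\theta_{\mathrm{den}} . \]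
   Context: $Y_i\in\mathbb R$ is an outcome, $Z_i\in\mathbb R$ a candidate instrument, $C_i\in\mathbb R^d$ covariates containing a constant, $X_i\in\mathbb R^k$ observed covariates relevant to annotation, $U_i\in\mathbb R^\ell$ unstructured data, $A_i$ an annotation indicator. $P_{\tilde X}$ is the law of $\tilde X_i$. "Treated as known" means the sample available is taken to be large enough that estimation error in $Z_i^\perp$ is ignored. Because of the random split, the samples indexed by $\mathcal I$ and $\mathcal I'$ may be regarded as independent i.i.d. samples from $P$. Identifying conditions: consistency, $Y_i=\sum_{m\in\{0,1\}}\mathbb I(M_i^*=m)Y_i^m$ and $M_i^*=\sum_z\mathbb I(Z_i=z)M_i^{*z}$ with potential treatments $M_i^{*z}$; exogeneity, $(\{Y_i^m\}_m,\{M_i^{*z}\}_z)$ conditionally independent of $Z_i$ given $C_i$; relevance, $E[Z_i^\perp M_i^*]\ne0$; homogeneous treatment effects, $Y_i^{1}-Y_i^{0}$ is a constant; linearity, the conditional expectation $E[Y_i^{0}\mid C_i]$ of the potential outcome is a linear function of $C_i$. The efficient influence function of a pathwise differentiable functional in a statistical model is the unique element $\varphi$ of the tangent space of the model at $P$ such that the pathwise derivative of the functional along every score $h$ equals $E_P[\varphi h]$; its variance is the semiparametric variance lower bound for regular asymptotically linear estimators. The statistical model is the semiparametric model induced by assumption (3), in which $\pi$ is known; $\varphi_{\mathrm{num}}$ and $\varphi_{\mathrm{den}}$ are the efficient influence functions of $\theta_{\mathrm{num}}$ and $\theta_{\mathrm{den}}$ under that model.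
   Formalization: That φ_num and φ are efficient (not just gradients) is shown only if E[Z^⊥Y|A,X]=E[Z^⊥Y|X]; it fails otherwise, e.g. A=1{Zε=1} with noise ε in Y. Z^⊥Y is assumed square integrable, Y^0 integrable; submodels have L²-differentiable likelihood ratios. *)

theory Defs
  imports "HOL-Probability.Probability"
begin

subsection \<open>Conditional independence and Gaussian laws\<close>

abbreviation sigma_of :: "'a measure \<Rightarrow> 'b measure \<Rightarrow> ('a \<Rightarrow> 'b) \<Rightarrow> 'a measure" where
  "sigma_of M N V \<equiv> vimage_algebra (space M) V N"

text \<open>\<^term>\<open>V\<close> and \<^term>\<open>T\<close> are conditionally independent given \<^term>\<open>G\<close>; the measures \<^term>\<open>NV\<close>,
  \<^term>\<open>NT\<close>, \<^term>\<open>NG\<close> only supply the \<open>\<sigma>\<close>-algebras of the target spaces.\<close>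

definition cond_indep ::
  "'a measure \<Rightarrow> 'b measure \<Rightarrow> ('a \<Rightarrow> 'b) \<Rightarrow> 'c measure \<Rightarrow> ('a \<Rightarrow> 'c)
    \<Rightarrow> 'e measure \<Rightarrow> ('a \<Rightarrow> 'e) \<Rightarrow> bool" where
  "cond_indep M NV V NT T NG G \<longleftrightarrow>
    (\<forall>S\<in>sets NV. \<forall>B\<in>sets NT. AE \<omega> in M.
       real_cond_exp M (sigma_of M NG G) (indicator {\<omega>\<in>space M. V \<omega> \<in> S \<and> T \<omega> \<in> B}) \<omega> =
       real_cond_exp M (sigma_of M NG G) (indicator {\<omega>\<in>space M. V \<omega> \<in> S}) \<omega> *
       real_cond_exp M (sigma_of M NG G) (indicator {\<omega>\<in>space M. T \<omega> \<in> B}) \<omega>)"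

text \<open>The Gaussian law with mean \<open>m\<close> and variance \<open>v \<ge> 0\<close>, a point mass if \<open>v = 0\<close>
  (\<^const>\<open>normal_density\<close> takes the standard deviation and is degenerate at 0).\<close>

definition normal_law :: "real \<Rightarrow> real \<Rightarrow> real measure" where
  "normal_law m v =
    (if v = 0 then return borel m else density lborel (\<lambda>x. ennreal (normal_density m (sqrt v) x)))"


subsection \<open>Efficient influence functions\<close>

definition L2 :: "'w measure \<Rightarrow> ('w \<Rightarrow> real) set" where
  "L2 P = {g. g \<in> borel_measurable P \<and> integrable P (\<lambda>w. (g w)\<^sup>2)}"

text \<open>A regular one-parameter submodel \<open>t \<mapsto> Q t\<close> through \<open>P\<close>, with score \<open>h\<close> at \<open>t = 0\<close>: near 0 the
  law \<open>Q t\<close> has a likelihood ratio \<open>f t\<close> with respect to \<open>P\<close>, and \<open>(f t - 1) / t \<rightarrow> h\<close> in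
  \<open>L\<^sup>2(P)\<close>. This implies differentiability in quadratic mean with the same score. Differentiability
  in quadratic mean alone would not suffice: along such paths the mean of an unbounded variable need
  not be differentiable.\<close>

definition regular_path :: "'w measure \<Rightarrow> (real \<Rightarrow> 'w measure) \<Rightarrow> ('w \<Rightarrow> real) \<Rightarrow> bool" where
  "regular_path P Q h \<longleftrightarrow>
    Q 0 = P \<and> h \<in> L2 P \<and>
    (\<exists>f. (\<forall>\<^sub>F t in at 0. f t \<in> borel_measurable P \<and> (\<forall>w. 0 \<le> f t w) \<and>
             Q t = density P (\<lambda>w. ennreal (f t w)))
       \<and> ((\<lambda>t. \<integral>\<^sup>+ w. ennreal (((f t w - 1) / t - h w)\<^sup>2) \<partial>P) \<longlongrightarrow> 0) (at 0))"

definition path_in_model ::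
  "'w measure set \<Rightarrow> 'w measure \<Rightarrow> (real \<Rightarrow> 'w measure) \<Rightarrow> ('w \<Rightarrow> real) \<Rightarrow> bool" where
  "path_in_model \<Q> P Q h \<longleftrightarrow> regular_path P Q h \<and> (\<forall>\<^sub>F t in at 0. Q t \<in> \<Q>)"

definition scores :: "'w measure set \<Rightarrow> 'w measure \<Rightarrow> ('w \<Rightarrow> real) set" where
  "scores \<Q> P = {h. \<exists>Q. path_in_model \<Q> P Q h}"

text \<open>The closed linear span of the scores in \<open>L\<^sup>2(P)\<close>.\<close>

definition tangent_space :: "'w measure set \<Rightarrow> 'w measure \<Rightarrow> ('w \<Rightarrow> real) set" where
  "tangent_space \<Q> P =
    {g \<in> L2 P. \<forall>\<epsilon>>0. \<exists>(n::nat) (c :: nat \<Rightarrow> real) h. (\<forall>i<n. h i \<in> scores \<Q> P) \<and>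
       (\<integral>w. (g w - (\<Sum>i<n. c i * h i w))\<^sup>2 \<partial>P) < \<epsilon>}"

definition pathwise_gradient ::
  "'w measure set \<Rightarrow> ('w measure \<Rightarrow> real) \<Rightarrow> 'w measure \<Rightarrow> ('w \<Rightarrow> real) \<Rightarrow> bool" where
  "pathwise_gradient \<Q> \<psi> P \<phi> \<longleftrightarrow> \<phi> \<in> L2 P \<and>
    (\<forall>Q h. path_in_model \<Q> P Q h \<longrightarrow>
       ((\<lambda>t. (\<psi> (Q t) - \<psi> P) / t) \<longlongrightarrow> (\<integral>w. \<phi> w * h w \<partial>P)) (at 0))"

text \<open>These two properties determine \<open>\<phi>\<close> up to \<open>P\<close>-null sets.\<close>

definition efficient_influence_function ::
  "'w measure set \<Rightarrow> ('w measure \<Rightarrow> real) \<Rightarrow> 'w measure \<Rightarrow> ('w \<Rightarrow> real) \<Rightarrow> bool" where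
  "efficient_influence_function \<Q> \<psi> P \<phi> \<longleftrightarrow>
    P \<in> \<Q> \<and> \<phi> \<in> tangent_space \<Q> P \<and> pathwise_gradient \<Q> \<psi> P \<phi>"


subsection \<open>The observed data\<close>

text \<open>Observations \<open>w = (Y, M, C, Z, A, X, U)\<close>.\<close>

type_synonym ('d, 'k, 'l) obs =
  "real \<times> real \<times> (real ^ 'd) \<times> real \<times> real \<times> (real ^ 'k) \<times> (real ^ 'l)"

type_synonym ('d, 'k, 'l) xtilde = "(real ^ 'k) \<times> (real ^ 'l) \<times> real \<times> (real ^ 'd)"

definition obsY :: "('d::finite, 'k::finite, 'l::finite) obs \<Rightarrow> real" where
  "obsY = (\<lambda>(y, m, c, z, a, x, u). y)"
definition obsM :: "('d::finite, 'k::finite, 'l::finite) obs \<Rightarrow> real" where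
  "obsM = (\<lambda>(y, m, c, z, a, x, u). m)"
definition obsC :: "('d::finite, 'k::finite, 'l::finite) obs \<Rightarrow> real ^ 'd" where
  "obsC = (\<lambda>(y, m, c, z, a, x, u). c)"
definition obsZ :: "('d::finite, 'k::finite, 'l::finite) obs \<Rightarrow> real" where
  "obsZ = (\<lambda>(y, m, c, z, a, x, u). z)"
definition obsA :: "('d::finite, 'k::finite, 'l::finite) obs \<Rightarrow> real" where
  "obsA = (\<lambda>(y, m, c, z, a, x, u). a)"
definition obsX :: "('d::finite, 'k::finite, 'l::finite) obs \<Rightarrow> real ^ 'k" where
  "obsX = (\<lambda>(y, m, c, z, a, x, u). x)"
definition obsXt :: "('d::finite, 'k::finite, 'l::finite) obs \<Rightarrow> ('d, 'k, 'l) xtilde" where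
  "obsXt = (\<lambda>(y, m, c, z, a, x, u). (x, u, z, c))"

text \<open>\<open>\<gamma>\<close> is a coefficient vector of the linear projection of \<open>Z\<close> on \<open>C\<close>: the residual is orthogonal
  in \<open>L\<^sup>2\<close> to every linear function of \<open>C\<close>. The residual does not depend on the choice of \<open>\<gamma>\<close>.\<close>

definition linear_projection :: "('d::finite, 'k::finite, 'l::finite) obs measure \<Rightarrow> real ^ 'd \<Rightarrow> bool" where
  "linear_projection P \<gamma> \<longleftrightarrow>
    integrable P (\<lambda>w. (obsZ w)\<^sup>2) \<and> integrable P (\<lambda>w. (norm (obsC w))\<^sup>2) \<and>
    (\<forall>b. (\<integral>w. (obsZ w - \<gamma> \<bullet> obsC w) * (b \<bullet> obsC w) \<partial>P) = 0)"

definition zperp :: "real ^ 'd \<Rightarrow> ('d::finite, 'k::finite, 'l::finite) obs \<Rightarrow> real" where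
  "zperp \<gamma> w = obsZ w - \<gamma> \<bullet> obsC w"

text \<open>A version of \<open>E[M | A = 1, X\<^sup>~]\<close>, as a function of the observation: the conditional expectation
  under the law of the observation given the event \<open>A = 1\<close>.\<close>

definition reg_annotated :: "('d::finite, 'k::finite, 'l::finite) obs measure \<Rightarrow> ('d, 'k, 'l) obs \<Rightarrow> real" where
  "reg_annotated P =
    real_cond_exp (uniform_measure P {w. obsA w = 1}) (sigma_of P borel obsXt) obsM"

definition is_mu ::
  "('d::finite, 'k::finite, 'l::finite) obs measure \<Rightarrow> (('d, 'k, 'l) xtilde \<Rightarrow> real) \<Rightarrow> bool" where
  "is_mu P \<mu> \<longleftrightarrow> \<mu> \<in> borel_measurable borel \<and>
    (AE w in uniform_measure P {w. obsA w = 1}. \<mu> (obsXt w) = reg_annotated P w)"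

definition is_propensity ::
  "('d::finite, 'k::finite, 'l::finite) obs measure \<Rightarrow> (real ^ 'k \<Rightarrow> real) \<Rightarrow> bool" where
  "is_propensity P \<pi> \<longleftrightarrow> \<pi> \<in> borel_measurable borel \<and>
    (AE w in P. \<pi> (obsX w) =
       real_cond_exp P (sigma_of P borel obsX) (indicator {w. obsA w = 1}) w)"

text \<open>The coefficient \<open>\<gamma>\<close> stays fixed when the law varies: the residual is treated as known.\<close>

definition theta_num :: "real ^ 'd \<Rightarrow> ('d::finite, 'k::finite, 'l::finite) obs measure \<Rightarrow> real" where
  "theta_num \<gamma> P = (\<integral>w. zperp \<gamma> w * obsY w \<partial>P)"

definition theta_den :: "real ^ 'd \<Rightarrow> ('d::finite, 'k::finite, 'l::finite) obs measure \<Rightarrow> real" where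
  "theta_den \<gamma> P = (\<integral>w. zperp \<gamma> w * reg_annotated P w \<partial>P)"

definition theta_ratio :: "real ^ 'd \<Rightarrow> ('d::finite, 'k::finite, 'l::finite) obs measure \<Rightarrow> real" where
  "theta_ratio \<gamma> P = inverse (theta_den \<gamma> P) * theta_num \<gamma> P"

text \<open>The semiparametric model in which the annotation probability \<open>\<pi>(x) = P(A = 1 | X = x)\<close> is known
  and the law is otherwise unrestricted, apart from the support of \<open>(A, M)\<close> entailed by
  \<open>M = A M\<^sup>*\<close> with binary \<open>A\<close>, \<open>M\<^sup>*\<close>. The last condition, \<open>P(A = 1 | X\<^sup>~) > 0\<close> almost surely, makes
  \<open>E[M | A = 1, X\<^sup>~]\<close>, and hence \<^const>\<open>theta_den\<close>, independent of the chosen version.\<close>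

definition known_propensity_model ::
  "(real ^ 'k \<Rightarrow> real) \<Rightarrow> ('d::finite, 'k::finite, 'l::finite) obs measure set" where
  "known_propensity_model \<pi> =
    {Q. prob_space Q \<and> sets Q = sets borel \<and>
        (AE w in Q. obsA w \<in> {0, 1} \<and> obsM w \<in> {0, obsA w}) \<and>
        is_propensity Q \<pi> \<and>
        (AE w in Q. 0 < real_cond_exp Q (sigma_of Q borel obsXt) (indicator {w. obsA w = 1}) w)}"

definition phi_num :: "real ^ 'd \<Rightarrow> ('d::finite, 'k::finite, 'l::finite) obs measure \<Rightarrow> ('d, 'k, 'l) obs \<Rightarrow> real" where
  "phi_num \<gamma> P w = zperp \<gamma> w * obsY w - theta_num \<gamma> P"

definition phi_den ::
  "real ^ 'd \<Rightarrow> (real ^ 'k \<Rightarrow> real) \<Rightarrow> (('d, 'k, 'l) xtilde \<Rightarrow> real)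
    \<Rightarrow> ('d::finite, 'k::finite, 'l::finite) obs measure \<Rightarrow> ('d, 'k, 'l) obs \<Rightarrow> real" where
  "phi_den \<gamma> \<pi> \<mu> P w =
    zperp \<gamma> w * (\<mu> (obsXt w) + obsA w / \<pi> (obsX w) * (obsM w - \<mu> (obsXt w))) - theta_den \<gamma> P"

definition theta_hat ::
  "real ^ 'd \<Rightarrow> (real ^ 'k \<Rightarrow> real) \<Rightarrow> (('d, 'k, 'l) xtilde \<Rightarrow> real)
    \<Rightarrow> nat set \<Rightarrow> (nat \<Rightarrow> ('d::finite, 'k::finite, 'l::finite) obs) \<Rightarrow> real" where
  "theta_hat \<gamma> \<pi> m I w =
    (\<Sum>i\<in>I. zperp \<gamma> (w i) * obsY (w i)) /
    (\<Sum>i\<in>I. zperp \<gamma> (w i) *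
       (m (obsXt (w i)) + obsA (w i) / \<pi> (obsX (w i)) * (obsM (w i) - m (obsXt (w i)))))"

end

theory Submission
  imports Defs
begin

text \<open>
  Contraction of the two conditional independences makes the annotation probability given
  \<open>(X\<^sup>~, M\<^sup>*)\<close> equal to \<open>\<pi>(X)\<close>, so inverse weighting recovers \<open>E[Z\<^sup>\<bottom> M\<^sup>*]\<close> from the annotated
  observations. For the limit law, write the estimator as a ratio: replacing \<open>\<mu>\<close> by its estimate
  changes the denominator by a sum which, given the training fold, has i.i.d. centred terms with
  variance of the order of the squared regression error; what remains is the central limit theorem.

  For the efficiency statements, fix a path of likelihood ratios \<open>f\<close> and let \<open>\<delta>\<close> be the change
  of the regression function along it. Known propensities do not enforce
  \<open>P(A = 1 | X\<^sup>~) = \<pi>(X)\<close> away from \<open>P\<close>, but the denominator functional differs from the integral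
  of its inverse probability weighted score against \<open>f\<close> only by an integral of
  \<open>(f - 1) (1 - A / \<pi>) Z\<^sup>\<bottom> \<delta>\<close>, and \<open>\<delta>\<close> tends to zero in \<open>L\<^sup>2\<close>. The tangent space contains all
  centred square integrable functions that are uncorrelated with \<open>(A - \<pi>(X)) b(X)\<close> for every bounded \<open>b\<close>.
\<close>

subsection \<open>Conditional expectation and conditional independence\<close>

text \<open>Two obstacles shape the proof. The regression function under a perturbed law has no
  closed formula and is never differentiated along the path. Its change \<delta> is controlled only
  through the normal equations under P and under the perturbed law: they bound the second moment of
  \<delta> by 2 / \<eta> times the first absolute moment of f - 1. So \<delta> is merely of order
  sqrt |t| in L2, which is enough because it multiplies a factor of order t. The same
  \<open>weighting_error\<close> multiplies \<delta> here and the estimation error of \<mu> in the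
  cross-fitting remainder, so one orthogonality serves both efficiency and the limit law. The second
  obstacle is the numerator. The assumptions tie (C, Z, U, \<open>Mstar\<close>) to A given X but
  say nothing of the kind about the outcome, so Z^perp Y may be correlated with A - \<pi>(X), and
  its centred version is then a gradient outside the tangent space. Hence efficiency of the
  numerator and of the ratio is claimed under E[Z^perp Y | A, X] = E[Z^perp Y | X].\<close>

lemma sigma_finite_subalgebra_sigma_of:
  assumes "prob_space M" "G \<in> measurable M N"
  shows "sigma_finite_subalgebra M (sigma_of M N G)"
proof (rule finite_measure_subalgebra_is_sigma_finite)
  interpret prob_space M by fact
  show "finite_measure_subalgebra M (sigma_of M N G)"
    using sets_image_in_sets[OF refl assms(2)] by unfold_locales (simp add: subalgebra_def)
qed

lemma measurable_sigma_of_compose: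
  assumes "G \<in> measurable M N" "g \<in> borel_measurable N"
  shows "(\<lambda>x. g (G x)) \<in> borel_measurable (sigma_of M N G)"
  by (rule measurable_compose[OF measurable_vimage_algebra1 assms(2)])
    (use assms(1) in \<open>auto simp: measurable_def\<close>)

text \<open>Every event of the generated algebra is a preimage under G, so the defining property
  need only be tested on indicators of \<open>S (G x)\<close>. Stated this way it applies directly
  to integrals of functions of G.\<close>

lemma real_cond_exp_sigma_of_charact:
  fixes f h :: "'a \<Rightarrow> real"
  assumes M: "prob_space M" and G: "G \<in> measurable M N"
    and f: "integrable M f" and h: "integrable M h" "h \<in> borel_measurable (sigma_of M N G)"
    and eq: "\<And>S. S \<in> sets N \<Longrightarrow> (\<integral>x. indicator S (G x) * f x \<partial>M) = (\<integral>x. indicator S (G x) * h x \<partial>M)"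
  shows "AE x in M. real_cond_exp M (sigma_of M N G) f x = h x"
proof -
  interpret sigma_finite_subalgebra M "sigma_of M N G"
    by (rule sigma_finite_subalgebra_sigma_of) fact+
  show ?thesis
  proof (rule real_cond_exp_charact)
    fix A assume "A \<in> sets (sigma_of M N G)"
    moreover have "sets (sigma_of M N G) = {G -` A \<inter> space M | A. A \<in> sets N}"
      using G by (intro sets_vimage_algebra2) (auto simp: measurable_def)
    ultimately obtain S where S: "S \<in> sets N" "A = G -` S \<inter> space M" by blast
    have "(\<integral>x\<in>A. k x \<partial>M) = (\<integral>x. indicator S (G x) * k x \<partial>M)" for k :: "'a \<Rightarrow> real"
      unfolding set_lebesgue_integral_def S(2)
      by (intro Bochner_Integration.integral_cong) (auto simp: indicator_def)
    then show "(\<integral>x\<in>A. f x \<partial>M) = (\<integral>x\<in>A. h x \<partial>M)"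
      using eq[OF S(1)] by simp
  qed (use f h in auto)
qed

lemma integrable_mult_AE_bounded:
  fixes f k :: "'a \<Rightarrow> real"
  assumes "integrable M f" "k \<in> borel_measurable M" "AE x in M. \<bar>k x\<bar> \<le> c"
  shows "integrable M (\<lambda>x. k x * f x)"
proof (rule Bochner_Integration.integrable_bound)
  show "integrable M (\<lambda>x. c * f x)" using assms(1) by simp
  show "AE x in M. norm (k x * f x) \<le> norm (c * f x)"
    using assms(3)
  proof eventually_elim
    case (elim x)
    then have "\<bar>k x\<bar> * \<bar>f x\<bar> \<le> c * \<bar>f x\<bar>" by (intro mult_right_mono) auto
    then show ?case using elim by (simp add: abs_mult)
  qed
qed (use assms in auto)

lemma integrable_mult_indicator_of:
  fixes f :: "'a \<Rightarrow> real"
  assumes [measurable]: "integrable M f" "G \<in> measurable M N" "S \<in> sets N"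
  shows "integrable M (\<lambda>x. indicator S (G x) * f x)"
  by (rule integrable_mult_AE_bounded[where c = 1]) (auto simp: indicator_def assms)

text \<open>If \<open>f\<close> integrates to zero over every event of \<open>\<sigma>(G)\<close>, its conditional expectation vanishes,
  so it is orthogonal to everything \<open>\<sigma>(G)\<close>-measurable, bounded or not.\<close>

lemma integral_mult_eq_0_of_indicators:
  fixes f :: "'a \<Rightarrow> real"
  assumes M: "prob_space M" and G: "G \<in> measurable M N" and f: "integrable M f"
    and zero: "\<And>S. S \<in> sets N \<Longrightarrow> (\<integral>x. indicator S (G x) * f x \<partial>M) = 0"
    and g: "g \<in> borel_measurable N" "integrable M (\<lambda>x. g (G x) * f x)"
  shows "(\<integral>x. g (G x) * f x \<partial>M) = 0"
proof -
  interpret sigma_finite_subalgebra M "sigma_of M N G"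
    by (rule sigma_finite_subalgebra_sigma_of) fact+
  have "AE x in M. real_cond_exp M (sigma_of M N G) f x = 0"
    by (rule real_cond_exp_sigma_of_charact[OF M G f]) (use zero in auto)
  then have "(\<integral>x. g (G x) * real_cond_exp M (sigma_of M N G) f x \<partial>M) = (\<integral>x. 0 \<partial>M)"
    by (intro integral_cong_AE)
      (auto intro!: borel_measurable_times measurable_compose[OF G g(1)])
  with real_cond_exp_intg(2)[OF g(2) measurable_sigma_of_compose[OF G g(1)]] f show ?thesis by auto
qed

text \<open>Rectangles are stable under intersection and generate the product algebra, and the
  events over which f integrates to zero form a Dynkin system. Since f is signed, this is run on
  integrals instead of comparing two measures.\<close>

lemma integral_indicator_pair_eq_0:
  fixes f :: "'a \<Rightarrow> real"
  assumes M: "prob_space M" and T[measurable]: "T \<in> measurable M NT"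
    and G[measurable]: "G \<in> measurable M NG" and f: "integrable M f"
    and zero: "\<And>B D. B \<in> sets NT \<Longrightarrow> D \<in> sets NG \<Longrightarrow>
      (\<integral>x. indicator B (T x) * indicator D (G x) * f x \<partial>M) = 0"
    and S: "S \<in> sets (NT \<Otimes>\<^sub>M NG)"
  shows "(\<integral>x. indicator S (T x, G x) * f x \<partial>M) = 0"
proof -
  have TG: "(\<lambda>x. (T x, G x)) \<in> measurable M (NT \<Otimes>\<^sub>M NG)" by simp
  note int = integrable_mult_indicator_of[OF f TG]
  have sp: "(T x, G x) \<in> space NT \<times> space NG" if "x \<in> space M" for x
    using that T G by (auto simp: measurable_def)
  have "S \<in> sigma_sets (space NT \<times> space NG) {a \<times> b | a b. a \<in> sets NT \<and> b \<in> sets NG}"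
    using S by (simp add: sets_pair_measure)
  with Int_stable_pair_measure_generator pair_measure_closed show ?thesis
  proof (induction rule: sigma_sets_induct_disjoint)
    case (basic A)
    then obtain B D where "A = B \<times> D" "B \<in> sets NT" "D \<in> sets NG" by auto
    with zero[of B D] show ?case by (simp add: indicator_times)
  next
    case empty then show ?case by simp
  next
    case (compl A)
    then have A: "A \<in> sets (NT \<Otimes>\<^sub>M NG)" by (simp add: sets_pair_measure)
    have "(\<integral>x. indicator (space NT \<times> space NG - A) (T x, G x) * f x \<partial>M)
        = (\<integral>x. f x - indicator A (T x, G x) * f x \<partial>M)"
      by (intro Bochner_Integration.integral_cong) (use sp in \<open>auto simp: indicator_def\<close>)
    also have "\<dots> = (\<integral>x. f x \<partial>M)"
      using compl int[OF A] f by simp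
    \<comment> \<open>The total integral is that over the largest rectangle, so it vanishes too;
      this settles complements.\<close>
    also have "\<dots> = (\<integral>x. indicator (space NT) (T x) * indicator (space NG) (G x) * f x \<partial>M)"
      by (intro Bochner_Integration.integral_cong) (use sp in \<open>auto simp: indicator_def\<close>)
    also have "\<dots> = 0" by (rule zero) auto
    finally show ?case .
  next
    case (union A)
    then have A: "A i \<in> sets (NT \<Otimes>\<^sub>M NG)" for i by (auto simp: sets_pair_measure)
    then have UA: "\<Union>(range A) \<in> sets (NT \<Otimes>\<^sub>M NG)" by auto
    have "(\<lambda>n. \<integral>x. indicator (\<Union>i<n. A i) (T x, G x) * f x \<partial>M)
        \<longlonglongrightarrow> (\<integral>x. indicator (\<Union>(range A)) (T x, G x) * f x \<partial>M)"
    proof (rule integral_dominated_convergence[where w = "\<lambda>x. \<bar>f x\<bar>"])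
      show "AE x in M. (\<lambda>n. indicator (\<Union>i<n. A i) (T x, G x) * f x)
          \<longlonglongrightarrow> indicator (\<Union>(range A)) (T x, G x) * f x"
        by (intro AE_I2 tendsto_mult_right LIMSEQ_indicator_UN)
      show "(\<lambda>x. indicator (\<Union>(range A)) (T x, G x) * f x) \<in> borel_measurable M"
        using int[OF UA] by auto
      have "(\<Union>i<n. A i) \<in> sets (NT \<Otimes>\<^sub>M NG)" for n using A by auto
      from int[OF this] show "(\<lambda>x. indicator (\<Union>i<n. A i) (T x, G x) * f x) \<in> borel_measurable M" for n
        by auto
    qed (use f in \<open>auto simp: indicator_def\<close>)
    moreover have "(\<integral>x. indicator (\<Union>i<n. A i) (T x, G x) * f x \<partial>M) = 0" for n
    proof -
      have "disjoint_family_on A {..<n}"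
        using union by (auto simp: disjoint_family_on_def)
      then have "(\<integral>x. indicator (\<Union>i<n. A i) (T x, G x) * f x \<partial>M)
          = (\<integral>x. (\<Sum>i<n. indicator (A i) (T x, G x) * f x) \<partial>M)"
        by (simp add: indicator_UN_disjoint sum_distrib_right)
      also have "\<dots> = (\<Sum>i<n. \<integral>x. indicator (A i) (T x, G x) * f x \<partial>M)"
        by (intro Bochner_Integration.integral_sum int A)
      finally show ?thesis using union by simp
    qed
    ultimately have "(\<lambda>n::nat. 0) \<longlonglongrightarrow> (\<integral>x. indicator (\<Union>(range A)) (T x, G x) * f x \<partial>M)"
      by simp
    then show ?case by (simp add: LIMSEQ_const_iff)
  qed
qed

section \<open>Conditional independence as an identity of integrals\<close>

lemma cond_indep_commute:
  assumes "cond_indep M NV V NT T NG G"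
  shows "cond_indep M NT T NV V NG G"
  unfolding cond_indep_def
proof (intro ballI)
  fix S B assume "S \<in> sets NT" "B \<in> sets NV"
  then show "AE \<omega> in M.
       real_cond_exp M (sigma_of M NG G) (indicator {\<omega>\<in>space M. T \<omega> \<in> S \<and> V \<omega> \<in> B}) \<omega> =
       real_cond_exp M (sigma_of M NG G) (indicator {\<omega>\<in>space M. T \<omega> \<in> S}) \<omega> *
       real_cond_exp M (sigma_of M NG G) (indicator {\<omega>\<in>space M. V \<omega> \<in> B}) \<omega>"
    using assms by (simp add: cond_indep_def conj_commute mult.commute)
qed

lemma (in prob_space) AE_abs_real_cond_exp_le:
  assumes F: "sigma_finite_subalgebra M F" and f: "f \<in> borel_measurable M" and b: "AE x in M. \<bar>f x\<bar> \<le> c"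
  shows "AE x in M. \<bar>real_cond_exp M F f x\<bar> \<le> c"
proof -
  interpret sub: sigma_finite_subalgebra M F by fact
  have int: "integrable M f" by (rule integrable_const_bound[where B = c]) (use b f in auto)
  have "AE x in M. - c \<le> f x" "AE x in M. f x \<le> c"
    using b by (eventually_elim; linarith)+
  from sub.real_cond_exp_ge_c[OF int this(1)] sub.real_cond_exp_le_c[OF int this(2)]
  show ?thesis by eventually_elim linarith
qed

text \<open>In words, E[f(V) | T, G] = E[f(V) | G]: given G, the variable T does not help to predict
  f(V). The definition offers only a product formula for indicators, and f may be unbounded, so V is
  handled by orthogonality and T by rectangles.\<close>

lemma cond_indep_integral_indicator:
  fixes f :: "'b \<Rightarrow> real"
  assumes M: "prob_space M" and ci: "cond_indep M NV V NT T NG G"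
    and V[measurable]: "V \<in> measurable M NV" and T[measurable]: "T \<in> measurable M NT"
    and G[measurable]: "G \<in> measurable M NG"
    and f[measurable]: "f \<in> borel_measurable NV" and int: "integrable M (\<lambda>x. f (V x))"
    and S: "S \<in> sets (NT \<Otimes>\<^sub>M NG)"
  shows "(\<integral>x. indicator S (T x, G x) * f (V x) \<partial>M)
    = (\<integral>x. indicator S (T x, G x) * real_cond_exp M (sigma_of M NG G) (\<lambda>x. f (V x)) x \<partial>M)"
proof -
  interpret prob_space M by fact
  interpret G: sigma_finite_subalgebra M "sigma_of M NG G"
    by (rule sigma_finite_subalgebra_sigma_of) fact+
  define E where "E = real_cond_exp M (sigma_of M NG G)"
  define q where "q = E (\<lambda>x. f (V x))"
  have q: "integrable M q" "q \<in> borel_measurable (sigma_of M NG G)"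
    using G.real_cond_exp_int(1)[OF int] by (auto simp: q_def E_def)
  have rect: "(\<integral>x. indicator B (T x) * indicator D (G x) * (f (V x) - q x) \<partial>M) = 0"
    if B[measurable]: "B \<in> sets NT" and D[measurable]: "D \<in> sets NG" for B D
  proof -
    define iB where "iB = (indicator {x\<in>space M. T x \<in> B} :: _ \<Rightarrow> real)"
    \<comment> \<open>\<open>k\<close> is the part of the event T in B, localised to G in D, that G
      does not predict. Conditional independence says that no event of V is correlated with
      it.\<close>
    define k where "k x = indicator D (G x) * (iB x - E iB x)" for x
    have iB: "iB \<in> borel_measurable M" "integrable M iB" "AE x in M. \<bar>iB x\<bar> \<le> 1"
      unfolding iB_def by (auto simp: less_top[symmetric] indicator_def)
    have pB: "E iB \<in> borel_measurable (sigma_of M NG G)" "AE x in M. \<bar>E iB x\<bar> \<le> 1"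
      unfolding E_def using AE_abs_real_cond_exp_le[OF G.sigma_finite_subalgebra_axioms iB(1,3)] by auto
    have pB_M: "E iB \<in> borel_measurable M" by (simp add: E_def)
    have D_meas: "(\<lambda>x. indicator D (G x) :: real) \<in> borel_measurable (sigma_of M NG G)"
      by (rule measurable_sigma_of_compose[OF G]) simp
    have k: "k \<in> borel_measurable M" "AE x in M. \<bar>k x\<bar> \<le> 2"
      using iB(1,3) pB pB_M unfolding k_def by (auto simp: indicator_def)
    have k_int: "integrable M k"
      using integrable_mult_AE_bounded[OF integrable_const[of 1] k] by simp
    have "(\<integral>x. indicator R (V x) * k x \<partial>M) = 0" if R[measurable]: "R \<in> sets NV" for R
    proof -
      define iR where "iR = (indicator {x\<in>space M. V x \<in> R} :: _ \<Rightarrow> real)"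
      define iRB where "iRB = (indicator {x\<in>space M. V x \<in> R \<and> T x \<in> B} :: _ \<Rightarrow> real)"
      have meas: "iR \<in> borel_measurable M" "iRB \<in> borel_measurable M"
        and bd: "AE x in M. \<bar>iR x\<bar> \<le> 1" "AE x in M. \<bar>iRB x\<bar> \<le> 1"
        and int': "integrable M iR" "integrable M iRB"
        unfolding iR_def iRB_def by (auto simp: less_top[symmetric] indicator_def)
      have D_iRB: "integrable M (\<lambda>x. indicator D (G x) * iRB x)"
        by (rule integrable_mult_indicator_of[OF int'(2) G D])
      have DpB: "(\<lambda>x. indicator D (G x) * E iB x) \<in> borel_measurable (sigma_of M NG G)"
        using D_meas pB(1) by simp
      have DpB_iR: "integrable M (\<lambda>x. (indicator D (G x) * E iB x) * iR x)"
        by (rule integrable_mult_AE_bounded[OF int'(1), where c = 1])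
          (use pB pB_M in \<open>auto simp: indicator_def\<close>)
      have "(\<integral>x. indicator R (V x) * k x \<partial>M)
          = (\<integral>x. indicator D (G x) * iRB x - (indicator D (G x) * E iB x) * iR x \<partial>M)"
        by (intro Bochner_Integration.integral_cong)
          (auto simp: k_def iRB_def iR_def iB_def indicator_def)
      also have "\<dots> = (\<integral>x. indicator D (G x) * iRB x \<partial>M) - (\<integral>x. (indicator D (G x) * E iB x) * iR x \<partial>M)"
        using D_iRB DpB_iR by simp
      also have "(\<integral>x. indicator D (G x) * iRB x \<partial>M) = (\<integral>x. indicator D (G x) * E iRB x \<partial>M)"
        unfolding E_def by (rule G.real_cond_exp_intg(2)[symmetric, OF D_iRB D_meas meas(2)])
      also have "\<dots> = (\<integral>x. (indicator D (G x) * E iB x) * E iR x \<partial>M)"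
      proof (rule integral_cong_AE)
        have "AE x in M. E iRB x = E iR x * E iB x"
          using ci R B unfolding cond_indep_def E_def iRB_def iR_def iB_def by blast
        then show "AE x in M. indicator D (G x) * E iRB x = (indicator D (G x) * E iB x) * E iR x"
          by eventually_elim simp
      qed (simp_all add: E_def)
      also have "\<dots> = (\<integral>x. (indicator D (G x) * E iB x) * iR x \<partial>M)"
        unfolding E_def using DpB_iR DpB meas(1) by (intro G.real_cond_exp_intg(2)) (auto simp: E_def)
      finally show ?thesis by simp
    qed
    from integral_mult_eq_0_of_indicators[OF M V k_int this f]
    have kf: "(\<integral>x. f (V x) * k x \<partial>M) = 0"
      using integrable_mult_AE_bounded[OF int k] by (simp add: mult.commute)
    have DB_int: "integrable M (\<lambda>x. (indicator D (G x) * iB x) * h x)" if "integrable M h" for h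
      by (rule integrable_mult_AE_bounded[OF that, where c = 1])
        (use iB(1) in \<open>auto simp: indicator_def iB_def\<close>)
    have DpB_int: "integrable M (\<lambda>x. (indicator D (G x) * E iB x) * h x)" if "integrable M h" for h
      by (rule integrable_mult_AE_bounded[OF that, where c = 1])
        (use pB pB_M in \<open>auto simp: indicator_def\<close>)
    have "(\<integral>x. (indicator D (G x) * iB x) * f (V x) \<partial>M) = (\<integral>x. (indicator D (G x) * E iB x) * f (V x) \<partial>M)"
      using kf DB_int[OF int] DpB_int[OF int]
      by (subst (asm) Bochner_Integration.integral_cong[OF refl,
            where g = "\<lambda>x. (indicator D (G x) * iB x) * f (V x) - (indicator D (G x) * E iB x) * f (V x)"])
        (simp_all add: k_def algebra_simps)
    also have "\<dots> = (\<integral>x. (indicator D (G x) * E iB x) * q x \<partial>M)"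
      unfolding q_def E_def
      by (intro G.real_cond_exp_intg(2)[symmetric])
        (use DpB_int[OF int] D_meas pB(1) in \<open>auto simp: E_def\<close>)
    \<comment> \<open>Conditional expectation is self-adjoint. After f(V) has been replaced by q
      against \<open>E iB\<close>, the roles are exchanged and \<open>E iB\<close> is replaced by
      \<open>iB\<close> against q.\<close>
    also have "\<dots> = (\<integral>x. (indicator D (G x) * q x) * E iB x \<partial>M)"
      by (simp add: mult_ac)
    also have "\<dots> = (\<integral>x. (indicator D (G x) * q x) * iB x \<partial>M)"
      unfolding E_def
      by (intro G.real_cond_exp_intg(2))
        (use DB_int[OF q(1)] D_meas q(2) iB(1) in \<open>auto simp: mult_ac\<close>)
    finally have "(\<integral>x. (indicator D (G x) * iB x) * f (V x) \<partial>M) - (\<integral>x. (indicator D (G x) * iB x) * q x \<partial>M) = 0"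
      by (simp add: mult_ac)
    then have "(\<integral>x. (indicator D (G x) * iB x) * f (V x) - (indicator D (G x) * iB x) * q x \<partial>M) = 0"
      using DB_int[OF int] DB_int[OF q(1)] by simp
    moreover have "(\<integral>x. (indicator D (G x) * iB x) * f (V x) - (indicator D (G x) * iB x) * q x \<partial>M)
      = (\<integral>x. indicator B (T x) * indicator D (G x) * (f (V x) - q x) \<partial>M)"
      by (intro Bochner_Integration.integral_cong) (auto simp: iB_def indicator_def)
    ultimately show ?thesis by simp
  qed
  have "(\<integral>x. indicator S (T x, G x) * (f (V x) - q x) \<partial>M) = 0"
    by (rule integral_indicator_pair_eq_0[OF M T G _ rect S]) (use int q in auto)
  moreover have "(\<integral>x. indicator S (T x, G x) * (f (V x) - q x) \<partial>M)
    = (\<integral>x. indicator S (T x, G x) * f (V x) \<partial>M) - (\<integral>x. indicator S (T x, G x) * q x \<partial>M)"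
    using integrable_mult_indicator_of[OF int _ S] integrable_mult_indicator_of[OF q(1) _ S]
    by (simp add: right_diff_distrib)
  ultimately show ?thesis by (simp add: q_def E_def)
qed

subsection \<open>Convergence in probability and in law\<close>

lemma integrable_mult_of_squares:
  fixes f g :: "'a \<Rightarrow> real"
  assumes "f \<in> borel_measurable M" "g \<in> borel_measurable M"
    and "integrable M (\<lambda>x. (f x)\<^sup>2)" "integrable M (\<lambda>x. (g x)\<^sup>2)"
  shows "integrable M (\<lambda>x. f x * g x)"
proof (rule Bochner_Integration.integrable_bound)
  show "integrable M (\<lambda>x. (f x)\<^sup>2 + (g x)\<^sup>2)" using assms by simp
  show "AE x in M. norm (f x * g x) \<le> norm ((f x)\<^sup>2 + (g x)\<^sup>2)"
  proof (rule AE_I2)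
    fix x
    have "2 * (\<bar>f x\<bar> * \<bar>g x\<bar>) \<le> (f x)\<^sup>2 + (g x)\<^sup>2"
      using sum_squares_bound[of "\<bar>f x\<bar>" "\<bar>g x\<bar>"] by simp
    moreover have "0 \<le> \<bar>f x\<bar> * \<bar>g x\<bar>" by simp
    ultimately have "\<bar>f x\<bar> * \<bar>g x\<bar> \<le> (f x)\<^sup>2 + (g x)\<^sup>2" by linarith
    then show "norm (f x * g x) \<le> norm ((f x)\<^sup>2 + (g x)\<^sup>2)" by (simp add: abs_mult)
  qed
qed (use assms in auto)

lemma Cauchy_Schwarz_integral:
  fixes f g :: "'a \<Rightarrow> real"
  assumes [measurable]: "f \<in> borel_measurable M" "g \<in> borel_measurable M"
    and "integrable M (\<lambda>x. (f x)\<^sup>2)" "integrable M (\<lambda>x. (g x)\<^sup>2)"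
  shows "(\<integral>x. \<bar>f x * g x\<bar> \<partial>M) \<le> sqrt (\<integral>x. (f x)\<^sup>2 \<partial>M) * sqrt (\<integral>x. (g x)\<^sup>2 \<partial>M)"
proof -
  have fg: "integrable M (\<lambda>x. \<bar>f x * g x\<bar>)"
    using integrable_mult_of_squares[OF assms] by simp
  have "(ennreal (\<integral>x. \<bar>f x * g x\<bar> \<partial>M))\<^sup>2 = (\<integral>\<^sup>+x. ennreal \<bar>f x\<bar> * ennreal \<bar>g x\<bar> \<partial>M)\<^sup>2"
    using fg by (simp add: nn_integral_eq_integral abs_mult flip: ennreal_mult)
  also have "\<dots> \<le> (\<integral>\<^sup>+x. (ennreal \<bar>f x\<bar>)\<^sup>2 \<partial>M) * (\<integral>\<^sup>+x. (ennreal \<bar>g x\<bar>)\<^sup>2 \<partial>M)"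
    by (rule Cauchy_Schwarz_nn_integral) auto
  also have "\<dots> = ennreal (\<integral>x. (f x)\<^sup>2 \<partial>M) * ennreal (\<integral>x. (g x)\<^sup>2 \<partial>M)"
    using assms by (simp add: ennreal_power nn_integral_eq_integral)
  finally have "(\<integral>x. \<bar>f x * g x\<bar> \<partial>M)\<^sup>2 \<le> (\<integral>x. (f x)\<^sup>2 \<partial>M) * (\<integral>x. (g x)\<^sup>2 \<partial>M)"
    by (simp add: ennreal_power flip: ennreal_mult)
  from real_sqrt_le_mono[OF this] show ?thesis
    by (simp add: real_sqrt_mult)
qed

section \<open>Convergence in probability through second moments\<close>

definition tendsto_zero_in_prob :: "'a measure \<Rightarrow> (nat \<Rightarrow> 'a \<Rightarrow> real) \<Rightarrow> bool" where
  "tendsto_zero_in_prob M X \<longleftrightarrow>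
    (\<forall>\<epsilon>>0. (\<lambda>n. measure M {x\<in>space M. \<epsilon> < \<bar>X n x\<bar>}) \<longlonglongrightarrow> 0)"

text \<open>Chebyshev's inequality with the moment as a nonnegative integral: the cross-fitting
  remainder may have infinite second moment at a given sample size, since only the limit of the
  regression risk is controlled.\<close>

lemma (in prob_space) prob_gt_le_second_moment:
  fixes X :: "'a \<Rightarrow> real"
  assumes [measurable]: "X \<in> borel_measurable M" and "0 < \<epsilon>"
    and b: "(\<integral>\<^sup>+x. ennreal ((X x)\<^sup>2) \<partial>M) \<le> ennreal b" "0 \<le> b"
  shows "prob {x\<in>space M. \<epsilon> < \<bar>X x\<bar>} \<le> b / \<epsilon>\<^sup>2"
proof -
  have "ennreal (prob {x\<in>space M. \<epsilon> < \<bar>X x\<bar>}) = (\<integral>\<^sup>+x. indicator {x\<in>space M. \<epsilon> < \<bar>X x\<bar>} x \<partial>M)"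
    by (simp add: emeasure_eq_measure)
  also have "\<dots> \<le> (\<integral>\<^sup>+x. ennreal (1 / \<epsilon>\<^sup>2) * ennreal ((X x)\<^sup>2) \<partial>M)"
  proof (intro nn_integral_mono)
    fix x
    have "1 \<le> 1 / \<epsilon>\<^sup>2 * (X x)\<^sup>2" if "\<epsilon> < \<bar>X x\<bar>"
      using that \<open>0 < \<epsilon>\<close> power_mono[of \<epsilon> "\<bar>X x\<bar>" 2] by (simp add: field_simps)
    then show "indicator {x\<in>space M. \<epsilon> < \<bar>X x\<bar>} x \<le> ennreal (1 / \<epsilon>\<^sup>2) * ennreal ((X x)\<^sup>2)"
      by (auto simp: indicator_def simp flip: ennreal_mult ennreal_1 intro!: ennreal_leI)
  qed
  also have "\<dots> = ennreal (1 / \<epsilon>\<^sup>2) * (\<integral>\<^sup>+x. ennreal ((X x)\<^sup>2) \<partial>M)"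
    by (rule nn_integral_cmult) simp
  also have "\<dots> \<le> ennreal (1 / \<epsilon>\<^sup>2) * ennreal b" using b by (intro mult_left_mono) auto
  also have "\<dots> = ennreal (b / \<epsilon>\<^sup>2)" using b by (simp flip: ennreal_mult)
  finally show ?thesis using b by (simp add: ennreal_le_iff)
qed

lemma (in prob_space) tendsto_zero_in_prob_of_second_moment:
  assumes X: "\<And>n. X n \<in> borel_measurable M"
    and lim: "(\<lambda>n. \<integral>\<^sup>+x. ennreal ((X n x)\<^sup>2) \<partial>M) \<longlonglongrightarrow> 0"
  shows "tendsto_zero_in_prob M X"
  unfolding tendsto_zero_in_prob_def
proof (intro allI impI)
  fix \<epsilon> :: real assume \<epsilon>: "0 < \<epsilon>"
  show "(\<lambda>n. prob {x\<in>space M. \<epsilon> < \<bar>X n x\<bar>}) \<longlonglongrightarrow> 0"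
  proof (rule LIMSEQ_I)
    fix r :: real assume "0 < r"
    define b where "b = r / 2 * \<epsilon>\<^sup>2"
    have b: "0 < b" using \<open>0 < r\<close> \<epsilon> by (simp add: b_def)
    then have "\<forall>\<^sub>F n in sequentially. (\<integral>\<^sup>+x. ennreal ((X n x)\<^sup>2) \<partial>M) < ennreal b"
      by (intro order_tendstoD(2)[OF lim]) simp
    then obtain N where N: "\<And>n. n \<ge> N \<Longrightarrow> (\<integral>\<^sup>+x. ennreal ((X n x)\<^sup>2) \<partial>M) < ennreal b"
      by (auto simp: eventually_sequentially)
    have "prob {x\<in>space M. \<epsilon> < \<bar>X n x\<bar>} < r" if "n \<ge> N" for n
    proof -
      have "prob {x\<in>space M. \<epsilon> < \<bar>X n x\<bar>} \<le> b / \<epsilon>\<^sup>2"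
        using N[OF that] b \<epsilon> X by (intro prob_gt_le_second_moment) auto
      also have "\<dots> < r" using \<epsilon> \<open>0 < r\<close> by (simp add: b_def)
      finally show ?thesis .
    qed
    then show "\<exists>N. \<forall>n\<ge>N. norm (prob {x\<in>space M. \<epsilon> < \<bar>X n x\<bar>} - 0) < r" by auto
  qed
qed

text \<open>A uniform second moment bound makes X tight: outside an event of small probability X is
  at most K, and there the product is large only if Y exceeds \<epsilon> / K.\<close>

lemma (in prob_space) tendsto_zero_in_prob_mult_L2_bounded:
  assumes X[measurable]: "\<And>n. X n \<in> borel_measurable M" and Y[measurable]: "\<And>n. Y n \<in> borel_measurable M"
    and Y0: "tendsto_zero_in_prob M Y"
    and b: "\<And>n. (\<integral>\<^sup>+x. ennreal ((X n x)\<^sup>2) \<partial>M) \<le> ennreal b" "0 \<le> b"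
  shows "tendsto_zero_in_prob M (\<lambda>n x. X n x * Y n x)"
  unfolding tendsto_zero_in_prob_def
proof (intro allI impI)
  fix \<epsilon> :: real assume \<epsilon>: "0 < \<epsilon>"
  show "(\<lambda>n. prob {x\<in>space M. \<epsilon> < \<bar>X n x * Y n x\<bar>}) \<longlonglongrightarrow> 0"
  proof (rule LIMSEQ_I)
    fix r :: real assume r: "0 < r"
    \<comment> \<open>Chosen so that b / K^2 = (r / 2) b / (b + 1) is below r / 2; the added 1 keeps
      K positive when b = 0.\<close>
    define K where "K = sqrt (2 * (b + 1) / r)"
    have K: "0 < K" "b / K\<^sup>2 < r / 2 + 0"
      using b(2) r by (auto simp: K_def field_simps)
    have "(\<lambda>n. prob {x\<in>space M. \<epsilon> / K < \<bar>Y n x\<bar>}) \<longlonglongrightarrow> 0"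
      using Y0 \<epsilon> K by (simp add: tendsto_zero_in_prob_def)
    then obtain N where N: "\<And>n. n \<ge> N \<Longrightarrow> prob {x\<in>space M. \<epsilon> / K < \<bar>Y n x\<bar>} < r / 2"
      using LIMSEQ_D[of _ 0 "r / 2"] r by (fastforce simp: abs_if split: if_splits)
    have "prob {x\<in>space M. \<epsilon> < \<bar>X n x * Y n x\<bar>} < r" if "n \<ge> N" for n
    proof -
      have "prob {x\<in>space M. \<epsilon> < \<bar>X n x * Y n x\<bar>}
          \<le> prob ({x\<in>space M. K < \<bar>X n x\<bar>} \<union> {x\<in>space M. \<epsilon> / K < \<bar>Y n x\<bar>})"
      proof (intro finite_measure_mono)
        have "\<epsilon> / K < \<bar>Y n x\<bar>" if "\<epsilon> < \<bar>X n x * Y n x\<bar>" "\<not> K < \<bar>X n x\<bar>" for x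
        proof -
          have "\<bar>X n x\<bar> * \<bar>Y n x\<bar> \<le> K * \<bar>Y n x\<bar>" using that by (intro mult_right_mono) auto
          then show ?thesis using that K by (simp add: abs_mult field_simps)
        qed
        then show "{x\<in>space M. \<epsilon> < \<bar>X n x * Y n x\<bar>}
          \<subseteq> {x\<in>space M. K < \<bar>X n x\<bar>} \<union> {x\<in>space M. \<epsilon> / K < \<bar>Y n x\<bar>}" by auto
      qed simp
      also have "\<dots> \<le> prob {x\<in>space M. K < \<bar>X n x\<bar>} + prob {x\<in>space M. \<epsilon> / K < \<bar>Y n x\<bar>}"
        by (rule measure_Un_le) auto
      also have "prob {x\<in>space M. K < \<bar>X n x\<bar>} \<le> b / K\<^sup>2"
        by (intro prob_gt_le_second_moment K b) simp
      finally show ?thesis using K(2) N[OF that] by linarith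
    qed
    then show "\<exists>N. \<forall>n\<ge>N. norm (prob {x\<in>space M. \<epsilon> < \<bar>X n x * Y n x\<bar>} - 0) < r" by auto
  qed
qed

text \<open>Slutsky's argument for a ratio, from T - G / c = (- a R - G (D - c) / c) / D. The
  estimated denominator D may vanish, so the formula for T is assumed only where it does not, and
  near c it does not.\<close>

lemma (in prob_space) tendsto_zero_in_prob_ratio:
  fixes G D R T :: "nat \<Rightarrow> 'a \<Rightarrow> real"
  assumes [measurable]: "\<And>n. G n \<in> borel_measurable M" "\<And>n. D n \<in> borel_measurable M"
      "\<And>n. R n \<in> borel_measurable M" "\<And>n. T n \<in> borel_measurable M"
    and T: "\<And>n x. x \<in> space M \<Longrightarrow> D n x \<noteq> 0 \<Longrightarrow> T n x = (G n x - a * R n x) / D n x"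
    and c: "c \<noteq> 0" and b: "\<And>n. (\<integral>\<^sup>+x. ennreal ((G n x)\<^sup>2) \<partial>M) \<le> ennreal b" "0 \<le> b"
    and D0: "tendsto_zero_in_prob M (\<lambda>n x. D n x - c)" and R0: "tendsto_zero_in_prob M R"
  shows "tendsto_zero_in_prob M (\<lambda>n x. T n x - G n x / c)"
  unfolding tendsto_zero_in_prob_def
proof (intro allI impI)
  fix \<epsilon> :: real assume \<epsilon>: "0 < \<epsilon>"
  \<comment> \<open>Off the three exceptional events the numerator of the difference is at most 2
    \<delta> and |D| is at least |c| / 2, so the quotient is at most 4 \<delta> / |c| =
    \<epsilon>.\<close>
  define \<delta> where "\<delta> = \<epsilon> * \<bar>c\<bar> / 4"
  have \<delta>: "0 < \<delta>" using \<epsilon> c by (simp add: \<delta>_def)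
  have GD0: "tendsto_zero_in_prob M (\<lambda>n x. G n x * (D n x - c))"
    by (rule tendsto_zero_in_prob_mult_L2_bounded[OF _ _ D0 b]) auto
  \<comment> \<open>Dividing by |a| + 1 instead of |a| allows a = 0.\<close>
  let ?p = "\<lambda>n. prob {x\<in>space M. \<bar>c\<bar> / 2 < \<bar>D n x - c\<bar>} + prob {x\<in>space M. \<delta> / (\<bar>a\<bar> + 1) < \<bar>R n x\<bar>}
    + prob {x\<in>space M. \<delta> * \<bar>c\<bar> < \<bar>G n x * (D n x - c)\<bar>}"
  have lim: "?p \<longlonglongrightarrow> 0 + 0 + 0"
  proof (intro tendsto_add)
    have "0 < \<bar>c\<bar> / 2" "0 < \<delta> / (\<bar>a\<bar> + 1)" "0 < \<delta> * \<bar>c\<bar>" using \<delta> c by auto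
    then show "(\<lambda>n. prob {x\<in>space M. \<bar>c\<bar> / 2 < \<bar>D n x - c\<bar>}) \<longlonglongrightarrow> 0"
      "(\<lambda>n. prob {x\<in>space M. \<delta> / (\<bar>a\<bar> + 1) < \<bar>R n x\<bar>}) \<longlonglongrightarrow> 0"
      "(\<lambda>n. prob {x\<in>space M. \<delta> * \<bar>c\<bar> < \<bar>G n x * (D n x - c)\<bar>}) \<longlonglongrightarrow> 0"
      using D0 R0 GD0 unfolding tendsto_zero_in_prob_def by blast+
  qed
  have incl: "\<bar>T n x - G n x / c\<bar> \<le> \<epsilon>"
    if x: "x \<in> space M" and 1: "\<bar>D n x - c\<bar> \<le> \<bar>c\<bar> / 2" and 2: "\<bar>R n x\<bar> \<le> \<delta> / (\<bar>a\<bar> + 1)" and 3: "\<bar>G n x * (D n x - c)\<bar> \<le> \<delta> * \<bar>c\<bar>" for n x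
  proof -
    have D: "\<bar>c\<bar> / 2 \<le> \<bar>D n x\<bar>" "0 < \<bar>D n x\<bar>" using 1 c by linarith+
    have aR: "\<bar>a * R n x\<bar> \<le> \<delta>"
    proof -
      have "\<bar>a\<bar> * \<bar>R n x\<bar> \<le> (\<bar>a\<bar> + 1) * (\<delta> / (\<bar>a\<bar> + 1))"
        using 2 by (intro mult_mono) auto
      also have "\<dots> = \<delta>" by (simp add: add_nonneg_eq_0_iff)
      finally show ?thesis by (simp add: abs_mult)
    qed
    have GD: "\<bar>G n x * (D n x - c) / c\<bar> \<le> \<delta>"
      using 3 c by (simp add: abs_mult field_simps)
    have "(G n x - a * R n x) / D n x - G n x / c
        = (- (a * R n x) - G n x * (D n x - c) / c) / D n x"
      using c D by (simp add: field_simps)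
    then have "\<bar>(G n x - a * R n x) / D n x - G n x / c\<bar>
        = \<bar>- (a * R n x) - G n x * (D n x - c) / c\<bar> / \<bar>D n x\<bar>" by simp
    also have "\<dots> \<le> (2 * \<delta>) / (\<bar>c\<bar> / 2)"
    proof (rule frac_le)
      show "\<bar>- (a * R n x) - G n x * (D n x - c) / c\<bar> \<le> 2 * \<delta>"
        using abs_triangle_ineq4[of "- (a * R n x)" "G n x * (D n x - c) / c"] aR GD by simp
    qed (use D c \<delta> in auto)
    also have "\<dots> = \<epsilon>" using c by (simp add: \<delta>_def)
    finally show ?thesis using T[of x n, OF x] D(2) by simp
  qed
  show "(\<lambda>n. prob {x\<in>space M. \<epsilon> < \<bar>T n x - G n x / c\<bar>}) \<longlonglongrightarrow> 0"
  proof (rule tendsto_sandwich[OF _ _ tendsto_const])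
    show "?p \<longlonglongrightarrow> 0" using lim by simp
    have "prob {x\<in>space M. \<epsilon> < \<bar>T n x - G n x / c\<bar>} \<le> ?p n" for n
    proof -
      have "prob {x\<in>space M. \<epsilon> < \<bar>T n x - G n x / c\<bar>}
        \<le> prob (({x\<in>space M. \<bar>c\<bar> / 2 < \<bar>D n x - c\<bar>} \<union> {x\<in>space M. \<delta> / (\<bar>a\<bar> + 1) < \<bar>R n x\<bar>})
            \<union> {x\<in>space M. \<delta> * \<bar>c\<bar> < \<bar>G n x * (D n x - c)\<bar>})"
        using incl[of _ n] by (intro finite_measure_mono) (auto simp: not_less[symmetric])
      also have "\<dots> \<le> prob ({x\<in>space M. \<bar>c\<bar> / 2 < \<bar>D n x - c\<bar>} \<union> {x\<in>space M. \<delta> / (\<bar>a\<bar> + 1) < \<bar>R n x\<bar>})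
          + prob {x\<in>space M. \<delta> * \<bar>c\<bar> < \<bar>G n x * (D n x - c)\<bar>}"
        by (rule measure_Un_le) auto
      also have "\<dots> \<le> ?p n"
        by (intro add_right_mono measure_Un_le) auto
      finally show ?thesis .
    qed
    then show "\<forall>\<^sub>F n in sequentially.
      prob {x\<in>space M. \<epsilon> < \<bar>T n x - G n x / c\<bar>} \<le> ?p n" by simp
  qed simp
qed

section \<open>Convergence in law through characteristic functions\<close>

lemma norm_iexp_diff_le: "cmod (iexp a - iexp b) \<le> \<bar>a - b\<bar>" "cmod (iexp a - iexp b) \<le> 2"
proof -
  have "iexp a - iexp b = iexp b * (iexp (a - b) - 1)"
    by (simp add: exp_diff right_diff_distrib)
  then have "cmod (iexp a - iexp b) = cmod (iexp (a - b) - 1)"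
    by (simp add: norm_mult)
  also have "\<dots> \<le> \<bar>a - b\<bar>" using iexp_approx1[of "a - b" 0] by simp
  finally show "cmod (iexp a - iexp b) \<le> \<bar>a - b\<bar>" .
  show "cmod (iexp a - iexp b) \<le> 2"
    using norm_triangle_ineq4[of "iexp a" "iexp b"] by simp
qed

text \<open>The characteristic functions differ by at most |t| \<epsilon> where the variables are
  \<epsilon>-close and by at most 2 elsewhere, hence have the same limit; Levy's theorem returns to
  laws.\<close>

lemma (in prob_space) weak_conv_m_converging_together:
  assumes X[measurable]: "\<And>n. X n \<in> borel_measurable M" and Y[measurable]: "\<And>n. Y n \<in> borel_measurable M"
    and L: "real_distribution L" and conv: "weak_conv_m (\<lambda>n. distr M borel (X n)) L"
    and d: "tendsto_zero_in_prob M (\<lambda>n x. Y n x - X n x)"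
  shows "weak_conv_m (\<lambda>n. distr M borel (Y n)) L"
proof (rule levy_continuity[OF _ L])
  show "real_distribution (distr M borel (Y n))" for n by (rule real_distribution_distr) simp
  fix t :: real
  have charX: "(\<lambda>n. char (distr M borel (X n)) t) \<longlonglongrightarrow> char L t"
    by (rule levy_continuity1[OF _ L conv]) (simp add: real_distribution_distr)
  have "(\<lambda>n. char (distr M borel (Y n)) t - char (distr M borel (X n)) t) \<longlonglongrightarrow> 0"
  proof (rule LIMSEQ_I)
    fix r :: real assume r: "0 < r"
    \<comment> \<open>Closeness costs at most r / 2 and the exceptional event at most 2 times r / 4.
      The added 1 covers t = 0.\<close>
    define \<epsilon> where "\<epsilon> = r / (2 * (\<bar>t\<bar> + 1))"
    have \<epsilon>: "0 < \<epsilon>" "\<bar>t\<bar> * \<epsilon> \<le> r / 2" using r by (auto simp: \<epsilon>_def field_simps)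
    have "(\<lambda>n. prob {x\<in>space M. \<epsilon> < \<bar>Y n x - X n x\<bar>}) \<longlonglongrightarrow> 0"
      using d \<epsilon> by (simp add: tendsto_zero_in_prob_def)
    then obtain N where N: "\<And>n. n \<ge> N \<Longrightarrow> prob {x\<in>space M. \<epsilon> < \<bar>Y n x - X n x\<bar>} < r / 4"
      using LIMSEQ_D[of _ 0 "r / 4"] r by (fastforce simp: abs_if split: if_splits)
    have "cmod (char (distr M borel (Y n)) t - char (distr M borel (X n)) t) < r" if "n \<ge> N" for n
    proof -
      let ?B = "{x\<in>space M. \<epsilon> < \<bar>Y n x - X n x\<bar>}"
      have intY: "integrable M (\<lambda>x. iexp (t * Y n x))" and intX: "integrable M (\<lambda>x. iexp (t * X n x))"
        by (intro integrable_iexp; simp)+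
      have "char (distr M borel (Y n)) t - char (distr M borel (X n)) t
          = (\<integral>x. iexp (t * Y n x) - iexp (t * X n x) \<partial>M)"
        using intX intY by (simp add: char_def integral_distr)
      also have "cmod \<dots> \<le> (\<integral>x. cmod (iexp (t * Y n x) - iexp (t * X n x)) \<partial>M)"
        by (rule integral_norm_bound)
      also have "\<dots> \<le> (\<integral>x. r / 2 + 2 * indicator ?B x \<partial>M)"
      proof (rule integral_mono)
        show "integrable M (\<lambda>x. cmod (iexp (t * Y n x) - iexp (t * X n x)))"
          using intX intY by (intro integrable_norm) simp
        show "integrable M (\<lambda>x. r / 2 + 2 * indicator ?B x)"
          by (auto simp: less_top[symmetric])
        fix x assume x: "x \<in> space M"
        show "cmod (iexp (t * Y n x) - iexp (t * X n x)) \<le> r / 2 + 2 * indicator ?B x"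
        proof (cases "x \<in> ?B")
          case True
          then show ?thesis using norm_iexp_diff_le(2)[of "t * Y n x" "t * X n x"] r by simp
        next
          case False
          have "cmod (iexp (t * Y n x) - iexp (t * X n x)) \<le> \<bar>t * Y n x - t * X n x\<bar>"
            by (rule norm_iexp_diff_le)
          also have "\<dots> = \<bar>t\<bar> * \<bar>Y n x - X n x\<bar>" by (simp add: abs_mult flip: right_diff_distrib)
          also have "\<dots> \<le> \<bar>t\<bar> * \<epsilon>" using False x by (intro mult_left_mono) auto
          finally show ?thesis using \<epsilon> False by simp
        qed
      qed
      also have "\<dots> = r / 2 + 2 * prob ?B"
        by (simp add: less_top[symmetric] prob_space)
      also have "\<dots> < r" using N[OF that] by simp
      finally show ?thesis .
    qed
    then show "\<exists>N. \<forall>n\<ge>N. cmod (char (distr M borel (Y n)) t - char (distr M borel (X n)) t - 0) < r"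
      by auto
  qed
  from tendsto_add[OF this charX] show "(\<lambda>n. char (distr M borel (Y n)) t) \<longlonglongrightarrow> char L t" by simp
qed

text \<open>Scaling a standard normal variable covers the point mass and the nondegenerate case at
  once, so the characteristic function below needs no case distinction.\<close>

lemma normal_law_eq_distr:
  assumes "0 \<le> v"
  shows "normal_law 0 v = distr std_normal_distribution borel (\<lambda>x. sqrt v * x)"
proof (cases "v = 0")
  case True
  interpret real_distribution std_normal_distribution by (rule real_dist_normal_dist)
  show ?thesis using True distr_const[of 0 borel] by (simp add: normal_law_def)
next
  case False
  interpret prob_space std_normal_distribution
    using real_dist_normal_dist by (simp add: real_distribution_def)
  have "distributed std_normal_distribution lborel (\<lambda>x. x) std_normal_density"
    unfolding distributed_def by (simp add: distr_id2)
  from normal_density_affine[OF this, of "sqrt v" 0] False assms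
  have "distributed std_normal_distribution lborel (\<lambda>x. sqrt v * x) (normal_density 0 (sqrt v))"
    by simp
  then have "distr std_normal_distribution lborel (\<lambda>x. sqrt v * x) = density lborel (normal_density 0 (sqrt v))"
    by (simp add: distributed_def)
  moreover have "distr std_normal_distribution lborel (\<lambda>x. sqrt v * x) = distr std_normal_distribution borel (\<lambda>x. sqrt v * x)"
    by (rule distr_cong) auto
  ultimately show ?thesis using False by (simp add: normal_law_def)
qed

lemma real_distribution_normal_law: "0 \<le> v \<Longrightarrow> real_distribution (normal_law 0 v)"
  using real_dist_normal_dist unfolding real_distribution_def
  by (auto simp: normal_law_eq_distr real_distribution_axioms_def intro!: prob_space.prob_space_distr)

lemma char_normal_law: "0 \<le> v \<Longrightarrow> char (normal_law 0 v) t = exp (- (v * t\<^sup>2) / 2)"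
proof -
  assume v: "0 \<le> v"
  have "char (normal_law 0 v) t = (\<integral>x. iexp (t * (sqrt v * x)) \<partial>std_normal_distribution)"
    unfolding normal_law_eq_distr[OF v] char_def by (subst integral_distr) auto
  also have "\<dots> = char std_normal_distribution (t * sqrt v)"
    by (simp add: char_def mult_ac)
  also have "\<dots> = exp (- (v * t\<^sup>2) / 2)"
    using v by (simp only: char_std_normal_distribution power_mult_distrib real_sqrt_pow2 mult.commute)
  finally show ?thesis .
qed

section \<open>Sums over i.i.d. samples\<close>

locale iid_sample = prob_space M for M :: "'a measure" +
  fixes W :: "nat \<Rightarrow> 'a \<Rightarrow> 'b::topological_space" and P :: "'b measure"
  assumes indep: "indep_vars (\<lambda>_. borel) W UNIV"
    and distr_W: "\<And>i. distr M borel (W i) = P"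
begin

lemma W_rv [measurable]: "W i \<in> borel_measurable M"
  using indep by (simp add: indep_vars_def2)

lemma sets_P [simp, measurable_cong]: "sets P = sets borel"
  using distr_W[of 0] by (metis sets_distr)

lemma space_P [simp]: "space P = UNIV"
  using sets_eq_imp_space_eq[OF sets_P] by simp

lemma prob_space_P: "prob_space P"
  unfolding distr_W[of 0, symmetric] by (rule prob_space_distr) simp

lemma integral_W:
  fixes g :: "'b \<Rightarrow> real"
  shows "g \<in> borel_measurable borel \<Longrightarrow> (\<integral>x. g (W i x) \<partial>M) = (\<integral>w. g w \<partial>P)"
  unfolding distr_W[of i, symmetric] by (subst integral_distr) auto

lemma integrable_W:
  fixes g :: "'b \<Rightarrow> real"
  shows "g \<in> borel_measurable borel \<Longrightarrow> integrable M (\<lambda>x. g (W i x)) \<longleftrightarrow> integrable P g"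
  unfolding distr_W[of i, symmetric] by (subst integrable_distr_eq) auto

lemma AE_W:
  "{w. Q w} \<in> sets borel \<Longrightarrow> (AE x in M. Q (W i x)) \<longleftrightarrow> (AE w in P. Q w)"
  unfolding distr_W[of i, symmetric] by (subst AE_distr_iff) auto

text \<open>Each added summand is independent of the partial sum and centred, so the cross term
  vanishes and the variances add up.\<close>

lemma square_integral_sum:
  fixes g :: "'b \<Rightarrow> real"
  assumes g[measurable]: "g \<in> borel_measurable borel" and g2: "integrable P (\<lambda>w. (g w)\<^sup>2)"
    and g0: "(\<integral>w. g w \<partial>P) = 0" and J: "finite J"
  shows "integrable M (\<lambda>x. (\<Sum>i\<in>J. g (W i x))\<^sup>2)"
    and "(\<integral>x. (\<Sum>i\<in>J. g (W i x))\<^sup>2 \<partial>M) = card J * (\<integral>w. (g w)\<^sup>2 \<partial>P)"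
proof -
  have gW2: "integrable M (\<lambda>x. (g (W i x))\<^sup>2)" for i
    using integrable_W[of "\<lambda>w. (g w)\<^sup>2" i] g2 by simp
  have gW: "integrable M (\<lambda>x. g (W i x))" for i
    by (rule square_integrable_imp_integrable) (use gW2 in auto)
  have iX: "indep_vars (\<lambda>_. borel) (\<lambda>i x. g (W i x)) UNIV"
    by (rule indep_vars_compose2[OF indep]) simp
  have "integrable M (\<lambda>x. (\<Sum>i\<in>J. g (W i x))\<^sup>2) \<and>
    (\<integral>x. (\<Sum>i\<in>J. g (W i x))\<^sup>2 \<partial>M) = card J * (\<integral>w. (g w)\<^sup>2 \<partial>P)"
    using J
  proof (induction J)
    case (insert a J)
    let ?S = "\<lambda>x. \<Sum>i\<in>J. g (W i x)"
    have intS: "integrable M ?S" using gW by simp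
    have ind: "indep_var borel (\<lambda>x. g (W a x)) borel ?S"
      by (rule indep_vars_sum[OF insert(1,2) indep_vars_subset[OF iX]]) simp
    have cross: "integrable M (\<lambda>x. g (W a x) * ?S x)" "(\<integral>x. g (W a x) * ?S x \<partial>M) = 0"
      using indep_var_integrable[OF ind gW intS] indep_var_lebesgue_integral[OF ind gW intS]
        integral_W[OF g, of a] g0 by auto
    have eq: "(\<Sum>i\<in>insert a J. g (W i x))\<^sup>2 = (g (W a x))\<^sup>2 + (2 * (g (W a x) * ?S x) + (?S x)\<^sup>2)" for x
      using insert by (simp add: power2_sum)
    have "(\<integral>x. (g (W a x))\<^sup>2 \<partial>M) = (\<integral>w. (g w)\<^sup>2 \<partial>P)" by (rule integral_W) simp
    then show ?case
      unfolding eq using insert cross gW2[of a] by (simp add: algebra_simps)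
  qed simp
  then show "integrable M (\<lambda>x. (\<Sum>i\<in>J. g (W i x))\<^sup>2)"
    "(\<integral>x. (\<Sum>i\<in>J. g (W i x))\<^sup>2 \<partial>M) = card J * (\<integral>w. (g w)\<^sup>2 \<partial>P)" by auto
qed

lemma nn_integral_square_sum:
  fixes g :: "'b \<Rightarrow> real"
  assumes g[measurable]: "g \<in> borel_measurable borel" and g2: "integrable P (\<lambda>w. (g w)\<^sup>2)"
    and g0: "(\<integral>w. g w \<partial>P) = 0" and J: "finite J"
  shows "(\<integral>\<^sup>+x. ennreal ((\<Sum>i\<in>J. g (W i x))\<^sup>2) \<partial>M) = ennreal (card J * (\<integral>w. (g w)\<^sup>2 \<partial>P))"
  using square_integral_sum[OF assms] by (simp add: nn_integral_eq_integral)

text \<open>Conditionally on the sample indexed by \<open>J'\<close>, the summands are i.i.d. and centred.\<close>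

lemma nn_integral_square_cross_fit_le:
  fixes k :: "(nat \<Rightarrow> 'b) \<Rightarrow> 'b \<Rightarrow> real"
  assumes k: "(\<lambda>(D, w). k D w) \<in> borel_measurable ((\<Pi>\<^sub>M i\<in>J'. borel) \<Otimes>\<^sub>M borel)"
    and k0: "\<And>D. D \<in> space (\<Pi>\<^sub>M i\<in>J'. (borel :: 'b measure)) \<Longrightarrow> integrable P (\<lambda>w. (k D w)\<^sup>2) \<Longrightarrow> (\<integral>w. k D w \<partial>P) = 0"
    and J: "finite J" "J \<inter> J' = {}"
  shows "(\<integral>\<^sup>+x. ennreal ((\<Sum>i\<in>J. k (\<lambda>i\<in>J'. W i x) (W i x))\<^sup>2) \<partial>M)
    \<le> card J * (\<integral>\<^sup>+x. (\<integral>\<^sup>+w. ennreal ((k (\<lambda>i\<in>J'. W i x) w)\<^sup>2) \<partial>P) \<partial>M)"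
proof -
  let ?D = "\<lambda>x. \<lambda>i\<in>J'. W i x" and ?V = "\<lambda>x. \<lambda>i\<in>J. W i x"
  let ?MD = "\<Pi>\<^sub>M i\<in>J'. (borel :: 'b measure)" and ?MV = "\<Pi>\<^sub>M i\<in>J. (borel :: 'b measure)"
  define F where "F = (\<lambda>(D, v). ennreal ((\<Sum>i\<in>J. k D (v i))\<^sup>2))"
  have kc: "(\<lambda>(D, v). k D (v i)) \<in> borel_measurable (?MD \<Otimes>\<^sub>M ?MV)" if "i \<in> J" for i
  proof -
    have "(\<lambda>p. (fst p, snd p i)) \<in> measurable (?MD \<Otimes>\<^sub>M ?MV) (?MD \<Otimes>\<^sub>M borel)"
      using that by measurable
    from measurable_compose[OF this k] show ?thesis by (simp add: case_prod_unfold)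
  qed
  have F[measurable]: "F \<in> borel_measurable (?MD \<Otimes>\<^sub>M ?MV)"
    using kc unfolding F_def case_prod_unfold by simp
  have kD: "k D \<in> borel_measurable borel" if "D \<in> space ?MD" for D
    using measurable_compose[OF measurable_Pair1'[OF that] k] by simp
  have D[measurable]: "?D \<in> measurable M ?MD" and V[measurable]: "?V \<in> measurable M ?MV"
    by measurable
  \<comment> \<open>Disjoint folds are independent blocks, so their joint law is a product and
    Tonelli integrates out the evaluation fold with the training fold frozen.\<close>
  have "indep_var ?MD ?D ?MV ?V"
    using J by (intro indep_var_restrict[OF indep]) auto
  then have joint: "distr M ?MD ?D \<Otimes>\<^sub>M distr M ?MV ?V = distr M (?MD \<Otimes>\<^sub>M ?MV) (\<lambda>x. (?D x, ?V x))"
    by (simp add: indep_var_distribution_eq)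
  interpret V: prob_space "distr M ?MV ?V" by (rule prob_space_distr) simp
  have "(\<integral>\<^sup>+x. ennreal ((\<Sum>i\<in>J. k (?D x) (W i x))\<^sup>2) \<partial>M) = (\<integral>\<^sup>+x. F (?D x, ?V x) \<partial>M)"
    by (simp add: F_def)
  also have "\<dots> = (\<integral>\<^sup>+p. F p \<partial>distr M (?MD \<Otimes>\<^sub>M ?MV) (\<lambda>x. (?D x, ?V x)))"
    by (subst nn_integral_distr) auto
  also have "\<dots> = (\<integral>\<^sup>+D. \<integral>\<^sup>+v. F (D, v) \<partial>distr M ?MV ?V \<partial>distr M ?MD ?D)"
    unfolding joint[symmetric] by (rule V.nn_integral_fst[symmetric]) simp
  also have "\<dots> = (\<integral>\<^sup>+x. \<integral>\<^sup>+v. F (?D x, v) \<partial>distr M ?MV ?V \<partial>M)"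
    by (subst nn_integral_distr) auto
  also have "\<dots> \<le> (\<integral>\<^sup>+x. card J * (\<integral>\<^sup>+w. ennreal ((k (?D x) w)\<^sup>2) \<partial>P) \<partial>M)"
  proof (rule nn_integral_mono)
    fix x assume x: "x \<in> space M"
    let ?E = "?D x"
    have E: "?E \<in> space ?MD" using D x by (rule measurable_space)
    note kE[measurable] = kD[OF E]
    have "(\<integral>\<^sup>+v. F (?E, v) \<partial>distr M ?MV ?V) = (\<integral>\<^sup>+y. F (?E, ?V y) \<partial>M)"
      by (rule nn_integral_distr) (auto intro!: measurable_compose[OF measurable_Pair1'[OF E] F])
    also have "\<dots> = (\<integral>\<^sup>+y. ennreal ((\<Sum>i\<in>J. k ?E (W i y))\<^sup>2) \<partial>M)"
      by (simp add: F_def)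
    also have "\<dots> \<le> card J * (\<integral>\<^sup>+w. ennreal ((k ?E w)\<^sup>2) \<partial>P)"
    \<comment> \<open>Centring is known only for training samples at which k is square integrable.
      At the others the right side is infinite, provided that its factor \<open>card J\<close> is
      not zero.\<close>
    proof (cases "J = {}")
      case False
      then have cJ: "card J > 0" using J by (simp add: card_gt_0_iff)
      show ?thesis
      proof (cases "integrable P (\<lambda>w. (k ?E w)\<^sup>2)")
        case True
        then have "(\<integral>\<^sup>+y. ennreal ((\<Sum>i\<in>J. k ?E (W i y))\<^sup>2) \<partial>M) = ennreal (card J * (\<integral>w. (k ?E w)\<^sup>2 \<partial>P))"
          by (intro nn_integral_square_sum k0 E J) auto
        also have "\<dots> = card J * (\<integral>\<^sup>+w. ennreal ((k ?E w)\<^sup>2) \<partial>P)"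
          using True by (simp add: nn_integral_eq_integral ennreal_mult ennreal_of_nat_eq_real_of_nat)
        finally show ?thesis by simp
      next
        case False
        have "(\<integral>\<^sup>+w. ennreal ((k ?E w)\<^sup>2) \<partial>P) = \<infinity>"
        proof (rule ccontr)
          assume "(\<integral>\<^sup>+w. ennreal ((k ?E w)\<^sup>2) \<partial>P) \<noteq> \<infinity>"
          then have "integrable P (\<lambda>w. (k ?E w)\<^sup>2)"
            using kE by (intro integrableI_bounded) (auto simp: less_top)
          with False show False by simp
        qed
        then show ?thesis using cJ by (simp add: ennreal_mult_top)
      qed
    qed simp
    finally show "(\<integral>\<^sup>+v. F (?E, v) \<partial>distr M ?MV ?V) \<le> card J * (\<integral>\<^sup>+w. ennreal ((k ?E w)\<^sup>2) \<partial>P)" .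
  qed
  also have "\<dots> = card J * (\<integral>\<^sup>+x. (\<integral>\<^sup>+w. ennreal ((k (?D x) w)\<^sup>2) \<partial>P) \<partial>M)"
  proof (rule nn_integral_cmult)
    interpret P: prob_space P by (rule prob_space_P)
    have "(\<lambda>p. ennreal ((case p of (D, w) \<Rightarrow> k D w)\<^sup>2)) \<in> borel_measurable (?MD \<Otimes>\<^sub>M P)"
      using k by (auto cong: measurable_cong_sets sets_pair_measure_cong)
    then have "(\<lambda>D. \<integral>\<^sup>+w. ennreal ((k D w)\<^sup>2) \<partial>P) \<in> borel_measurable ?MD"
      using P.borel_measurable_nn_integral_fst[of "\<lambda>p. ennreal ((case p of (D, w) \<Rightarrow> k D w)\<^sup>2)" ?MD] by simp
    from measurable_compose[OF D this]
    show "(\<lambda>x. \<integral>\<^sup>+w. ennreal ((k (?D x) w)\<^sup>2) \<partial>P) \<in> borel_measurable M" .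
  qed
  finally show ?thesis .
qed

text \<open>For i.i.d. terms the law of a sum depends on the index set only through its size. The
  limit is therefore proved along initial segments and composed with
  \<open>card (J n)\<close>.\<close>

lemma central_limit_index_sets:
  fixes g :: "'b \<Rightarrow> real"
  assumes g[measurable]: "g \<in> borel_measurable borel" and g2: "integrable P (\<lambda>w. (g w)\<^sup>2)"
    and g0: "(\<integral>w. g w \<partial>P) = 0"
    and J: "\<And>n. finite (J n)" "filterlim (\<lambda>n. card (J n)) at_top sequentially"
  shows "weak_conv_m (\<lambda>n. distr M borel (\<lambda>x. (\<Sum>i\<in>J n. g (W i x)) / sqrt (card (J n))))
    (normal_law 0 (\<integral>w. (g w)\<^sup>2 \<partial>P))"
proof -
  define v where "v = (\<integral>w. (g w)\<^sup>2 \<partial>P)"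
  have v: "0 \<le> v" by (simp add: v_def)
  define X where "X i x = g (W i x)" for i x
  have X[measurable]: "X i \<in> borel_measurable M" for i unfolding X_def by simp
  have iX: "indep_vars (\<lambda>_. borel) X UNIV"
    unfolding X_def by (rule indep_vars_compose2[OF indep]) simp
  define \<mu> where "\<mu> = distr P borel g"
  have dX: "distr M borel (X i) = \<mu>" for i
    unfolding \<mu>_def distr_W[of i, symmetric] X_def by (subst distr_distr) (auto simp: comp_def)
  have X2: "integrable M (\<lambda>x. (X i x)\<^sup>2)" "(\<integral>x. (X i x)\<^sup>2 \<partial>M) = v" "(\<integral>x. X i x \<partial>M) = 0" for i
    using integrable_W[of "\<lambda>w. (g w)\<^sup>2" i] integral_W[of "\<lambda>w. (g w)\<^sup>2" i] integral_W[of g i] g2 g0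
    by (auto simp: X_def v_def)
  have chS: "char (distr M borel (\<lambda>x. (\<Sum>i\<in>A. X i x) / c)) t = (char \<mu> (t / c)) ^ card A" for A c t
  proof -
    have "char (distr M borel (\<lambda>x. (\<Sum>i\<in>A. X i x) / c)) t = char (distr M borel (\<lambda>x. \<Sum>i\<in>A. X i x)) (t / c)"
      unfolding char_def by (subst (1 2) integral_distr) (auto simp: field_simps)
    also have "\<dots> = (\<Prod>i\<in>A. char (distr M borel (X i)) (t / c))"
      by (rule char_distr_sum[OF indep_vars_subset[OF iX]]) simp
    finally show ?thesis by (simp add: dX)
  qed
  have lim: "(\<lambda>k. (char \<mu> (t / sqrt (real k))) ^ k) \<longlonglongrightarrow> exp (- (v * t\<^sup>2) / 2)" for t
  \<comment> \<open>The classical central limit theorem is applied with positive variance. If the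
    variance is zero, g vanishes almost everywhere and every characteristic function is 1.\<close>
  proof (cases "v = 0")
    case True
    have "AE w in P. (g w)\<^sup>2 = 0"
      using True g2 by (subst (asm) v_def, subst (asm) integral_nonneg_eq_0_iff_AE) auto
    then have "AE w in P. g w = 0" by simp
    then have "(\<integral>w. iexp (t * g w) \<partial>P) = (\<integral>w. 1 \<partial>P)" for t
      by (intro integral_cong_AE) auto
    then have "char \<mu> t = 1" for t
      using prob_space.prob_space[OF prob_space_P]
      unfolding char_def \<mu>_def by (subst integral_distr) auto
    then show ?thesis using True by simp
  next
    case False
    define \<sigma> where "\<sigma> = sqrt v"
    have \<sigma>: "0 < \<sigma>" "\<sigma>\<^sup>2 = v" using False v by (auto simp: \<sigma>_def)
    have "weak_conv_m (\<lambda>n. distr M borel (\<lambda>x. (\<Sum>i<n. X i x) / sqrt (n * \<sigma>\<^sup>2))) std_normal_distribution"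
      by (rule central_limit_theorem_zero_mean[OF iX _ \<sigma>(1) _ _ dX]) (use X2 \<sigma> in auto)
    from levy_continuity1[OF _ real_dist_normal_dist this, of "t * \<sigma>"]
    have "(\<lambda>n. (char \<mu> (t * \<sigma> / sqrt (n * \<sigma>\<^sup>2))) ^ n) \<longlonglongrightarrow> exp (- (t * \<sigma>)\<^sup>2 / 2)"
      by (simp add: chS real_distribution_distr char_std_normal_distribution)
    moreover have "t * \<sigma> / sqrt (n * \<sigma>\<^sup>2) = t / sqrt n" for n
      using \<sigma>(1) by (simp add: real_sqrt_mult)
    moreover have "(t * \<sigma>)\<^sup>2 = v * t\<^sup>2" using \<sigma>(2) by (simp add: power_mult_distrib)
    ultimately show ?thesis by simp
  qed
  show ?thesis
    unfolding v_def[symmetric] X_def[symmetric]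
  proof (rule levy_continuity[OF _ real_distribution_normal_law[OF v]])
    show "real_distribution (distr M borel (\<lambda>x. (\<Sum>i\<in>J n. X i x) / sqrt (card (J n))))" for n
      by (rule real_distribution_distr) simp
    show "(\<lambda>n. char (distr M borel (\<lambda>x. (\<Sum>i\<in>J n. X i x) / sqrt (card (J n)))) t) \<longlonglongrightarrow> char (normal_law 0 v) t" for t
      using filterlim_compose[OF lim J(2), of t] by (simp add: chS char_normal_law v)
  qed
qed

end

subsection \<open>Laws with a known propensity\<close>

lemma continuous_obs:
  "continuous_on UNIV (obsY :: ('d::finite, 'k::finite, 'l::finite) obs \<Rightarrow> real)"
  "continuous_on UNIV (obsM :: ('d, 'k, 'l) obs \<Rightarrow> real)"
  "continuous_on UNIV (obsC :: ('d, 'k, 'l) obs \<Rightarrow> real ^ 'd)"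
  "continuous_on UNIV (obsZ :: ('d, 'k, 'l) obs \<Rightarrow> real)"
  "continuous_on UNIV (obsA :: ('d, 'k, 'l) obs \<Rightarrow> real)"
  "continuous_on UNIV (obsX :: ('d, 'k, 'l) obs \<Rightarrow> real ^ 'k)"
  "continuous_on UNIV (obsXt :: ('d, 'k, 'l) obs \<Rightarrow> ('d, 'k, 'l) xtilde)"
  by (simp_all add: obsY_def obsM_def obsC_def obsZ_def obsA_def obsX_def obsXt_def
      case_prod_unfold continuous_intros)

lemmas measurable_obs [measurable] = continuous_obs[THEN borel_measurable_continuous_onI]

lemma measurable_zperp [measurable]: "zperp \<gamma> \<in> borel_measurable borel"
  unfolding zperp_def[abs_def] by measurable

lemma obsX_eq_fst_obsXt: "obsX w = fst (obsXt w)"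
  by (simp add: obsX_def obsXt_def case_prod_unfold)

lemma zperp_eq_obsXt: "zperp \<gamma> w = (\<lambda>(x, u, z, c). z - \<gamma> \<bullet> c) (obsXt w)"
  by (simp add: zperp_def obsZ_def obsC_def obsXt_def case_prod_unfold)

text \<open>All laws of an observation live on \<^const>\<open>UNIV\<close>, so the \<open>\<sigma>\<close>-algebra generated by \<open>X\<^sup>~\<close> is the same
  for all of them.\<close>

abbreviation sigma_Xt :: "('d::finite, 'k::finite, 'l::finite) obs measure" where
  "sigma_Xt \<equiv> vimage_algebra UNIV obsXt borel"

lemma measurable_sigma_Xt_compose:
  fixes g :: "('d::finite, 'k::finite, 'l::finite) xtilde \<Rightarrow> real"
  assumes "g \<in> borel_measurable borel"
  shows "(\<lambda>w. g (obsXt w)) \<in> borel_measurable sigma_Xt"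
  by (rule measurable_compose[OF measurable_vimage_algebra1 assms]) simp

lemma measurable_sigma_Xt_zperp:
  "(\<lambda>w :: ('d::finite, 'k::finite, 'l::finite) obs. zperp \<gamma> w) \<in> borel_measurable sigma_Xt"
proof -
  have "(\<lambda>(x, u, z, c). z - \<gamma> \<bullet> c) \<in> borel_measurable (borel :: ('d, 'k, 'l) xtilde measure)"
    by (intro borel_measurable_continuous_onI) (simp add: case_prod_unfold continuous_intros)
  from measurable_sigma_Xt_compose[OF this] show ?thesis by (simp add: zperp_eq_obsXt)
qed

lemma measurable_sigma_Xt_obsX:
  fixes g :: "real ^ 'k \<Rightarrow> real"
  assumes "g \<in> borel_measurable borel"
  shows "(\<lambda>w :: ('d::finite, 'k::finite, 'l::finite) obs. g (obsX w)) \<in> borel_measurable sigma_Xt"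
proof -
  have "fst \<in> borel_measurable (borel :: ('d, 'k, 'l) xtilde measure)"
    by (intro borel_measurable_continuous_onI continuous_intros)
  from measurable_sigma_Xt_compose[OF measurable_compose[OF this assms]]
  show ?thesis by (simp add: obsX_eq_fst_obsXt)
qed

section \<open>The law given annotation and its regression function\<close>

lemma integral_uniform_measure:
  fixes f :: "'a \<Rightarrow> real"
  assumes "prob_space M" and A[measurable]: "A \<in> sets M" and f[measurable]: "f \<in> borel_measurable M"
    and pos: "0 < measure M A"
  shows "(\<integral>x. f x \<partial>uniform_measure M A) = (\<integral>x. indicator A x * f x \<partial>M) / measure M A"
    and "integrable (uniform_measure M A) f \<longleftrightarrow> integrable M (\<lambda>x. indicator A x * f x)"
proof -
  interpret prob_space M by fact
  have eq: "uniform_measure M A = density M (\<lambda>x. ennreal (indicator A x / measure M A))"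
    unfolding uniform_measure_def using pos
    by (intro density_cong) (auto simp: emeasure_eq_measure indicator_def divide_ennreal simp flip: ennreal_1)
  have *: "indicator A x / measure M A * f x = (indicator A x * f x) / measure M A" for x by simp
  show "(\<integral>x. f x \<partial>uniform_measure M A) = (\<integral>x. indicator A x * f x \<partial>M) / measure M A"
    unfolding eq by (subst integral_real_density) (auto simp: *)
  show "integrable (uniform_measure M A) f \<longleftrightarrow> integrable M (\<lambda>x. indicator A x * f x)"
    unfolding eq by (subst integrable_real_density) (use pos in \<open>auto simp: * divide_inverse mult.commute[of _ "inverse _"] mult.assoc\<close>)
qed

locale propensity_model =
  fixes Q :: "('d::finite, 'k::finite, 'l::finite) obs measure" and \<pi> :: "real ^ 'k \<Rightarrow> real"
  assumes in_model: "Q \<in> known_propensity_model \<pi>"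
begin

lemma prob_space_Q: "prob_space Q" and sets_Q [simp, measurable_cong]: "sets Q = sets borel"
  and AE_support: "AE w in Q. obsA w \<in> {0, 1} \<and> obsM w \<in> {0, obsA w}"
  and propensity: "is_propensity Q \<pi>"
  and positivity: "AE w in Q. 0 < real_cond_exp Q (sigma_of Q borel obsXt) (indicator {w. obsA w = 1}) w"
  using in_model by (auto simp: known_propensity_model_def)

sublocale prob_space Q by (rule prob_space_Q)

lemma space_Q [simp]: "space Q = UNIV"
  using sets_eq_imp_space_eq[OF sets_Q] by simp

lemma prob_UNIV [simp]: "prob UNIV = 1"
  using prob_space by simp

lemma sigma_finite_subalgebra_Xt: "sigma_finite_subalgebra Q sigma_Xt"
  using sigma_finite_subalgebra_sigma_of[OF prob_space_Q, of obsXt borel] by simp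

sublocale Xt: sigma_finite_subalgebra Q sigma_Xt by (rule sigma_finite_subalgebra_Xt)

lemma measurable_Xt [measurable_dest]: "f \<in> borel_measurable sigma_Xt \<Longrightarrow> f \<in> borel_measurable Q"
  by (rule measurable_from_subalg[OF Xt.subalg])

text \<open>Since P(A = 1 | X~) is positive almost surely, an event of X~ with positive probability
  contains annotated observations. This carries facts about the regression function, known only
  under the annotated law, over to the whole population.\<close>

lemma AE_of_annotated:
  assumes R: "{w. R w} \<in> sets sigma_Xt" and AE: "AE w in Q. obsA w = 1 \<longrightarrow> R w"
  shows "AE w in Q. R w"
proof -
  let ?e = "real_cond_exp Q sigma_Xt (indicator {w. obsA w = 1})"
  let ?N = "indicator {w. \<not> R w} :: _ \<Rightarrow> real"
  have "{w. \<not> R w} = space sigma_Xt - {w. R w}" by auto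
  then have N: "?N \<in> borel_measurable sigma_Xt" using R by simp
  have N': "?N \<in> borel_measurable Q" by (rule measurable_Xt[OF N])
  have int: "integrable Q (\<lambda>w. ?N w * indicator {w. obsA w = 1} w)"
  proof (rule integrable_const_bound[where B = 1])
    show "(\<lambda>w. ?N w * indicator {w. obsA w = 1} w) \<in> borel_measurable Q"
      using N' by (rule borel_measurable_times) simp
  qed (simp add: indicator_def)
  have "(\<integral>w. ?N w * ?e w \<partial>Q) = (\<integral>w. ?N w * indicator {w. obsA w = 1} w \<partial>Q)"
    by (rule Xt.real_cond_exp_intg(2)[OF int N]) simp
  also have "\<dots> = 0"
    using AE by (intro integral_eq_zero_AE) (auto simp: indicator_def)
  finally have "(\<integral>w. ?N w * ?e w \<partial>Q) = 0" .
  moreover have "AE w in Q. 0 \<le> ?N w * ?e w"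
    using positivity by (auto simp: indicator_def)
  ultimately have "AE w in Q. ?N w * ?e w = 0"
    using integral_nonneg_eq_0_iff_AE[OF Xt.real_cond_exp_intg(1)[OF int N]] by simp
  then show ?thesis using positivity by eventually_elim (auto simp: indicator_def split: if_splits)
qed

lemma prob_annotated_pos: "0 < prob {w. obsA w = 1}"
proof (rule ccontr)
  assume "\<not> ?thesis"
  then have "prob {w. obsA w = 1} = 0" by (simp add: not_less measure_le_0_iff)
  then have "AE w in Q. w \<notin> {w. obsA w = 1}"
    by (intro AE_not_in) (auto simp: null_sets_def emeasure_eq_measure)
  then have "AE w in Q. obsA w = 1 \<longrightarrow> False" by eventually_elim simp
  from AE_of_annotated[OF _ this] have "AE w in Q. False" by simp
  then show False using AE_False by simp
qed

abbreviation "annotated_law \<equiv> uniform_measure Q {w. obsA w = 1}"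

lemma prob_space_annotated: "prob_space annotated_law"
  using prob_annotated_pos
  by (intro prob_space_uniform_measure) (auto simp: emeasure_eq_measure)

lemma AE_annotated_law: "{w. R w} \<in> sets borel \<Longrightarrow> (AE w in annotated_law. R w) \<longleftrightarrow> (AE w in Q. obsA w = 1 \<longrightarrow> R w)"
  using prob_annotated_pos
  by (subst AE_uniform_measure) (auto simp: emeasure_eq_measure)

lemma sigma_finite_subalgebra_annotated: "sigma_finite_subalgebra annotated_law sigma_Xt"
  using sigma_finite_subalgebra_sigma_of[OF prob_space_annotated, of obsXt borel] by simp

lemma reg_annotated_measurable: "reg_annotated Q \<in> borel_measurable sigma_Xt"
  unfolding reg_annotated_def by simp

lemma integrable_annotated_obsM: "integrable annotated_law obsM"
proof -
  interpret U: prob_space annotated_law by (rule prob_space_annotated)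
  have "AE w in annotated_law. \<bar>obsM w\<bar> \<le> 1"
    by (subst AE_annotated_law, simp, use AE_support in eventually_elim) auto
  then show ?thesis by (intro U.integrable_const_bound[where B = 1]) auto
qed

lemma reg_annotated_bounded: "AE w in Q. 0 \<le> reg_annotated Q w \<and> reg_annotated Q w \<le> 1"
proof (rule AE_of_annotated)
  interpret U: sigma_finite_subalgebra annotated_law sigma_Xt
    by (rule sigma_finite_subalgebra_annotated)
  have b: "AE w in annotated_law. 0 \<le> obsM w" "AE w in annotated_law. obsM w \<le> 1"
    by (subst AE_annotated_law, simp, use AE_support in eventually_elim, auto)+
  have "AE w in annotated_law. 0 \<le> reg_annotated Q w \<and> reg_annotated Q w \<le> 1"
    using U.real_cond_exp_ge_c[OF integrable_annotated_obsM b(1)]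
      U.real_cond_exp_le_c[OF integrable_annotated_obsM b(2)]
    by (simp add: reg_annotated_def)
  moreover have "{w. 0 \<le> reg_annotated Q w \<and> reg_annotated Q w \<le> 1} \<in> sets borel"
    using measurable_Xt[OF reg_annotated_measurable] by simp
  ultimately show "AE w in Q. obsA w = 1 \<longrightarrow> 0 \<le> reg_annotated Q w \<and> reg_annotated Q w \<le> 1"
    using AE_annotated_law by blast
  have "{w \<in> space sigma_Xt. 0 \<le> reg_annotated Q w \<and> reg_annotated Q w \<le> 1} \<in> sets sigma_Xt"
    using reg_annotated_measurable by measurable
  then show "{w. 0 \<le> reg_annotated Q w \<and> reg_annotated Q w \<le> 1} \<in> sets sigma_Xt" by simp
qed

lemma AE_A_indicator: "AE w in Q. indicator {w. obsA w = 1} w = obsA w"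
  using AE_support by eventually_elim (auto simp: indicator_def)

text \<open>The normal equation of the regression on annotated observations. The factor A turns an
  integral under Q into one under the annotated law, up to the constant P(A = 1).\<close>

lemma reg_annotated_residual:
  assumes b: "b \<in> borel_measurable sigma_Xt" "AE w in Q. \<bar>b w\<bar> \<le> c"
  shows "(\<integral>w. obsA w * (obsM w - reg_annotated Q w) * b w \<partial>Q) = 0"
proof -
  interpret U: sigma_finite_subalgebra annotated_law sigma_Xt
    by (rule sigma_finite_subalgebra_annotated)
  note [measurable] = measurable_Xt[OF b(1)] measurable_Xt[OF reg_annotated_measurable]
  let ?I = "indicator {w. obsA w = 1} :: _ \<Rightarrow> real"
  have bM: "integrable Q (\<lambda>w. ?I w * (b w * obsM w))"
  proof (rule integrable_const_bound[where B = c])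
    show "AE w in Q. norm (?I w * (b w * obsM w)) \<le> c"
      using b(2) AE_support by eventually_elim (auto simp: indicator_def)
  qed simp
  have "{w. \<bar>b w\<bar> \<le> c} \<in> sets borel" by measurable
  then have "AE w in annotated_law. \<bar>b w\<bar> \<le> c"
    using b(2) by (subst AE_annotated_law) (auto elim!: eventually_mono)
  then have bMU: "integrable annotated_law (\<lambda>w. b w * obsM w)"
    by (intro integrable_mult_AE_bounded[OF integrable_annotated_obsM]) auto
  have int: "integrable Q (\<lambda>w. ?I w * (b w * reg_annotated Q w))"
    using U.real_cond_exp_intg(1)[OF bMU b(1)] prob_annotated_pos
    by (simp add: integral_uniform_measure(2)[OF prob_space_Q] reg_annotated_def)
  have "(\<integral>w. b w * reg_annotated Q w \<partial>annotated_law) = (\<integral>w. b w * obsM w \<partial>annotated_law)"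
    using U.real_cond_exp_intg(2)[OF bMU b(1)] by (simp add: reg_annotated_def)
  then have "(\<integral>w. ?I w * (b w * obsM w) \<partial>Q) = (\<integral>w. ?I w * (b w * reg_annotated Q w) \<partial>Q)"
    using prob_annotated_pos by (simp add: integral_uniform_measure(1)[OF prob_space_Q])
  then have "(\<integral>w. ?I w * (b w * obsM w) - ?I w * (b w * reg_annotated Q w) \<partial>Q) = 0"
    using bM int by simp
  also have "(\<integral>w. ?I w * (b w * obsM w) - ?I w * (b w * reg_annotated Q w) \<partial>Q)
      = (\<integral>w. obsA w * (obsM w - reg_annotated Q w) * b w \<partial>Q)"
    by (rule integral_cong_AE) (use AE_A_indicator in \<open>auto elim!: eventually_mono simp: algebra_simps\<close>)
  finally show ?thesis .
qed

end

section \<open>Paths of likelihood ratios\<close>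

lemma regular_path_obtain:
  assumes P: "prob_space P" and path: "regular_path P Q h"
  obtains f where
    "\<forall>\<^sub>F t in at 0. t \<noteq> 0 \<and> f t \<in> borel_measurable P \<and> (\<forall>w. 0 \<le> f t w) \<and>
       Q t = density P (\<lambda>w. ennreal (f t w)) \<and>
       integrable P (\<lambda>w. ((f t w - 1) / t - h w)\<^sup>2) \<and> integrable P (\<lambda>w. (f t w - 1)\<^sup>2)"
    and "((\<lambda>t. \<integral>w. ((f t w - 1) / t - h w)\<^sup>2 \<partial>P) \<longlongrightarrow> 0) (at 0)"
proof -
  interpret prob_space P by fact
  obtain f where f: "\<forall>\<^sub>F t in at 0. f t \<in> borel_measurable P \<and> (\<forall>w. 0 \<le> f t w) \<and>
             Q t = density P (\<lambda>w. ennreal (f t w))"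
    and lim: "((\<lambda>t. \<integral>\<^sup>+ w. ennreal (((f t w - 1) / t - h w)\<^sup>2) \<partial>P) \<longlongrightarrow> 0) (at 0)"
    and h: "h \<in> borel_measurable P" "integrable P (\<lambda>w. (h w)\<^sup>2)"
    using path by (auto simp: regular_path_def L2_def)
  have fin: "\<forall>\<^sub>F t in at 0. (\<integral>\<^sup>+ w. ennreal (((f t w - 1) / t - h w)\<^sup>2) \<partial>P) < \<infinity>"
    by (rule order_tendstoD(2)[OF lim]) simp
  have ne: "\<forall>\<^sub>F t in at (0::real). t \<noteq> 0" by (simp add: eventually_at_filter)
  have ev: "\<forall>\<^sub>F t in at 0. t \<noteq> 0 \<and> f t \<in> borel_measurable P \<and> (\<forall>w. 0 \<le> f t w) \<and>
       Q t = density P (\<lambda>w. ennreal (f t w)) \<and>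
       integrable P (\<lambda>w. ((f t w - 1) / t - h w)\<^sup>2) \<and> integrable P (\<lambda>w. (f t w - 1)\<^sup>2)"
    using f fin ne
  proof eventually_elim
    case (elim t)
    then have [measurable]: "f t \<in> borel_measurable P" by simp
    have r: "integrable P (\<lambda>w. ((f t w - 1) / t - h w)\<^sup>2)"
      using elim h by (intro integrableI_bounded) auto
    have "integrable P (\<lambda>w. (f t w - 1)\<^sup>2)"
    proof (rule Bochner_Integration.integrable_bound)
      show "integrable P (\<lambda>w. 2 * t\<^sup>2 * (((f t w - 1) / t - h w)\<^sup>2 + (h w)\<^sup>2))"
        using r h by simp
      show "AE w in P. norm ((f t w - 1)\<^sup>2) \<le> norm (2 * t\<^sup>2 * (((f t w - 1) / t - h w)\<^sup>2 + (h w)\<^sup>2))"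
      proof (rule AE_I2)
        fix w
        \<comment> \<open>\<open>a\<close> is the remainder of the quotient, so f - 1 = t (a + h)
          inherits square integrability from the remainder and the score.\<close>
        define a where "a = (f t w - 1) / t - h w"
        have "f t w - 1 = t * (a + h w)" using elim by (simp add: a_def)
        moreover have "(a + h w)\<^sup>2 \<le> 2 * (a\<^sup>2 + (h w)\<^sup>2)"
          using sum_squares_bound[of a "h w"] by (simp add: power2_sum)
        ultimately have "(f t w - 1)\<^sup>2 \<le> t\<^sup>2 * (2 * (a\<^sup>2 + (h w)\<^sup>2))"
          by (simp only: power_mult_distrib mult_left_mono zero_le_power2)
        then show "norm ((f t w - 1)\<^sup>2) \<le> norm (2 * t\<^sup>2 * (((f t w - 1) / t - h w)\<^sup>2 + (h w)\<^sup>2))"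
          by (simp add: a_def[symmetric] abs_mult algebra_simps)
      qed
    qed simp
    then show ?case using elim r by auto
  qed
  have "((\<lambda>t. ennreal (\<integral>w. ((f t w - 1) / t - h w)\<^sup>2 \<partial>P)) \<longlongrightarrow> ennreal 0) (at 0)"
    using lim
    by (rule Lim_transform_eventually[THEN tendsto_eq_rhs])
      (use ev in \<open>auto elim!: eventually_mono simp: nn_integral_eq_integral\<close>)
  then have "((\<lambda>t. \<integral>w. ((f t w - 1) / t - h w)\<^sup>2 \<partial>P) \<longlongrightarrow> 0) (at 0)"
    by (subst (asm) tendsto_ennreal_iff) auto
  with ev show ?thesis by (rule that)
qed

lemma integral_density_eq:
  assumes f: "f \<in> borel_measurable P" "\<And>w. 0 \<le> f w" and T: "T \<in> borel_measurable P"
    and u: "integrable P (\<lambda>w. (f w - 1)\<^sup>2)" and T2: "integrable P (\<lambda>w. (T w)\<^sup>2)" and P: "prob_space P"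
  shows "(\<integral>w. T w \<partial>density P (\<lambda>w. ennreal (f w))) = (\<integral>w. T w \<partial>P) + (\<integral>w. (f w - 1) * T w \<partial>P)"
    and "integrable (density P (\<lambda>w. ennreal (f w))) T"
proof -
  interpret prob_space P by fact
  have int: "integrable P (\<lambda>w. (f w - 1) * T w)" "integrable P T"
    using integrable_mult_of_squares[OF _ T u T2] square_integrable_imp_integrable[OF T T2] f by auto
  have fT: "f w * T w = T w + (f w - 1) * T w" for w by (simp add: algebra_simps)
  show "(\<integral>w. T w \<partial>density P (\<lambda>w. ennreal (f w))) = (\<integral>w. T w \<partial>P) + (\<integral>w. (f w - 1) * T w \<partial>P)"
    using f T int by (subst integral_real_density) (auto simp: fT)
  show "integrable (density P (\<lambda>w. ennreal (f w))) T"
    using f T int by (subst integrable_real_density) (auto simp: fT)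
qed

lemma tendsto_integral_mult_of_L2:
  fixes T h :: "'a \<Rightarrow> real"
  assumes T: "T \<in> borel_measurable P" "integrable P (\<lambda>w. (T w)\<^sup>2)"
    and h: "h \<in> borel_measurable P" "integrable P (\<lambda>w. (h w)\<^sup>2)"
    and ev: "\<forall>\<^sub>F t in F. g t \<in> borel_measurable P \<and> integrable P (\<lambda>w. (g t w - h w)\<^sup>2)"
    and lim: "((\<lambda>t. \<integral>w. (g t w - h w)\<^sup>2 \<partial>P) \<longlongrightarrow> 0) F"
  shows "((\<lambda>t. \<integral>w. T w * g t w \<partial>P) \<longlongrightarrow> (\<integral>w. T w * h w \<partial>P)) F"
proof (rule Lim_null[THEN iffD2], rule Lim_null_comparison)
  show "((\<lambda>t. sqrt (\<integral>w. (T w)\<^sup>2 \<partial>P) * sqrt (\<integral>w. (g t w - h w)\<^sup>2 \<partial>P)) \<longlongrightarrow> 0) F"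
    by (intro tendsto_mult_right_zero) (use tendsto_real_sqrt[OF lim] in simp)
  show "\<forall>\<^sub>F t in F. norm ((\<integral>w. T w * g t w \<partial>P) - (\<integral>w. T w * h w \<partial>P))
      \<le> sqrt (\<integral>w. (T w)\<^sup>2 \<partial>P) * sqrt (\<integral>w. (g t w - h w)\<^sup>2 \<partial>P)"
    using ev
  proof eventually_elim
    case (elim t)
    have Th: "integrable P (\<lambda>w. T w * h w)" by (rule integrable_mult_of_squares) (use T h in auto)
    have Tr: "integrable P (\<lambda>w. T w * (g t w - h w))"
      by (rule integrable_mult_of_squares) (use T h elim in auto)
    have "(\<integral>w. T w * g t w \<partial>P) = (\<integral>w. T w * h w + T w * (g t w - h w) \<partial>P)"
      by (simp add: algebra_simps)
    then have "(\<integral>w. T w * g t w \<partial>P) - (\<integral>w. T w * h w \<partial>P) = (\<integral>w. T w * (g t w - h w) \<partial>P)"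
      using Th Tr by simp
    also have "norm \<dots> \<le> (\<integral>w. \<bar>T w * (g t w - h w)\<bar> \<partial>P)"
      using integral_norm_bound[of P "\<lambda>w. T w * (g t w - h w)"] by simp
    also have "\<dots> \<le> sqrt (\<integral>w. (T w)\<^sup>2 \<partial>P) * sqrt (\<integral>w. (g t w - h w)\<^sup>2 \<partial>P)"
      by (rule Cauchy_Schwarz_integral) (use T h elim in auto)
    finally show ?case .
  qed
qed

text \<open>A mean is linear in the likelihood ratio, so its difference quotient is exactly the
  integral of T against (f - 1) / t. Convergence of this quotient in L2 admits an unbounded
  T.\<close>

lemma pathwise_derivative_integral:
  assumes P: "prob_space P" and path: "regular_path P Q h"
    and T: "T \<in> borel_measurable P" "integrable P (\<lambda>w. (T w)\<^sup>2)"
  shows "((\<lambda>t. ((\<integral>w. T w \<partial>Q t) - (\<integral>w. T w \<partial>P)) / t) \<longlongrightarrow> (\<integral>w. T w * h w \<partial>P)) (at 0)"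
proof -
  obtain f where f: "\<forall>\<^sub>F t in at 0. t \<noteq> 0 \<and> f t \<in> borel_measurable P \<and> (\<forall>w. 0 \<le> f t w) \<and>
       Q t = density P (\<lambda>w. ennreal (f t w)) \<and>
       integrable P (\<lambda>w. ((f t w - 1) / t - h w)\<^sup>2) \<and> integrable P (\<lambda>w. (f t w - 1)\<^sup>2)"
    and lim: "((\<lambda>t. \<integral>w. ((f t w - 1) / t - h w)\<^sup>2 \<partial>P) \<longlongrightarrow> 0) (at 0)"
    by (rule regular_path_obtain[OF P path]) blast
  have h: "h \<in> borel_measurable P" "integrable P (\<lambda>w. (h w)\<^sup>2)"
    using path by (auto simp: regular_path_def L2_def)
  have "((\<lambda>t. \<integral>w. T w * ((f t w - 1) / t) \<partial>P) \<longlongrightarrow> (\<integral>w. T w * h w \<partial>P)) (at 0)"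
    by (rule tendsto_integral_mult_of_L2[OF T h _ lim]) (use f in \<open>auto elim!: eventually_mono\<close>)
  then show ?thesis
  proof (rule Lim_transform_eventually)
    show "\<forall>\<^sub>F t in at 0. (\<integral>w. T w * ((f t w - 1) / t) \<partial>P) = ((\<integral>w. T w \<partial>Q t) - (\<integral>w. T w \<partial>P)) / t"
      using f
    proof eventually_elim
      case (elim t)
      have "(\<integral>w. T w \<partial>Q t) = (\<integral>w. T w \<partial>P) + (\<integral>w. (f t w - 1) * T w \<partial>P)"
        using elim integral_density_eq(1)[of "f t" P T] T P by auto
      then show ?case by (simp add: mult.commute)
    qed
  qed
qed

text \<open>Differentiate the total mass, which is constantly 1: the case T = 1 of the derivative of
  a mean.\<close>

lemma score_mean_zero:
  assumes P: "prob_space P" and path: "regular_path P Q h" and prob: "\<forall>\<^sub>F t in at 0. prob_space (Q t)"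
  shows "(\<integral>w. h w \<partial>P) = 0"
proof -
  interpret prob_space P by fact
  have "((\<lambda>t. ((\<integral>w. 1 \<partial>Q t) - (\<integral>w. 1 \<partial>P)) / t) \<longlongrightarrow> (\<integral>w. 1 * h w \<partial>P)) (at 0)"
    by (rule pathwise_derivative_integral[OF P path]) auto
  moreover have "((\<lambda>t. ((\<integral>w. 1 \<partial>Q t) - (\<integral>w. 1 \<partial>P)) / t) \<longlongrightarrow> 0) (at 0)"
    by (rule tendsto_eventually) (use prob in \<open>auto elim!: eventually_mono simp: prob_space.prob_space prob_space\<close>)
  ultimately show ?thesis using tendsto_unique[OF trivial_limit_at] by fastforce
qed

subsection \<open>The tangent space\<close>

lemma (in prob_space) real_cond_exp_L2_contraction:
  assumes F: "sigma_finite_subalgebra M F" and f: "f \<in> borel_measurable M" and f2: "integrable M (\<lambda>x. (f x)\<^sup>2)"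
  shows "integrable M (\<lambda>x. (real_cond_exp M F f x)\<^sup>2)"
    and "(\<integral>x. (real_cond_exp M F f x)\<^sup>2 \<partial>M) \<le> (\<integral>x. (f x)\<^sup>2 \<partial>M)"
proof -
  interpret sub: sigma_finite_subalgebra M F by fact
  have int: "integrable M f" by (rule square_integrable_imp_integrable[OF f f2])
  have c: "convex_on UNIV (\<lambda>x::real. x\<^sup>2)" by (rule convex_power2)
  show i: "integrable M (\<lambda>x. (real_cond_exp M F f x)\<^sup>2)"
    by (rule sub.integrable_convex_cond_exp[OF int, of UNIV]) (use f2 c in \<open>auto simp: emeasure_space_1\<close>)
  have "AE x in M. (real_cond_exp M F f x)\<^sup>2 \<le> real_cond_exp M F (\<lambda>x. (f x)\<^sup>2) x"
    by (rule sub.real_cond_exp_jensens_inequality(2)[OF int, of UNIV]) (use f2 c in auto)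
  then have "(\<integral>x. (real_cond_exp M F f x)\<^sup>2 \<partial>M) \<le> (\<integral>x. real_cond_exp M F (\<lambda>x. (f x)\<^sup>2) x \<partial>M)"
    using i sub.real_cond_exp_int(1)[OF f2] by (intro integral_mono_AE)
  also have "\<dots> = (\<integral>x. (f x)\<^sup>2 \<partial>M)" by (rule sub.real_cond_exp_int(2)[OF f2])
  finally show "(\<integral>x. (real_cond_exp M F f x)\<^sup>2 \<partial>M) \<le> (\<integral>x. (f x)\<^sup>2 \<partial>M)" .
qed

lemma (in prob_space) square_expectation_le:
  fixes f :: "'a \<Rightarrow> real"
  assumes f: "f \<in> borel_measurable M" and f2: "integrable M (\<lambda>x. (f x)\<^sup>2)"
  shows "(expectation f)\<^sup>2 \<le> expectation (\<lambda>x. (f x)\<^sup>2)"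
  using variance_eq[OF square_integrable_imp_integrable[OF f f2] f2] variance_positive[of f] by simp

text \<open>Cauchy-Schwarz for four signed terms in Lagrange's form: the gap between the two sides
  is the sum of six squares, one for each pair.\<close>

lemma power2_sum4_le: "(a - b + c - d)\<^sup>2 \<le> 4 * (a\<^sup>2 + b\<^sup>2 + c\<^sup>2 + (d::real)\<^sup>2)"
proof -
  have "(a - b + c - d)\<^sup>2 + ((a + b)\<^sup>2 + (a - c)\<^sup>2 + (a + d)\<^sup>2 + (b + c)\<^sup>2 + (b - d)\<^sup>2 + (c + d)\<^sup>2)
    = 4 * (a\<^sup>2 + b\<^sup>2 + c\<^sup>2 + d\<^sup>2)"
    by (simp add: power2_eq_square algebra_simps)
  then show ?thesis by (smt (verit) zero_le_power2)
qed

section \<open>Truncation and the propensity residual\<close>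

definition truncate :: "real \<Rightarrow> real \<Rightarrow> real" where
  "truncate c x = max (- c) (min c x)"

lemma truncate_measurable [measurable]: "truncate c \<in> borel_measurable borel"
  unfolding truncate_def[abs_def] by measurable

lemma abs_truncate_le: "0 \<le> c \<Longrightarrow> \<bar>truncate c x\<bar> \<le> c"
  by (auto simp: truncate_def)

lemma truncate_eq: "\<bar>x\<bar> \<le> c \<Longrightarrow> truncate c x = x"
  by (auto simp: truncate_def)

lemma abs_diff_truncate_le: "0 \<le> c \<Longrightarrow> \<bar>x - truncate c x\<bar> \<le> \<bar>x\<bar>"
  by (auto simp: truncate_def)

locale propensity_bounded = propensity_model P \<pi>
  for P :: "('d::finite, 'k::finite, 'l::finite) obs measure" and \<pi> +
  fixes \<eta> :: real
  assumes \<pi>_bounds: "0 < \<eta>" "\<And>x. \<pi> x \<in> {\<eta>..1}"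
begin

lemma \<pi>_measurable [measurable]: "\<pi> \<in> borel_measurable borel"
  using propensity by (simp add: is_propensity_def)

lemma \<pi>_pos: "0 < \<pi> x" and \<pi>_le_1: "\<pi> x \<le> 1" and \<pi>_ge: "\<eta> \<le> \<pi> x"
  using \<pi>_bounds(2)[of x] \<pi>_bounds(1) by auto

abbreviation "sigma_X \<equiv> vimage_algebra UNIV obsX borel :: ('d, 'k, 'l) obs measure"
abbreviation "sigma_AX \<equiv> vimage_algebra UNIV (\<lambda>w. (obsA w, obsX w)) borel :: ('d, 'k, 'l) obs measure"

lemma sigma_finite_subalgebra_X: "sigma_finite_subalgebra P sigma_X"
  using sigma_finite_subalgebra_sigma_of[OF prob_space_Q, of obsX borel] by simp

lemma measurable_AX: "(\<lambda>w. (obsA w, obsX w)) \<in> borel_measurable P"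
  by measurable

lemma sigma_finite_subalgebra_AX: "sigma_finite_subalgebra P sigma_AX"
  using sigma_finite_subalgebra_sigma_of[OF prob_space_Q measurable_AX] by simp

sublocale X: sigma_finite_subalgebra P sigma_X by (rule sigma_finite_subalgebra_X)
sublocale AX: sigma_finite_subalgebra P sigma_AX by (rule sigma_finite_subalgebra_AX)

lemma measurable_X: "f \<in> borel_measurable sigma_X \<Longrightarrow> f \<in> borel_measurable P"
  by (rule measurable_from_subalg[OF X.subalg])

lemma subalgebra_AX_X: "subalgebra sigma_AX sigma_X"
proof -
  have "(\<lambda>w. snd (obsA w, obsX w)) \<in> borel_measurable sigma_AX"
    by (rule measurable_compose[OF measurable_vimage_algebra1]) (auto intro!: borel_measurable_continuous_onI continuous_intros)
  then have "sets sigma_X \<subseteq> sets sigma_AX" by (intro sets_image_in_sets) simp_all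
  then show ?thesis by (simp add: subalgebra_def)
qed

lemma obsA_measurable_AX: "obsA \<in> borel_measurable sigma_AX"
proof -
  have "(\<lambda>w. fst (obsA w, obsX w)) \<in> borel_measurable sigma_AX"
    by (rule measurable_compose[OF measurable_vimage_algebra1]) (auto intro!: borel_measurable_continuous_onI continuous_intros)
  then show ?thesis by simp
qed

lemma measurable_sigma_X_compose: "g \<in> borel_measurable borel \<Longrightarrow> (\<lambda>w. g (obsX w)) \<in> borel_measurable sigma_X"
  for g :: "real ^ 'k \<Rightarrow> real"
  by (rule measurable_compose[OF measurable_vimage_algebra1]) simp_all

lemma AE_abs_A_le: "AE w in P. \<bar>obsA w\<bar> \<le> 1"
  using AE_support by eventually_elim auto

lemma propensity_integral:
  assumes b: "b \<in> borel_measurable sigma_X" and int: "integrable P b"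
  shows "(\<integral>w. obsA w * b w \<partial>P) = (\<integral>w. \<pi> (obsX w) * b w \<partial>P)"
proof -
  let ?I = "indicator {w. obsA w = 1} :: _ \<Rightarrow> real"
  note [measurable] = measurable_X[OF b]
  have i: "integrable P (\<lambda>w. b w * ?I w)"
    using integrable_mult_AE_bounded[OF int, of ?I 1] by (simp add: mult.commute indicator_def)
  have "(\<integral>w. obsA w * b w \<partial>P) = (\<integral>w. b w * ?I w \<partial>P)"
    by (rule integral_cong_AE) (use AE_A_indicator in \<open>auto elim!: eventually_mono simp: mult.commute\<close>)
  also have "\<dots> = (\<integral>w. b w * real_cond_exp P sigma_X ?I w \<partial>P)"
    by (rule X.real_cond_exp_intg(2)[symmetric, OF i b]) simp
  also have "\<dots> = (\<integral>w. \<pi> (obsX w) * b w \<partial>P)"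
    using propensity
    by (intro integral_cong_AE) (auto elim!: eventually_mono simp: is_propensity_def mult.commute)
  finally show ?thesis .
qed

lemma AE_abs_propensity_residual_le:
  assumes "\<And>x. \<bar>b x\<bar> \<le> 1"
  shows "AE w in P. \<bar>(obsA w - \<pi> (obsX w)) * b (obsX w)\<bar> \<le> 1"
  using AE_support
proof eventually_elim
  case (elim w)
  then have "\<bar>obsA w - \<pi> (obsX w)\<bar> \<le> 1" using \<pi>_pos[of "obsX w"] \<pi>_le_1[of "obsX w"] by auto
  then show ?case using assms[of "obsX w"] by (simp add: abs_mult mult_le_one)
qed

lemma propensity_residual_measurable_AX:
  assumes b: "b \<in> borel_measurable borel"
  shows "(\<lambda>w. (obsA w - \<pi> (obsX w)) * b (obsX w)) \<in> borel_measurable sigma_AX"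
  using obsA_measurable_AX measurable_from_subalg[OF subalgebra_AX_X measurable_sigma_X_compose[OF \<pi>_measurable]]
    measurable_from_subalg[OF subalgebra_AX_X measurable_sigma_X_compose[OF b]]
  by (intro borel_measurable_times borel_measurable_diff)

text \<open>Given X, the residual A - \<pi>(X) has mean zero, so functions of X alone satisfy the
  tangent condition.\<close>

lemma propensity_residual_orthogonal:
  assumes f: "f \<in> borel_measurable sigma_X" "integrable P f"
    and b[measurable]: "b \<in> borel_measurable borel" and bb: "\<And>x. \<bar>b x\<bar> \<le> 1"
  shows "(\<integral>w. (obsA w - \<pi> (obsX w)) * b (obsX w) * f w \<partial>P) = 0"
proof -
  have bf: "integrable P (\<lambda>w. b (obsX w) * f w)"
    by (rule integrable_mult_AE_bounded[OF f(2), where c = 1]) (use bb in auto)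
  have "integrable P (\<lambda>w. obsA w * (b (obsX w) * f w))" "integrable P (\<lambda>w. \<pi> (obsX w) * (b (obsX w) * f w))"
    using integrable_mult_AE_bounded[OF bf _ AE_abs_A_le]
      integrable_mult_AE_bounded[OF bf, of "\<lambda>w. \<pi> (obsX w)" 1] \<pi>_pos \<pi>_le_1 by (auto simp: abs_of_pos)
  then have "(\<integral>w. (obsA w - \<pi> (obsX w)) * b (obsX w) * f w \<partial>P)
      = (\<integral>w. obsA w * (b (obsX w) * f w) \<partial>P) - (\<integral>w. \<pi> (obsX w) * (b (obsX w) * f w) \<partial>P)"
    by (simp add: left_diff_distrib mult.assoc)
  also have "\<dots> = 0"
    using propensity_integral[of "\<lambda>w. b (obsX w) * f w"] bf f(1) measurable_sigma_X_compose[OF b] by simp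
  finally show ?thesis .
qed

section \<open>Bounded perturbations that stay in the model\<close>

text \<open>The factor 1 + g stays above 1 / 2, so null sets, and with them the support of (A, M),
  are unchanged. The orthogonality condition is what keeps the conditional mean of A given X equal
  to \<pi>(X).\<close>

lemma density_in_model:
  assumes g[measurable]: "g \<in> borel_measurable P" and bd: "\<And>w. \<bar>g w\<bar> \<le> 1 / 2" and g0: "(\<integral>w. g w \<partial>P) = 0"
    and orth: "\<And>b. b \<in> borel_measurable borel \<Longrightarrow> (\<And>x. \<bar>b x\<bar> \<le> 1) \<Longrightarrow>
      (\<integral>w. (obsA w - \<pi> (obsX w)) * b (obsX w) * g w \<partial>P) = 0"
  shows "density P (\<lambda>w. ennreal (1 + g w)) \<in> known_propensity_model \<pi>"
proof -
  let ?Q = "density P (\<lambda>w. ennreal (1 + g w))"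
  have pos: "0 < 1 + g w" for w using bd[of w] by linarith
  have g_int: "integrable P g" using bd by (intro integrable_const_bound[where B = "1/2"]) auto
  have prob_Q: "prob_space ?Q"
  proof
    have "emeasure ?Q (space ?Q) = (\<integral>\<^sup>+w. ennreal (1 + g w) \<partial>P)"
      by (simp add: emeasure_density cong: nn_integral_cong)
    also have "\<dots> = ennreal (\<integral>w. 1 + g w \<partial>P)"
      using g_int pos by (intro nn_integral_eq_integral AE_I2) (auto intro: less_imp_le)
    also have "\<dots> = 1" using g_int g0 prob_space by simp
    finally show "emeasure ?Q (space ?Q) = 1" .
  qed
  interpret Q: prob_space ?Q by fact
  have AE_Q: "(AE w in ?Q. R w) \<longleftrightarrow> (AE w in P. R w)" for R
    using pos by (subst AE_density) (auto simp: ennreal_less_zero_iff)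
  have int_Q: "(\<integral>w. k w \<partial>?Q) = (\<integral>w. (1 + g w) * k w \<partial>P)" if "k \<in> borel_measurable P" for k :: "_ \<Rightarrow> real"
    using that pos by (subst integral_real_density) (auto intro!: AE_I2 less_imp_le)
  let ?I = "indicator {w. obsA w = 1} :: _ \<Rightarrow> real"
  have prop_Q: "is_propensity ?Q \<pi>"
  proof -
    have "AE w in ?Q. real_cond_exp ?Q (sigma_of ?Q borel obsX) ?I w = \<pi> (obsX w)"
    proof (rule real_cond_exp_sigma_of_charact[OF prob_Q])
      show "(\<lambda>w. \<pi> (obsX w)) \<in> borel_measurable (sigma_of ?Q borel obsX)"
        using measurable_sigma_X_compose[OF \<pi>_measurable] by simp
      show "integrable ?Q (\<lambda>w. \<pi> (obsX w))"
        by (rule Q.integrable_const_bound[where B = 1])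
          (use \<pi>_pos \<pi>_le_1 in \<open>auto simp: abs_of_pos\<close>)
      fix S :: "(real ^ 'k) set" assume S[measurable]: "S \<in> sets borel"
      let ?b = "\<lambda>w. indicator S (obsX w) :: real"
      have b: "?b \<in> borel_measurable sigma_X" using measurable_sigma_X_compose[of "indicator S"] by simp
      have bg: "integrable P (\<lambda>w. (obsA w - \<pi> (obsX w)) * ?b w * g w)"
        and bi: "integrable P (\<lambda>w. obsA w * ?b w)" "integrable P (\<lambda>w. \<pi> (obsX w) * ?b w)" "integrable P ?b"
      proof -
        have "AE w in P. \<bar>(obsA w - \<pi> (obsX w)) * ?b w\<bar> \<le> 2"
          using AE_support
        proof eventually_elim
          case (elim w)
          then show ?case using \<pi>_pos[of "obsX w"] \<pi>_le_1[of "obsX w"] by (auto simp: indicator_def)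
        qed
        from integrable_mult_AE_bounded[OF g_int _ this]
        show "integrable P (\<lambda>w. (obsA w - \<pi> (obsX w)) * ?b w * g w)" by simp
        show bi: "integrable P ?b"
          by (intro integrable_const_bound[where B = 1]) (auto simp: indicator_def)
        show "integrable P (\<lambda>w. obsA w * ?b w)"
          by (rule integrable_mult_AE_bounded[OF bi _ AE_abs_A_le]) simp
        show "integrable P (\<lambda>w. \<pi> (obsX w) * ?b w)"
          by (rule integrable_mult_AE_bounded[OF bi, where c = 1])
            (use \<pi>_pos \<pi>_le_1 in \<open>auto simp: abs_of_pos\<close>)
      qed
      \<comment> \<open>The difference is the P-mean of (A - \<pi>) b (1 + g). The summand 1
        contributes nothing because \<pi> is the propensity at P, and g contributes nothing by
        \<open>orth\<close>.\<close>
      have "(\<integral>w. ?b w * ?I w \<partial>?Q) - (\<integral>w. ?b w * \<pi> (obsX w) \<partial>?Q)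
          = (\<integral>w. ?b w * ?I w - ?b w * \<pi> (obsX w) \<partial>?Q)"
        by (intro Bochner_Integration.integral_diff[symmetric] Q.integrable_const_bound[where B = 1])
          (use \<pi>_pos \<pi>_le_1 in \<open>auto simp: abs_of_pos indicator_def\<close>)
      also have "\<dots> = (\<integral>w. (1 + g w) * (?b w * ?I w - ?b w * \<pi> (obsX w)) \<partial>P)"
        by (rule int_Q) simp
      also have "\<dots> = (\<integral>w. (obsA w * ?b w - \<pi> (obsX w) * ?b w) + (obsA w - \<pi> (obsX w)) * ?b w * g w \<partial>P)"
        by (rule integral_cong_AE) (use AE_A_indicator in \<open>auto elim!: eventually_mono simp: algebra_simps\<close>)
      also have "\<dots> = 0"
        using bg bi propensity_integral[OF b bi(3)] orth[of "indicator S"] by (simp add: indicator_def)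
      finally show "(\<integral>w. ?b w * ?I w \<partial>?Q) = (\<integral>w. ?b w * \<pi> (obsX w) \<partial>?Q)" by simp
    qed (auto simp: less_top[symmetric])
    from AE_symmetric[OF this] show ?thesis by (simp add: is_propensity_def)
  qed
  let ?e = "real_cond_exp ?Q sigma_Xt ?I"
  have "AE w in ?Q. 0 < ?e w"
  proof -
    interpret QXt: sigma_finite_subalgebra ?Q sigma_Xt
      using sigma_finite_subalgebra_sigma_of[OF prob_Q, of obsXt borel] by simp
    \<comment> \<open>\<open>?N\<close> marks the event of X~ where the perturbed conditional
      probability is not positive. It has no annotated observations under the perturbed law, hence
      none under P as null sets agree, and positivity at P makes it null.\<close>
    let ?N = "\<lambda>w. of_bool (?e w \<le> 0) :: real"
    have N: "?N \<in> borel_measurable sigma_Xt" by measurable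
    have N': "?N \<in> borel_measurable ?Q" by (rule measurable_from_subalg[OF QXt.subalg N])
    have int: "integrable ?Q (\<lambda>w. ?N w * ?I w)"
    proof (rule Q.integrable_const_bound[where B = 1])
      show "(\<lambda>w. ?N w * ?I w) \<in> borel_measurable ?Q"
        using N' by (rule borel_measurable_times) simp
    qed (simp add: indicator_def)
    have "(\<integral>w. ?N w * ?I w \<partial>?Q) = (\<integral>w. ?N w * ?e w \<partial>?Q)"
      by (rule QXt.real_cond_exp_intg(2)[symmetric, OF int N]) simp
    also have "\<dots> \<le> (\<integral>w. 0 \<partial>?Q)"
      by (rule integral_mono) (use QXt.real_cond_exp_intg(1)[OF int N] in auto)
    finally have "(\<integral>w. ?N w * ?I w \<partial>?Q) = 0"
      by (intro antisym) (auto intro!: integral_nonneg_AE)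
    then have "AE w in ?Q. ?N w * ?I w = 0"
      using integral_nonneg_eq_0_iff_AE[OF int] by simp
    then have "AE w in P. ?N w * ?I w = 0" by (simp only: AE_Q)
    then have "AE w in P. obsA w = 1 \<longrightarrow> \<not> ?e w \<le> 0"
      by eventually_elim (auto simp: indicator_def)
    moreover have "?e -` {0<..} \<inter> space sigma_Xt = {w. \<not> ?e w \<le> 0}" by auto
    then have "{w. \<not> ?e w \<le> 0} \<in> sets sigma_Xt"
      using measurable_sets[OF borel_measurable_cond_exp[of ?Q sigma_Xt ?I], of "{0<..}"] by simp
    ultimately have "AE w in P. \<not> ?e w \<le> 0" by (rule AE_of_annotated[rotated])
    then show ?thesis by (simp add: AE_Q not_le)
  qed
  then show ?thesis
    using AE_support prop_Q prob_Q by (simp add: known_propensity_model_def AE_Q del: AE_conj_iff)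
qed

text \<open>The linear path 1 + t g works: for small t its difference quotient is g itself, so the
  L2 error is zero, and t g meets the same mean and orthogonality conditions as g.\<close>

lemma bounded_score:
  assumes g[measurable]: "g \<in> borel_measurable P" and bd: "\<And>w. \<bar>g w\<bar> \<le> K" and g0: "(\<integral>w. g w \<partial>P) = 0"
    and orth: "\<And>b. b \<in> borel_measurable borel \<Longrightarrow> (\<And>x. \<bar>b x\<bar> \<le> 1) \<Longrightarrow>
      (\<integral>w. (obsA w - \<pi> (obsX w)) * b (obsX w) * g w \<partial>P) = 0"
  shows "g \<in> scores (known_propensity_model \<pi>) P"
proof -
  \<comment> \<open>The maximum keeps the density nonnegative for large t as well; near 0 it does
    nothing.\<close>
  define f where "f t w = max 0 (1 + t * g w)" for t w
  define Q where "Q t = density P (\<lambda>w. ennreal (f t w))" for t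
  have K: "0 \<le> K" using bd[of undefined] by linarith
  \<comment> \<open>In this range |t g| is at most |t| K, hence at most 1 / 2, the bound that
    \<open>density_in_model\<close> asks for.\<close>
  have small: "\<forall>\<^sub>F t in at (0::real). \<bar>t\<bar> * (2 * K + 1) < 1"
  proof -
    have "((\<lambda>t::real. \<bar>t\<bar> * (2 * K + 1)) \<longlongrightarrow> \<bar>0\<bar> * (2 * K + 1)) (at 0)" by (intro tendsto_intros)
    then show ?thesis by (intro order_tendstoD(2)) auto
  qed
  have tg: "\<bar>t * g w\<bar> \<le> 1 / 2" if "\<bar>t\<bar> * (2 * K + 1) < 1" for t w
  proof -
    have "\<bar>t * g w\<bar> \<le> \<bar>t\<bar> * K" using bd by (simp add: abs_mult mult_left_mono)
    also have "\<dots> \<le> 1 / 2" using that by (simp add: algebra_simps)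
    finally show ?thesis .
  qed
  have f_eq: "f t w = 1 + t * g w" if "\<bar>t\<bar> * (2 * K + 1) < 1" for t w
    using tg[OF that, of w] by (auto simp: f_def)
  have "regular_path P Q g"
    unfolding regular_path_def
  proof (intro conjI exI[of _ f])
    show "Q 0 = P" by (simp add: Q_def f_def density_1)
    show "g \<in> L2 P"
      unfolding L2_def
    proof (intro CollectI conjI g integrable_const_bound[where B = "K\<^sup>2"] AE_I2)
      show "norm ((g w)\<^sup>2) \<le> K\<^sup>2" for w
        using bd[of w] K abs_le_square_iff[of "g w" K] by simp
    qed simp
    show "\<forall>\<^sub>F t in at 0. f t \<in> borel_measurable P \<and> (\<forall>w. 0 \<le> f t w) \<and> Q t = density P (\<lambda>w. ennreal (f t w))"
      unfolding Q_def f_def by (intro always_eventually) simp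
    show "((\<lambda>t. \<integral>\<^sup>+ w. ennreal (((f t w - 1) / t - g w)\<^sup>2) \<partial>P) \<longlongrightarrow> 0) (at 0)"
    proof (rule tendsto_eventually)
      have "\<forall>\<^sub>F t in at (0::real). t \<noteq> 0" by (simp add: eventually_at_filter)
      with small show "\<forall>\<^sub>F t in at 0. (\<integral>\<^sup>+ w. ennreal (((f t w - 1) / t - g w)\<^sup>2) \<partial>P) = 0"
        by eventually_elim (simp add: f_eq)
    qed
  qed
  moreover have "\<forall>\<^sub>F t in at 0. Q t \<in> known_propensity_model \<pi>"
    using small
  proof eventually_elim
    case (elim t)
    have "(\<integral>w. (obsA w - \<pi> (obsX w)) * b (obsX w) * (t * g w) \<partial>P) = 0"
      if "b \<in> borel_measurable borel" "\<And>x. \<bar>b x\<bar> \<le> 1" for b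
      using orth[OF that] by (simp add: mult.left_commute[of _ t])
    with density_in_model[of "\<lambda>w. t * g w"] tg[OF elim] g0 show ?case
      by (simp add: Q_def f_eq[OF elim])
  qed
  ultimately show ?thesis by (auto simp: scores_def path_in_model_def)
qed

text \<open>\<^term>\<open>h\<close> is the limit of the projections \<open>T - E[T | A, X] + E[T | X] - E[T]\<close> of its
  truncations \<open>T\<close>; these are bounded scores, and the projection leaves \<^term>\<open>h\<close> unchanged.\<close>

lemma in_tangent_space:
  assumes h[measurable]: "h \<in> borel_measurable P" and h2: "integrable P (\<lambda>w. (h w)\<^sup>2)" and h0: "(\<integral>w. h w \<partial>P) = 0"
    and orth: "\<And>b. b \<in> borel_measurable borel \<Longrightarrow> (\<And>x. \<bar>b x\<bar> \<le> 1) \<Longrightarrow>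
      (\<integral>w. (obsA w - \<pi> (obsX w)) * b (obsX w) * h w \<partial>P) = 0"
  shows "h \<in> tangent_space (known_propensity_model \<pi>) P"
proof -
  let ?E1 = "real_cond_exp P sigma_X" and ?E2 = "real_cond_exp P sigma_AX"
  have h_int: "integrable P h" by (rule square_integrable_imp_integrable[OF h h2])
  have E1_AX: "?E1 f \<in> borel_measurable sigma_AX" for f
    by (rule measurable_from_subalg[OF subalgebra_AX_X]) simp
  \<comment> \<open>Orthogonality to every (A - \<pi>(X)) b(X) means, for binary A, that A carries
    no information on the mean of h beyond X.\<close>
  have E_eq: "AE w in P. ?E2 h w = ?E1 h w"
  proof -
    let ?q = "?E1 h"
    have q: "integrable P ?q" by (rule X.real_cond_exp_int(1)[OF h_int])
    have d: "integrable P (\<lambda>w. h w - ?q w)" using h_int q by simp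
    have Ad: "integrable P (\<lambda>w. obsA w * (h w - ?q w))"
      by (rule integrable_mult_AE_bounded[OF d _ AE_abs_A_le]) simp
    have rect: "(\<integral>w. indicator B (obsA w) * indicator D (obsX w) * (h w - ?q w) \<partial>P) = 0"
      if [measurable]: "B \<in> sets borel" "D \<in> sets borel" for B D
    proof -
      let ?D = "\<lambda>w. indicator D (obsX w) :: real"
      have D: "?D \<in> borel_measurable sigma_X" using measurable_sigma_X_compose[of "indicator D"] by simp
      have Dk: "integrable P (\<lambda>w. ?D w * k w)" if "integrable P k" for k
        by (rule integrable_mult_indicator_of[OF that, of obsX borel]) auto
      have ADk: "integrable P (\<lambda>w. obsA w * (?D w * k w))" "integrable P (\<lambda>w. \<pi> (obsX w) * (?D w * k w))"
        if "integrable P k" for k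
      proof -
        show "integrable P (\<lambda>w. obsA w * (?D w * k w))"
          by (rule integrable_mult_AE_bounded[OF Dk[OF that] _ AE_abs_A_le]) simp
        show "integrable P (\<lambda>w. \<pi> (obsX w) * (?D w * k w))"
          by (rule integrable_mult_AE_bounded[OF Dk[OF that], where c = 1])
            (use \<pi>_pos \<pi>_le_1 in \<open>auto simp: abs_of_pos\<close>)
      qed
      have zero1: "(\<integral>w. ?D w * (h w - ?q w) \<partial>P) = 0"
        using X.real_cond_exp_intg(2)[OF Dk[OF h_int] D h] Dk[OF h_int] Dk[OF q] by (simp add: right_diff_distrib)
      have "(\<integral>w. obsA w * (?D w * h w) - \<pi> (obsX w) * (?D w * h w) \<partial>P) = 0"
        using orth[of "indicator D"] by (simp add: indicator_def algebra_simps)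
      then have "(\<integral>w. obsA w * (?D w * h w) \<partial>P) = (\<integral>w. \<pi> (obsX w) * (?D w * h w) \<partial>P)"
        using ADk[OF h_int] by simp
      also have "\<dots> = (\<integral>w. \<pi> (obsX w) * (?D w * ?q w) \<partial>P)"
        using X.real_cond_exp_intg(2)[of "\<lambda>w. \<pi> (obsX w) * ?D w" h] ADk(2)[OF h_int] D
          measurable_sigma_X_compose[OF \<pi>_measurable]
        by (simp add: mult.assoc)
      also have "\<dots> = (\<integral>w. obsA w * (?D w * ?q w) \<partial>P)"
        by (rule propensity_integral[symmetric]) (use D Dk[OF q] in auto)
      finally have zero2: "(\<integral>w. obsA w * (?D w * (h w - ?q w)) \<partial>P) = 0"
        using ADk(1)[OF h_int] ADk(1)[OF q] by (simp add: right_diff_distrib)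
      \<comment> \<open>As A is 0 or 1, an indicator of A is affine in A, so only the weights 1 and
        A need testing.\<close>
      let ?i0 = "indicator B 0 :: real" and ?i1 = "indicator B 1 :: real"
      have "(\<integral>w. indicator B (obsA w) * indicator D (obsX w) * (h w - ?q w) \<partial>P)
        = (\<integral>w. ?i0 * (?D w * (h w - ?q w)) + (?i1 - ?i0) * (obsA w * (?D w * (h w - ?q w))) \<partial>P)"
      proof (rule integral_cong_AE)
        show "AE w in P. indicator B (obsA w) * indicator D (obsX w) * (h w - ?q w)
          = ?i0 * (?D w * (h w - ?q w)) + (?i1 - ?i0) * (obsA w * (?D w * (h w - ?q w)))"
          using AE_support by eventually_elim (auto simp: algebra_simps)
      qed simp_all
      also have "\<dots> = 0" using zero1 zero2 Dk[OF d] ADk(1)[OF d] by simp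
      finally show ?thesis .
    qed
    have "AE w in P. real_cond_exp P (sigma_of P (borel \<Otimes>\<^sub>M borel) (\<lambda>w. (obsA w, obsX w))) h w = ?q w"
    proof (rule real_cond_exp_sigma_of_charact[OF prob_space_Q _ h_int q])
      show "?q \<in> borel_measurable (sigma_of P (borel \<Otimes>\<^sub>M borel) (\<lambda>w. (obsA w, obsX w)))"
        using E1_AX by (simp add: borel_prod)
      fix S :: "(real \<times> (real ^ 'k)) set" assume S[measurable]: "S \<in> sets (borel \<Otimes>\<^sub>M borel)"
      have "(\<integral>w. indicator S (obsA w, obsX w) * (h w - ?q w) \<partial>P) = 0"
        by (rule integral_indicator_pair_eq_0[OF prob_space_Q _ _ d rect S]) auto
      moreover have "integrable P (\<lambda>w. indicator S (obsA w, obsX w) * k w)" if "integrable P k" for k :: "_ \<Rightarrow> real"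
        by (rule integrable_mult_indicator_of[OF that _ S]) simp
      ultimately show "(\<integral>w. indicator S (obsA w, obsX w) * h w \<partial>P) = (\<integral>w. indicator S (obsA w, obsX w) * ?q w \<partial>P)"
        using h_int q by (simp add: right_diff_distrib)
    qed simp
    then show ?thesis by (simp add: borel_prod)
  qed
  define T where "T n w = truncate (real n) (h w)" for n w
  define e where "e n w = h w - T n w" for n w
  have T[measurable]: "T n \<in> borel_measurable P" for n
    unfolding T_def using measurable_compose[OF h truncate_measurable] by simp
  have e[measurable]: "e n \<in> borel_measurable P" for n unfolding e_def by simp
  have T_bd: "\<bar>T n w\<bar> \<le> n" for n w by (simp add: T_def abs_truncate_le)
  have T_int: "integrable P (T n)" for n
    by (rule integrable_const_bound[where B = n]) (use T_bd in auto)
  have e_int: "integrable P (e n)" for n unfolding e_def using h_int T_int by simp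
  have e_le: "(e n w)\<^sup>2 \<le> (h w)\<^sup>2" for n w
    by (simp add: e_def T_def abs_diff_truncate_le flip: abs_le_square_iff)
  have e2: "integrable P (\<lambda>w. (e n w)\<^sup>2)" for n
    by (rule Bochner_Integration.integrable_bound[OF h2]) (use e_le in auto)
  have e_lim: "(\<lambda>n. \<integral>w. (e n w)\<^sup>2 \<partial>P) \<longlonglongrightarrow> (\<integral>w. 0 \<partial>P)"
  proof (rule integral_dominated_convergence[OF _ _ h2])
    show "AE w in P. (\<lambda>n. (e n w)\<^sup>2) \<longlonglongrightarrow> 0"
    proof (rule AE_I2, rule tendsto_eventually)
      fix w
      obtain N :: nat where "\<bar>h w\<bar> \<le> N" using real_arch_simple by blast
      then show "\<forall>\<^sub>F n in sequentially. (e n w)\<^sup>2 = 0"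
        by (intro eventually_sequentiallyI[of N]) (simp add: e_def T_def truncate_eq)
    qed
  qed (use e_le in auto)
  \<comment> \<open>For binary A the difference E[T | A, X] - E[T | X] is A - \<pi>(X) times a
    function of X. That is the component which would move the propensity, and it is removed
    here.\<close>
  define g where "g n w = T n w - ?E2 (T n) w + ?E1 (T n) w - (\<integral>v. T n v \<partial>P)" for n w
  have g[measurable]: "g n \<in> borel_measurable P" for n unfolding g_def by simp
  have gt: "AE w in P. truncate (4 * real n) (g n w) = g n w" for n
  proof -
    have "\<bar>\<integral>v. T n v \<partial>P\<bar> \<le> n"
    proof -
      have "\<bar>\<integral>v. T n v \<partial>P\<bar> \<le> (\<integral>v. \<bar>T n v\<bar> \<partial>P)"
        using integral_norm_bound[of P "T n"] by simp
      also have "\<dots> \<le> (\<integral>v. real n \<partial>P)"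
        by (rule integral_mono) (use T_int T_bd in auto)
      finally show ?thesis by simp
    qed
    moreover have "AE w in P. \<bar>?E1 (T n) w\<bar> \<le> n" "AE w in P. \<bar>?E2 (T n) w\<bar> \<le> n"
      by (rule AE_abs_real_cond_exp_le; use T_bd sigma_finite_subalgebra_X sigma_finite_subalgebra_AX in simp)+
    ultimately show ?thesis
    proof (elim AE_mp, intro AE_I2 impI)
      fix w assume "\<bar>\<integral>v. T n v \<partial>P\<bar> \<le> n" "\<bar>?E1 (T n) w\<bar> \<le> n" "\<bar>?E2 (T n) w\<bar> \<le> n"
      then show "truncate (4 * real n) (g n w) = g n w"
        using T_bd[of n w] by (intro truncate_eq) (simp add: g_def)
    qed
  qed
  \<comment> \<open>Each of the four terms of \<open>g\<close> is at most n, the conditional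
    expectations only almost everywhere. Truncating at 4 n turns this into the bound at every point
    that \<open>bounded_score\<close> wants, changing only a null set.\<close>
  define G where "G n w = truncate (4 * real n) (g n w)" for n w
  have G[measurable]: "G n \<in> borel_measurable P" for n
    unfolding G_def using measurable_compose[OF g truncate_measurable] by simp
  have G_eq: "AE w in P. G n w = g n w" for n using gt by (simp add: G_def)
  have G_score: "G n \<in> scores (known_propensity_model \<pi>) P" for n
  proof (rule bounded_score[OF G])
    show "\<bar>G n w\<bar> \<le> 4 * real n" for w by (simp add: G_def abs_truncate_le)
    have E_int: "integrable P (?E1 (T n))" "integrable P (?E2 (T n))"
      using X.real_cond_exp_int(1)[OF T_int] AX.real_cond_exp_int(1)[OF T_int] by auto
    have "(\<integral>w. G n w \<partial>P) = (\<integral>w. g n w \<partial>P)" by (rule integral_cong_AE) (use G_eq in auto)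
    also have "\<dots> = 0"
      using T_int E_int X.real_cond_exp_int(2)[OF T_int, of n] AX.real_cond_exp_int(2)[OF T_int, of n] prob_space
      by (simp add: g_def)
    finally show "(\<integral>w. G n w \<partial>P) = 0" .
    fix b :: "real ^ 'k \<Rightarrow> real" assume b[measurable]: "b \<in> borel_measurable borel" and bb: "\<And>x. \<bar>b x\<bar> \<le> 1"
    let ?k = "\<lambda>w. (obsA w - \<pi> (obsX w)) * b (obsX w)"
    note k_AX = propensity_residual_measurable_AX[OF b]
    note k_bd = AE_abs_propensity_residual_le[of b, OF bb]
    have k_int: "integrable P (\<lambda>w. ?k w * f w)" if "integrable P f" for f
      by (rule integrable_mult_AE_bounded[OF that _ k_bd]) simp
    have k1: "(\<integral>w. ?k w * ?E2 (T n) w \<partial>P) = (\<integral>w. ?k w * T n w \<partial>P)"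
      by (rule AX.real_cond_exp_intg(2)[OF k_int[OF T_int] k_AX T])
    have k2: "(\<integral>w. ?k w * f w \<partial>P) = 0" if "f \<in> borel_measurable sigma_X" "integrable P f" for f
      using that b bb by (rule propensity_residual_orthogonal)
    have "(\<integral>w. ?k w * G n w \<partial>P)
        = (\<integral>w. ?k w * T n w - ?k w * ?E2 (T n) w + ?k w * ?E1 (T n) w - ?k w * (\<integral>v. T n v \<partial>P) \<partial>P)"
    proof (rule integral_cong_AE)
      show "AE w in P. ?k w * G n w = ?k w * T n w - ?k w * ?E2 (T n) w + ?k w * ?E1 (T n) w - ?k w * (\<integral>v. T n v \<partial>P)"
        using G_eq[of n] by eventually_elim (simp add: g_def right_diff_distrib distrib_left)
    qed simp_all
    also have "\<dots> = (\<integral>w. ?k w * T n w \<partial>P) - (\<integral>w. ?k w * ?E2 (T n) w \<partial>P)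
        + (\<integral>w. ?k w * ?E1 (T n) w \<partial>P) - (\<integral>w. ?k w * (\<integral>v. T n v \<partial>P) \<partial>P)"
      using k_int[OF T_int[of n]] k_int[OF E_int(1)] k_int[OF E_int(2)] k_int[of "\<lambda>_. \<integral>v. T n v \<partial>P"]
      by (subst Bochner_Integration.integral_diff Bochner_Integration.integral_add; simp)+
    also have "\<dots> = 0"
      using k1 k2[of "?E1 (T n)"] k2[of "\<lambda>_. \<integral>v. T n v \<partial>P"] E_int by simp
    finally show "(\<integral>w. ?k w * G n w \<partial>P) = 0" .
  qed
  \<comment> \<open>The constant 16 is 4 for squaring a sum of four terms, times four terms whose
    second moments are each at most that of the truncation error.\<close>
  have approx: "(\<integral>w. (h w - G n w)\<^sup>2 \<partial>P) \<le> 16 * (\<integral>w. (e n w)\<^sup>2 \<partial>P)" for n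
  proof -
    let ?m = "\<integral>v. e n v \<partial>P"
    have c1: "integrable P (\<lambda>w. (?E1 (e n) w)\<^sup>2)" "(\<integral>w. (?E1 (e n) w)\<^sup>2 \<partial>P) \<le> (\<integral>w. (e n w)\<^sup>2 \<partial>P)"
      by (rule real_cond_exp_L2_contraction[OF sigma_finite_subalgebra_X e e2])+
    have c2: "integrable P (\<lambda>w. (?E2 (e n) w)\<^sup>2)" "(\<integral>w. (?E2 (e n) w)\<^sup>2 \<partial>P) \<le> (\<integral>w. (e n w)\<^sup>2 \<partial>P)"
      by (rule real_cond_exp_L2_contraction[OF sigma_finite_subalgebra_AX e e2])+
    have c3: "?m\<^sup>2 \<le> (\<integral>w. (e n w)\<^sup>2 \<partial>P)" by (rule square_expectation_le[OF e e2])
    have e_eq: "e n = (\<lambda>w. h w - T n w)" by (simp add: e_def fun_eq_iff)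
    \<comment> \<open>The projection is linear and fixes h, because E[h | A, X] = E[h | X] and E[h]
      = 0. So the error is the projection of the truncation error.\<close>
    have "AE w in P. h w - G n w = e n w - ?E2 (e n) w + ?E1 (e n) w - ?m"
      using G_eq[of n] E_eq X.real_cond_exp_diff[OF h_int T_int, of n] AX.real_cond_exp_diff[OF h_int T_int, of n]
    proof eventually_elim
      case (elim w)
      have "?m = - (\<integral>v. T n v \<partial>P)" using h_int T_int h0 by (simp add: e_eq)
      then show ?case using elim by (simp add: g_def e_eq)
    qed
    then have "AE w in P. (h w - G n w)\<^sup>2 \<le> 4 * ((e n w)\<^sup>2 + (?E2 (e n) w)\<^sup>2 + (?E1 (e n) w)\<^sup>2 + ?m\<^sup>2)"
      by eventually_elim (simp only: power2_sum4_le)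
    moreover have i: "integrable P (\<lambda>w. 4 * ((e n w)\<^sup>2 + (?E2 (e n) w)\<^sup>2 + (?E1 (e n) w)\<^sup>2 + ?m\<^sup>2))"
      using e2 c1 c2 by simp
    ultimately have "(\<integral>w. (h w - G n w)\<^sup>2 \<partial>P)
        \<le> (\<integral>w. 4 * ((e n w)\<^sup>2 + (?E2 (e n) w)\<^sup>2 + (?E1 (e n) w)\<^sup>2 + ?m\<^sup>2) \<partial>P)"
      by (intro integral_mono_AE Bochner_Integration.integrable_bound[OF i]) (auto elim!: eventually_mono)
    also have "\<dots> = 4 * ((\<integral>w. (e n w)\<^sup>2 \<partial>P) + (\<integral>w. (?E2 (e n) w)\<^sup>2 \<partial>P) + (\<integral>w. (?E1 (e n) w)\<^sup>2 \<partial>P) + ?m\<^sup>2)"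
      using e2 c1 c2 prob_space by simp
    also have "\<dots> \<le> 4 * ((\<integral>w. (e n w)\<^sup>2 \<partial>P) + (\<integral>w. (e n w)\<^sup>2 \<partial>P) + (\<integral>w. (e n w)\<^sup>2 \<partial>P) + (\<integral>w. (e n w)\<^sup>2 \<partial>P))"
      by (intro mult_left_mono add_mono c1(2) c2(2) c3 order_refl) simp
    finally show ?thesis by simp
  qed
  show ?thesis
    unfolding tangent_space_def
  proof (intro CollectI conjI allI impI)
    show "h \<in> L2 P" using h h2 by (simp add: L2_def)
    fix \<epsilon> :: real assume "0 < \<epsilon>"
    then have "\<forall>\<^sub>F n in sequentially. (\<integral>w. (e n w)\<^sup>2 \<partial>P) < \<epsilon> / 16"
      using order_tendstoD(2)[OF e_lim, of "\<epsilon> / 16"] by simp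
    then obtain n where "(\<integral>w. (e n w)\<^sup>2 \<partial>P) < \<epsilon> / 16" by (auto simp: eventually_sequentially)
    then have "(\<integral>w. (h w - (\<Sum>i<(1::nat). 1 * G n w))\<^sup>2 \<partial>P) < \<epsilon>" using approx[of n] by simp
    then show "\<exists>(m::nat) c g. (\<forall>i<m. g i \<in> scores (known_propensity_model \<pi>) P) \<and>
       (\<integral>w. (h w - (\<Sum>i<m. c i * g i w))\<^sup>2 \<partial>P) < \<epsilon>"
      using G_score by (intro exI[of _ 1] exI[of _ "\<lambda>_. 1"] exI[of _ "\<lambda>_. G n"]) simp
  qed
qed

end

subsection \<open>Pathwise derivatives\<close>

locale annotated_law = propensity_bounded P \<pi> \<eta>
  for P :: "('d::finite, 'k::finite, 'l::finite) obs measure" and \<pi> \<eta> +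
  fixes \<gamma> :: "real ^ 'd" and \<mu> :: "('d, 'k, 'l) xtilde \<Rightarrow> real" and B :: real
  assumes zperp_le: "AE w in P. \<bar>zperp \<gamma> w\<bar> \<le> B" "0 \<le> B"
    and is_mu: "is_mu P \<mu>"
    and ignorable: "AE w in P. real_cond_exp P sigma_Xt obsA w = \<pi> (obsX w)"
    and zY_L2: "integrable P (\<lambda>w. (zperp \<gamma> w * obsY w)\<^sup>2)"
begin

abbreviation "z \<equiv> zperp \<gamma>"
abbreviation "mX w \<equiv> \<mu> (obsXt w)"

text \<open>The uncentred augmented inverse probability weighted score.\<close>

definition \<zeta> :: "('d, 'k, 'l) obs \<Rightarrow> real" where
  "\<zeta> w = z w * (mX w + obsA w / \<pi> (obsX w) * (obsM w - mX w))"

lemma \<mu>_measurable [measurable]: "\<mu> \<in> borel_measurable borel"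
  using is_mu by (simp add: is_mu_def)

lemma mX_Xt: "mX \<in> borel_measurable sigma_Xt"
  by (rule measurable_sigma_Xt_compose) simp

lemma \<pi>_Xt: "(\<lambda>w. \<pi> (obsX w)) \<in> borel_measurable sigma_Xt"
  by (rule measurable_sigma_Xt_obsX) simp

lemma z_Xt: "z \<in> borel_measurable sigma_Xt"
  by (rule measurable_sigma_Xt_zperp)

lemma \<zeta>_measurable [measurable]: "\<zeta> \<in> borel_measurable borel"
  unfolding \<zeta>_def[abs_def] by measurable

lemma mX_eq_reg_annotated: "AE w in P. mX w = reg_annotated P w"
proof (rule AE_of_annotated)
  have "{w \<in> space sigma_Xt. mX w = reg_annotated P w} \<in> sets sigma_Xt"
    using mX_Xt reg_annotated_measurable by measurable
  then show S: "{w. mX w = reg_annotated P w} \<in> sets sigma_Xt" by simp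
  then have "{w. mX w = reg_annotated P w} \<in> sets borel"
    using Xt.subalg by (auto simp: subalgebra_def)
  then show "AE w in P. obsA w = 1 \<longrightarrow> mX w = reg_annotated P w"
    using is_mu AE_annotated_law[of "\<lambda>w. mX w = reg_annotated P w"] by (simp add: is_mu_def)
qed

lemma mX_bounds: "AE w in P. 0 \<le> mX w \<and> mX w \<le> 1"
  using mX_eq_reg_annotated reg_annotated_bounded by eventually_elim simp

lemma ignorable_integral:
  assumes b: "b \<in> borel_measurable sigma_Xt" "integrable P b"
  shows "(\<integral>w. obsA w * b w \<partial>P) = (\<integral>w. \<pi> (obsX w) * b w \<partial>P)"
proof -
  note [measurable] = measurable_Xt[OF b(1)]
  have i: "integrable P (\<lambda>w. b w * obsA w)"
    using integrable_mult_AE_bounded[OF b(2) _ AE_abs_A_le] by (simp add: mult.commute)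
  have "(\<integral>w. obsA w * b w \<partial>P) = (\<integral>w. b w * real_cond_exp P sigma_Xt obsA w \<partial>P)"
    using Xt.real_cond_exp_intg(2)[OF i b(1)] by (simp add: mult.commute)
  also have "\<dots> = (\<integral>w. \<pi> (obsX w) * b w \<partial>P)"
    by (rule integral_cong_AE) (use ignorable in \<open>auto elim!: eventually_mono simp: mult.commute\<close>)
  finally show ?thesis .
qed

lemma residual:
  assumes b: "b \<in> borel_measurable sigma_Xt" "AE w in P. \<bar>b w\<bar> \<le> c"
  shows "(\<integral>w. obsA w * (obsM w - mX w) * b w \<partial>P) = 0"
proof -
  note [measurable] = measurable_Xt[OF b(1)] measurable_Xt[OF reg_annotated_measurable]
  have "(\<integral>w. obsA w * (obsM w - mX w) * b w \<partial>P) = (\<integral>w. obsA w * (obsM w - reg_annotated P w) * b w \<partial>P)"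
    by (rule integral_cong_AE) (use mX_eq_reg_annotated in \<open>auto elim!: eventually_mono\<close>)
  then show ?thesis using reg_annotated_residual[OF b] by simp
qed

lemma AE_weight_bounds: "AE w in P. 0 \<le> obsA w / \<pi> (obsX w) \<and> obsA w / \<pi> (obsX w) \<le> 1 / \<eta>"
  using AE_support
proof eventually_elim
  case (elim w)
  have "1 / \<pi> (obsX w) \<le> 1 / \<eta>" using \<pi>_ge[of "obsX w"] \<pi>_bounds(1) by (simp add: frac_le)
  then show ?case using elim \<pi>_bounds(1) \<pi>_pos[of "obsX w"] by auto
qed

text \<open>A common almost sure bound for \<open>\<zeta>\<close> and
  \<open>weighting_error\<close>: the weights A / \<pi> are at most 1 / \<eta>, while \<mu> and |M -
  \<mu>| are at most 1.\<close>

definition K :: real where "K = B * (1 + 1 / \<eta>)"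

lemma K_nonneg: "0 \<le> K"
  using zperp_le(2) \<pi>_bounds(1) by (simp add: K_def)

lemma AE_abs_\<zeta>_le: "AE w in P. \<bar>\<zeta> w\<bar> \<le> K"
  using AE_weight_bounds mX_bounds zperp_le(1) AE_support
proof eventually_elim
  case (elim w)
  have "\<bar>obsM w - mX w\<bar> \<le> 1" using elim by auto
  then have "\<bar>obsA w / \<pi> (obsX w) * (obsM w - mX w)\<bar> \<le> 1 / \<eta> * 1"
    unfolding abs_mult using elim \<pi>_bounds(1) by (intro mult_mono) auto
  then have "\<bar>mX w + obsA w / \<pi> (obsX w) * (obsM w - mX w)\<bar> \<le> 1 + 1 / \<eta>"
    using elim by linarith
  then show ?case unfolding \<zeta>_def K_def abs_mult using elim zperp_le(2) by (intro mult_mono) auto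
qed

text \<open>The slope of the score in the regression value: replacing \<mu> by \<mu> + \<delta> adds
  exactly \<open>weighting_error\<close> times \<delta> to \<open>\<zeta>\<close>.\<close>

definition weighting_error :: "('d, 'k, 'l) obs \<Rightarrow> real" where "weighting_error w = z w * (1 - obsA w / \<pi> (obsX w))"

lemma weighting_error_measurable [measurable]: "weighting_error \<in> borel_measurable borel"
  unfolding weighting_error_def[abs_def] by measurable

lemma AE_abs_weighting_error_le: "AE w in P. \<bar>weighting_error w\<bar> \<le> K"
  using AE_weight_bounds zperp_le(1)
proof eventually_elim
  case (elim w)
  then have "\<bar>1 - obsA w / \<pi> (obsX w)\<bar> \<le> 1 + 1 / \<eta>" by linarith
  then show ?case unfolding weighting_error_def K_def abs_mult using elim zperp_le(2) by (intro mult_mono) auto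
qed

text \<open>At P the mean of A given X~ is \<pi>(X), so 1 - A / \<pi> is centred given X~. To first
  order the score is thus insensitive to errors in \<mu>.\<close>

lemma integral_weighting_error:
  assumes b: "b \<in> borel_measurable sigma_Xt" "integrable P b"
  shows "(\<integral>w. weighting_error w * b w \<partial>P) = 0"
proof -
  note [measurable] = measurable_Xt[OF b(1)]
  have zb: "integrable P (\<lambda>w. z w * b w)"
    by (rule integrable_mult_AE_bounded[OF b(2) _ zperp_le(1)]) simp
  have zb\<pi>: "integrable P (\<lambda>w. inverse (\<pi> (obsX w)) * (z w * b w))"
    by (rule integrable_mult_AE_bounded[OF zb, where c = "inverse \<eta>"])
      (use \<pi>_ge \<pi>_pos \<pi>_bounds(1) in \<open>auto intro!: AE_I2 le_imp_inverse_le simp: abs_of_pos\<close>)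
  have Azb: "integrable P (\<lambda>w. obsA w * (inverse (\<pi> (obsX w)) * (z w * b w)))"
    by (rule integrable_mult_AE_bounded[OF zb\<pi> _ AE_abs_A_le]) simp
  have "(\<integral>w. weighting_error w * b w \<partial>P) = (\<integral>w. z w * b w - obsA w * (inverse (\<pi> (obsX w)) * (z w * b w)) \<partial>P)"
    by (rule Bochner_Integration.integral_cong) (simp_all add: weighting_error_def field_simps)
  also have "\<dots> = (\<integral>w. z w * b w \<partial>P) - (\<integral>w. obsA w * (inverse (\<pi> (obsX w)) * (z w * b w)) \<partial>P)"
    using zb Azb by simp
  also have "(\<integral>w. obsA w * (inverse (\<pi> (obsX w)) * (z w * b w)) \<partial>P)
      = (\<integral>w. \<pi> (obsX w) * (inverse (\<pi> (obsX w)) * (z w * b w)) \<partial>P)"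
    by (intro ignorable_integral zb\<pi> borel_measurable_times borel_measurable_inverse z_Xt \<pi>_Xt b(1))
  also have "\<dots> = (\<integral>w. z w * b w \<partial>P)"
    using \<pi>_pos by (intro Bochner_Integration.integral_cong) (auto simp: field_simps less_imp_neq[THEN not_sym])
  finally show ?thesis by simp
qed

lemma AE_abs_z\<pi>_le: "AE w in P. \<bar>z w / \<pi> (obsX w)\<bar> \<le> B / \<eta>"
  using zperp_le(1)
proof eventually_elim
  case (elim w)
  then show ?case
    using \<pi>_ge[of "obsX w"] \<pi>_pos[of "obsX w"] \<pi>_bounds(1) zperp_le(2)
    by (simp add: abs_divide abs_of_pos frac_le)
qed

lemma z\<pi>_Xt: "(\<lambda>w. z w / \<pi> (obsX w)) \<in> borel_measurable sigma_Xt"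
  using z_Xt \<pi>_Xt by measurable

lemma integrable_AE_bounded: "f \<in> borel_measurable P \<Longrightarrow> AE w in P. \<bar>f w\<bar> \<le> c \<Longrightarrow> integrable P f"
  for f :: "_ \<Rightarrow> real"
  by (rule integrable_const_bound[where B = c]) auto

lemma integrable_\<zeta>: "integrable P \<zeta>"
  by (rule integrable_AE_bounded[OF _ AE_abs_\<zeta>_le]) simp

lemma integrable_zmX: "integrable P (\<lambda>w. z w * mX w)"
proof (rule integrable_AE_bounded)
  show "AE w in P. \<bar>z w * mX w\<bar> \<le> B * 1"
    using zperp_le(1) mX_bounds
    by eventually_elim (simp only: abs_mult, intro mult_mono, auto intro: zperp_le(2))
qed simp

lemma theta_den_eq_zmX: "theta_den \<gamma> P = (\<integral>w. z w * mX w \<partial>P)"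
  unfolding theta_den_def
  by (rule integral_cong_AE)
    (use mX_eq_reg_annotated measurable_Xt[OF reg_annotated_measurable] in \<open>auto elim!: eventually_mono\<close>)

lemma theta_den_eq: "theta_den \<gamma> P = (\<integral>w. \<zeta> w \<partial>P)"
proof -
  have "(\<integral>w. \<zeta> w - z w * mX w \<partial>P) = (\<integral>w. obsA w * (obsM w - mX w) * (z w / \<pi> (obsX w)) \<partial>P)"
    by (intro Bochner_Integration.integral_cong) (auto simp: \<zeta>_def field_simps)
  also have "\<dots> = 0" by (rule residual[OF z\<pi>_Xt AE_abs_z\<pi>_le])
  finally show ?thesis using integrable_\<zeta> integrable_zmX by (simp add: theta_den_eq_zmX)
qed

lemma phi_den_eq: "phi_den \<gamma> \<pi> \<mu> P w = \<zeta> w - theta_den \<gamma> P"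
  by (simp add: phi_den_def \<zeta>_def)

lemma \<zeta>_L2: "integrable P (\<lambda>w. (\<zeta> w)\<^sup>2)"
proof (rule integrable_AE_bounded)
  show "AE w in P. \<bar>(\<zeta> w)\<^sup>2\<bar> \<le> K\<^sup>2"
    using AE_abs_\<zeta>_le by eventually_elim (use K_nonneg abs_le_square_iff[of _ K] in auto)
qed simp

text \<open>The second-order term of the functional is the product of two errors: the likelihood
  perturbation and \<open>\<delta>\<close>, the change of the regression function.\<close>

lemma theta_den_expansion:
  assumes f[measurable]: "f \<in> borel_measurable P" and f0: "\<And>w. 0 \<le> f w"
    and Q: "density P (\<lambda>w. ennreal (f w)) \<in> known_propensity_model \<pi>"
    and u2: "integrable P (\<lambda>w. (f w - 1)\<^sup>2)"
  obtains \<delta> where "\<delta> \<in> borel_measurable P" "AE w in P. \<bar>\<delta> w\<bar> \<le> 1"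
    "\<eta> * (\<integral>w. (\<delta> w)\<^sup>2 \<partial>P) \<le> 2 * (\<integral>w. \<bar>f w - 1\<bar> \<partial>P)"
    "theta_den \<gamma> (density P (\<lambda>w. ennreal (f w))) - theta_den \<gamma> P
      = (\<integral>w. (f w - 1) * \<zeta> w \<partial>P) + (\<integral>w. (f w - 1) * (weighting_error w * \<delta> w) \<partial>P)"
proof -
  let ?Q = "density P (\<lambda>w. ennreal (f w))"
  interpret Q: propensity_model ?Q \<pi> by unfold_locales (rule Q)
  have AE_Q: "AE w in ?Q. R w" if "AE w in P. R w" for R
    using that by (subst AE_density) (auto elim!: eventually_mono)
  have int_Q: "(\<integral>w. a w \<partial>?Q) = (\<integral>w. f w * a w \<partial>P)" if "a \<in> borel_measurable P" for a :: "_ \<Rightarrow> real"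
    using that f0 by (subst integral_real_density) (auto intro!: AE_I2)
  have u_int: "integrable P (\<lambda>w. f w - 1)"
    by (rule square_integrable_imp_integrable[OF _ u2]) simp
  have f_int: "integrable P f" using Bochner_Integration.integrable_add[OF u_int integrable_const[of 1]] by simp
  have bdd: "integrable P (\<lambda>w. f w * a w)" "integrable P (\<lambda>w. (f w - 1) * a w)" "integrable P a"
    if "a \<in> borel_measurable P" "AE w in P. \<bar>a w\<bar> \<le> c" for a c
    using integrable_mult_AE_bounded[OF f_int that] integrable_mult_AE_bounded[OF u_int that]
      integrable_AE_bounded[OF that] by (simp_all add: mult.commute)
  have split: "(\<integral>w. f w * a w \<partial>P) = (\<integral>w. a w \<partial>P) + (\<integral>w. (f w - 1) * a w \<partial>P)"
    if a: "a \<in> borel_measurable P" "AE w in P. \<bar>a w\<bar> \<le> c" for a c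
    using bdd[OF a] by (simp add: left_diff_distrib)
  \<comment> \<open>The regression under the perturbed law lies in [0, 1] only almost everywhere for
    that law, which may have more null sets than P because f may vanish. Clipping gives bounds at
    every point.\<close>
  define m where "m w = max 0 (min 1 (reg_annotated ?Q w))" for w
  have m_Xt: "m \<in> borel_measurable sigma_Xt"
    unfolding m_def using Q.reg_annotated_measurable by measurable
  have m_eq: "AE w in ?Q. m w = reg_annotated ?Q w"
    using Q.reg_annotated_bounded by eventually_elim (simp add: m_def)
  define \<delta> where "\<delta> w = m w - mX w" for w
  have \<delta>_Xt: "\<delta> \<in> borel_measurable sigma_Xt" unfolding \<delta>_def using m_Xt mX_Xt by measurable
  note [measurable] = measurable_Xt[OF m_Xt] measurable_Xt[OF \<delta>_Xt] measurable_Xt[OF Q.reg_annotated_measurable]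
  have m_bd: "\<bar>m w\<bar> \<le> 1" for w by (simp add: m_def)
  have \<delta>_bd: "AE w in P. \<bar>\<delta> w\<bar> \<le> 1"
    using mX_bounds by eventually_elim (auto simp: \<delta>_def m_def)
  have Q_res: "(\<integral>w. f w * (obsA w * (obsM w - m w) * b w) \<partial>P) = 0"
    if b: "b \<in> borel_measurable sigma_Xt" "AE w in P. \<bar>b w\<bar> \<le> c" for b c
  proof -
    note [measurable] = measurable_Xt[OF b(1)]
    have "(\<integral>w. obsA w * (obsM w - m w) * b w \<partial>?Q) = (\<integral>w. obsA w * (obsM w - reg_annotated ?Q w) * b w \<partial>?Q)"
      by (rule integral_cong_AE) (use m_eq in \<open>auto elim!: eventually_mono\<close>)
    also have "\<dots> = 0" by (rule Q.reg_annotated_residual[OF b(1) AE_Q[OF b(2)]])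
    finally show ?thesis by (subst (asm) int_Q) auto
  qed
  have AM_bd: "AE w in P. \<bar>obsA w * (obsM w - c w) * b w\<bar> \<le> d"
    if "AE w in P. 0 \<le> c w \<and> c w \<le> 1" "AE w in P. \<bar>b w\<bar> \<le> d" for b c d
    using that AE_support
  proof eventually_elim
    case (elim w)
    have "\<bar>obsA w * (obsM w - c w)\<bar> \<le> 1" using elim by auto
    then have "\<bar>obsA w * (obsM w - c w)\<bar> * \<bar>b w\<bar> \<le> 1 * d" using elim by (intro mult_mono) auto
    then show ?case by (simp add: abs_mult)
  qed
  have m01: "AE w in P. 0 \<le> m w \<and> m w \<le> 1" by (simp add: m_def)
  have weighting_error\<delta>_bd: "AE w in P. \<bar>weighting_error w * \<delta> w\<bar> \<le> K * 1"
    using AE_abs_weighting_error_le \<delta>_bd by eventually_elim (simp only: abs_mult, intro mult_mono, auto intro: K_nonneg)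
  have \<delta>2_bd: "AE w in P. \<bar>(\<delta> w)\<^sup>2\<bar> \<le> 1"
    using \<delta>_bd by eventually_elim (use abs_square_le_1 in auto)
  have A\<delta>2_bd: "AE w in P. \<bar>obsA w * (\<delta> w)\<^sup>2\<bar> \<le> 1"
    using \<delta>2_bd AE_support by eventually_elim auto
  show ?thesis
  proof (rule that)
    show "\<delta> \<in> borel_measurable P" by simp
    show "AE w in P. \<bar>\<delta> w\<bar> \<le> 1" by (rule \<delta>_bd)
    let ?r = "\<lambda>w. obsA w * (obsM w - mX w) * \<delta> w"
    have r_bd: "AE w in P. \<bar>?r w\<bar> \<le> 1" by (rule AM_bd[OF mX_bounds \<delta>_bd])
    have d_bd: "AE w in P. \<bar>obsA w * (obsM w - m w) * \<delta> w\<bar> \<le> 1" by (rule AM_bd[OF m01 \<delta>_bd])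
    \<comment> \<open>Write A \<delta>^2 as the residual at \<mu> minus the residual at m, each
      times \<delta>. The second is centred under the perturbed law and the first under P, so only f
      - 1 against the first is left.\<close>
    have "(\<integral>w. f w * (obsA w * (\<delta> w)\<^sup>2) \<partial>P) = (\<integral>w. f w * ?r w - f w * (obsA w * (obsM w - m w) * \<delta> w) \<partial>P)"
      by (intro Bochner_Integration.integral_cong) (auto simp: \<delta>_def power2_eq_square algebra_simps)
    also have "\<dots> = (\<integral>w. f w * ?r w \<partial>P)"
      using bdd(1)[OF _ r_bd] bdd(1)[OF _ d_bd] Q_res[OF \<delta>_Xt \<delta>_bd] by simp
    also have "\<dots> = (\<integral>w. (f w - 1) * ?r w \<partial>P)"
      using split[OF _ r_bd] residual[OF \<delta>_Xt \<delta>_bd] by simp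
    finally have fA: "(\<integral>w. f w * (obsA w * (\<delta> w)\<^sup>2) \<partial>P) = (\<integral>w. (f w - 1) * ?r w \<partial>P)" .
    have abs_le: "\<bar>\<integral>w. (f w - 1) * a w \<partial>P\<bar> \<le> (\<integral>w. \<bar>f w - 1\<bar> \<partial>P)"
      if a: "a \<in> borel_measurable P" "AE w in P. \<bar>a w\<bar> \<le> 1" for a
    proof -
      have "\<bar>\<integral>w. (f w - 1) * a w \<partial>P\<bar> \<le> (\<integral>w. \<bar>(f w - 1) * a w\<bar> \<partial>P)"
        using integral_norm_bound[of P "\<lambda>w. (f w - 1) * a w"] by simp
      also have "\<dots> \<le> (\<integral>w. \<bar>f w - 1\<bar> \<partial>P)"
      proof (rule integral_mono_AE)
        show "AE w in P. \<bar>(f w - 1) * a w\<bar> \<le> \<bar>f w - 1\<bar>"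
          using a(2) by eventually_elim (simp add: abs_mult mult_left_le)
      qed (use bdd(2)[OF a] u_int in auto)
      finally show ?thesis .
    qed
    \<comment> \<open>Overlap and \<open>ignorable\<close> reduce the second moment of \<delta> to
      its second moment on annotated observations.\<close>
    have "\<eta> * (\<integral>w. (\<delta> w)\<^sup>2 \<partial>P) = (\<integral>w. \<eta> * (\<delta> w)\<^sup>2 \<partial>P)" by simp
    also have "\<dots> \<le> (\<integral>w. \<pi> (obsX w) * (\<delta> w)\<^sup>2 \<partial>P)"
    proof (rule integral_mono)
      show "integrable P (\<lambda>w. \<pi> (obsX w) * (\<delta> w)\<^sup>2)"
        by (rule integrable_mult_AE_bounded[OF bdd(3)[OF _ \<delta>2_bd], where c = 1])
          (use \<pi>_pos \<pi>_le_1 in \<open>auto simp: abs_of_pos\<close>)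
    qed (use bdd(3)[OF _ \<delta>2_bd] \<pi>_ge in \<open>auto intro: mult_right_mono\<close>)
    also have "\<dots> = (\<integral>w. obsA w * (\<delta> w)\<^sup>2 \<partial>P)"
      using \<delta>_Xt bdd(3)[OF _ \<delta>2_bd] by (intro ignorable_integral[symmetric]) auto
    also have "\<dots> = (\<integral>w. f w * (obsA w * (\<delta> w)\<^sup>2) \<partial>P) - (\<integral>w. (f w - 1) * (obsA w * (\<delta> w)\<^sup>2) \<partial>P)"
      using split[OF _ A\<delta>2_bd] by simp
    \<comment> \<open>Both terms integrate f - 1 against a function bounded by 1, whence the factor
      2.\<close>
    also have "\<dots> \<le> 2 * (\<integral>w. \<bar>f w - 1\<bar> \<partial>P)"
      using abs_le[OF _ r_bd] abs_le[OF _ A\<delta>2_bd] unfolding fA by (simp add: abs_le_iff)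
    finally show "\<eta> * (\<integral>w. (\<delta> w)\<^sup>2 \<partial>P) \<le> 2 * (\<integral>w. \<bar>f w - 1\<bar> \<partial>P)" .
    let ?s = "\<lambda>w. obsA w * (obsM w - m w) * (z w / \<pi> (obsX w))"
    have s_bd: "AE w in P. \<bar>?s w\<bar> \<le> B / \<eta>" by (rule AM_bd[OF m01 AE_abs_z\<pi>_le])
    have "theta_den \<gamma> ?Q = (\<integral>w. z w * m w \<partial>?Q)"
      unfolding theta_den_def by (rule integral_cong_AE) (use m_eq in \<open>auto elim!: eventually_mono\<close>)
    also have "\<dots> = (\<integral>w. f w * (z w * m w) \<partial>P)" by (rule int_Q) simp
    also have "\<dots> = (\<integral>w. f w * \<zeta> w + f w * (weighting_error w * \<delta> w) - f w * ?s w \<partial>P)"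
    proof (rule Bochner_Integration.integral_cong)
      fix w
      \<comment> \<open>The first two terms together are the score with m in place of \<mu>.
        Subtracting \<open>?s\<close> strips off its weighted residual, which is centred under the
        perturbed law.\<close>
      have "z w * m w = \<zeta> w + weighting_error w * \<delta> w - ?s w"
        using \<pi>_pos[of "obsX w"] by (simp add: \<zeta>_def weighting_error_def \<delta>_def field_simps)
      then show "f w * (z w * m w) = f w * \<zeta> w + f w * (weighting_error w * \<delta> w) - f w * ?s w"
        by (simp only: distrib_left right_diff_distrib)
    qed simp
    also have "\<dots> = (\<integral>w. f w * \<zeta> w \<partial>P) + (\<integral>w. f w * (weighting_error w * \<delta> w) \<partial>P)"
      using bdd(1)[OF _ AE_abs_\<zeta>_le] bdd(1)[OF _ weighting_error\<delta>_bd] bdd(1)[OF _ s_bd] Q_res[OF z\<pi>_Xt AE_abs_z\<pi>_le] by simp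
    \<comment> \<open>\<delta> is a function of X~, so its product with the weighting error
      integrates to zero under P. Only f - 1 survives against it, which makes the term second
      order.\<close>
    also have "\<dots> = theta_den \<gamma> P + (\<integral>w. (f w - 1) * \<zeta> w \<partial>P) + (\<integral>w. (f w - 1) * (weighting_error w * \<delta> w) \<partial>P)"
      using split[OF _ AE_abs_\<zeta>_le] split[OF _ weighting_error\<delta>_bd] integral_weighting_error[OF \<delta>_Xt bdd(3)[OF _ \<delta>_bd]]
      by (simp add: theta_den_eq)
    finally show "theta_den \<gamma> ?Q - theta_den \<gamma> P
      = (\<integral>w. (f w - 1) * \<zeta> w \<partial>P) + (\<integral>w. (f w - 1) * (weighting_error w * \<delta> w) \<partial>P)" by simp
  qed
qed

text \<open>After division by t the remainder pairs h plus an L2 error with the weighting error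
  times \<delta>. The L2 norm of \<delta> tends to zero with t, so the remainder does too, although
  no derivative of the regression exists.\<close>

lemma theta_den_gradient:
  assumes path: "path_in_model (known_propensity_model \<pi>) P Q h"
  shows "((\<lambda>t. (theta_den \<gamma> (Q t) - theta_den \<gamma> P) / t) \<longlongrightarrow> (\<integral>w. \<zeta> w * h w \<partial>P)) (at 0)"
proof -
  have reg: "regular_path P Q h" and inQ: "\<forall>\<^sub>F t in at 0. Q t \<in> known_propensity_model \<pi>"
    using path by (auto simp: path_in_model_def)
  obtain f where f: "\<forall>\<^sub>F t in at 0. t \<noteq> 0 \<and> f t \<in> borel_measurable P \<and> (\<forall>w. 0 \<le> f t w) \<and>
       Q t = density P (\<lambda>w. ennreal (f t w)) \<and>
       integrable P (\<lambda>w. ((f t w - 1) / t - h w)\<^sup>2) \<and> integrable P (\<lambda>w. (f t w - 1)\<^sup>2)"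
    and lim: "((\<lambda>t. \<integral>w. ((f t w - 1) / t - h w)\<^sup>2 \<partial>P) \<longlongrightarrow> 0) (at 0)"
    by (rule regular_path_obtain[OF prob_space_Q reg]) blast
  have h[measurable]: "h \<in> borel_measurable P" and h2: "integrable P (\<lambda>w. (h w)\<^sup>2)"
    using reg by (auto simp: regular_path_def L2_def)
  define H where "H = sqrt (\<integral>w. (h w)\<^sup>2 \<partial>P)"
  define R where "R t = sqrt (\<integral>w. ((f t w - 1) / t - h w)\<^sup>2 \<partial>P)" for t
  \<comment> \<open>The part with h uses Cauchy-Schwarz and the bound 2 / \<eta> times the first
    moment of f - 1 for the second moment of \<delta>. The part with the path error R needs only
    |\<delta>| at most 1.\<close>
  define \<beta> where "\<beta> t = K * (H * sqrt (2 / \<eta> * (\<bar>t\<bar> * (H + R t))) + R t)" for t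
  have nonneg: "0 \<le> H" "0 \<le> R t" for t by (simp_all add: H_def R_def)
  have R0: "(R \<longlongrightarrow> 0) (at 0)" unfolding R_def using tendsto_real_sqrt[OF lim] by simp
  have "(\<beta> \<longlongrightarrow> K * (H * sqrt (2 / \<eta> * (\<bar>0\<bar> * (H + 0))) + 0)) (at 0)"
    unfolding \<beta>_def by (intro tendsto_intros R0)
  then have \<beta>0: "(\<beta> \<longlongrightarrow> 0) (at 0)" by simp
  have main: "((\<lambda>t. \<integral>w. \<zeta> w * ((f t w - 1) / t) \<partial>P) \<longlongrightarrow> (\<integral>w. \<zeta> w * h w \<partial>P)) (at 0)"
    by (rule tendsto_integral_mult_of_L2[OF _ \<zeta>_L2 h h2 _ lim]) (use f in \<open>auto elim!: eventually_mono\<close>)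
  have "((\<lambda>t. (theta_den \<gamma> (Q t) - theta_den \<gamma> P) / t - (\<integral>w. \<zeta> w * ((f t w - 1) / t) \<partial>P)) \<longlongrightarrow> 0) (at 0)"
  proof (rule Lim_null_comparison[OF _ \<beta>0])
    show "\<forall>\<^sub>F t in at 0. norm ((theta_den \<gamma> (Q t) - theta_den \<gamma> P) / t - (\<integral>w. \<zeta> w * ((f t w - 1) / t) \<partial>P)) \<le> \<beta> t"
      using f inQ
    proof eventually_elim
      case (elim t)
      then have t: "t \<noteq> 0" and ft[measurable]: "f t \<in> borel_measurable P" and f0: "\<And>w. 0 \<le> f t w"
        and Qt: "Q t = density P (\<lambda>w. ennreal (f t w))"
        and r2: "integrable P (\<lambda>w. ((f t w - 1) / t - h w)\<^sup>2)" and u2: "integrable P (\<lambda>w. (f t w - 1)\<^sup>2)"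
        by auto
      obtain \<delta> where \<delta>[measurable]: "\<delta> \<in> borel_measurable P" and \<delta>_bd: "AE w in P. \<bar>\<delta> w\<bar> \<le> 1"
        and \<delta>2_le: "\<eta> * (\<integral>w. (\<delta> w)\<^sup>2 \<partial>P) \<le> 2 * (\<integral>w. \<bar>f t w - 1\<bar> \<partial>P)"
        and ex: "theta_den \<gamma> (Q t) - theta_den \<gamma> P
          = (\<integral>w. (f t w - 1) * \<zeta> w \<partial>P) + (\<integral>w. (f t w - 1) * (weighting_error w * \<delta> w) \<partial>P)"
        by (rule theta_den_expansion[OF ft f0 elim(2)[unfolded Qt] u2, folded Qt])
      define r where "r w = (f t w - 1) / t - h w" for w
      have r[measurable]: "r \<in> borel_measurable P" unfolding r_def by simp
      have r2': "integrable P (\<lambda>w. (r w)\<^sup>2)" using r2 by (simp add: r_def)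
      have u_eq: "f t w - 1 = t * (h w + r w)" for w using t by (simp add: r_def)
      have h_int: "integrable P h" "integrable P r"
        by (rule square_integrable_imp_integrable; use h2 r2' in simp)+
      have \<delta>2: "integrable P (\<lambda>w. (\<delta> w)\<^sup>2)"
        by (rule integrable_AE_bounded[where c = 1]) (use \<delta>_bd in \<open>auto elim!: eventually_mono simp: abs_square_le_1\<close>)
      have one: "(\<integral>w. \<bar>a w\<bar> \<partial>P) \<le> sqrt (\<integral>w. (a w)\<^sup>2 \<partial>P)"
        if "a \<in> borel_measurable P" "integrable P (\<lambda>w. (a w)\<^sup>2)" for a :: "_ \<Rightarrow> real"
        using Cauchy_Schwarz_integral[of a P "\<lambda>_. 1"] that prob_space by simp
      have "(\<integral>w. \<bar>f t w - 1\<bar> \<partial>P) \<le> (\<integral>w. \<bar>t\<bar> * (\<bar>h w\<bar> + \<bar>r w\<bar>) \<partial>P)"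
        using h_int unfolding u_eq
        by (intro integral_mono) (auto simp: abs_mult intro!: mult_left_mono)
      also have "\<dots> = \<bar>t\<bar> * ((\<integral>w. \<bar>h w\<bar> \<partial>P) + (\<integral>w. \<bar>r w\<bar> \<partial>P))" using h_int by simp
      also have "\<dots> \<le> \<bar>t\<bar> * (H + R t)"
        using one[OF h h2] one[OF r r2'] by (intro mult_left_mono add_mono) (auto simp: H_def R_def r_def)
      finally have u_le: "(\<integral>w. \<bar>f t w - 1\<bar> \<partial>P) \<le> \<bar>t\<bar> * (H + R t)" .
      have \<delta>_small: "(\<integral>w. (\<delta> w)\<^sup>2 \<partial>P) \<le> 2 / \<eta> * (\<bar>t\<bar> * (H + R t))"
        using \<delta>2_le u_le \<pi>_bounds(1) by (simp add: field_simps)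
      have \<delta>_le1: "(\<integral>w. (\<delta> w)\<^sup>2 \<partial>P) \<le> 1"
      proof -
        have "(\<integral>w. (\<delta> w)\<^sup>2 \<partial>P) \<le> (\<integral>w. 1 \<partial>P)"
          by (rule integral_mono_AE) (use \<delta>_bd \<delta>2 in \<open>auto elim!: eventually_mono simp: abs_square_le_1\<close>)
        then show ?thesis using prob_space by simp
      qed
      have h\<delta>: "(\<integral>w. \<bar>h w * \<delta> w\<bar> \<partial>P) \<le> H * sqrt (2 / \<eta> * (\<bar>t\<bar> * (H + R t)))"
      proof -
        have "(\<integral>w. \<bar>h w * \<delta> w\<bar> \<partial>P) \<le> H * sqrt (\<integral>w. (\<delta> w)\<^sup>2 \<partial>P)"
          unfolding H_def by (rule Cauchy_Schwarz_integral[OF h \<delta> h2 \<delta>2])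
        also have "\<dots> \<le> H * sqrt (2 / \<eta> * (\<bar>t\<bar> * (H + R t)))"
          using \<delta>_small nonneg by (intro mult_left_mono) auto
        finally show ?thesis .
      qed
      have r\<delta>: "(\<integral>w. \<bar>r w * \<delta> w\<bar> \<partial>P) \<le> R t"
      proof -
        have "(\<integral>w. \<bar>r w * \<delta> w\<bar> \<partial>P) \<le> R t * sqrt (\<integral>w. (\<delta> w)\<^sup>2 \<partial>P)"
          using Cauchy_Schwarz_integral[OF r \<delta> r2' \<delta>2] by (simp add: R_def r_def)
        also have "\<dots> \<le> R t * 1" using \<delta>_le1 nonneg by (intro mult_left_mono) auto
        finally show ?thesis by simp
      qed
      have hr\<delta>: "integrable P (\<lambda>w. h w * \<delta> w)" "integrable P (\<lambda>w. r w * \<delta> w)"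
        by (rule integrable_mult_of_squares; use h2 r2' \<delta>2 in simp)+
      have "\<bar>(theta_den \<gamma> (Q t) - theta_den \<gamma> P) / t - (\<integral>w. \<zeta> w * ((f t w - 1) / t) \<partial>P)\<bar>
          = \<bar>\<integral>w. (h w + r w) * (weighting_error w * \<delta> w) \<partial>P\<bar>"
      proof -
        have "(\<integral>w. (f t w - 1) * \<zeta> w \<partial>P) = (\<integral>w. t * (\<zeta> w * ((f t w - 1) / t)) \<partial>P)"
          using t by (intro Bochner_Integration.integral_cong) auto
        moreover have "(\<integral>w. (f t w - 1) * (weighting_error w * \<delta> w) \<partial>P) = (\<integral>w. t * ((h w + r w) * (weighting_error w * \<delta> w)) \<partial>P)"
          by (intro Bochner_Integration.integral_cong) (auto simp: u_eq)
        ultimately show ?thesis unfolding ex using t by (simp add: add_divide_distrib)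
      qed
      also have "\<dots> \<le> (\<integral>w. \<bar>(h w + r w) * (weighting_error w * \<delta> w)\<bar> \<partial>P)"
        using integral_norm_bound[of P "\<lambda>w. (h w + r w) * (weighting_error w * \<delta> w)"] by simp
      also have "\<dots> \<le> (\<integral>w. K * (\<bar>h w * \<delta> w\<bar> + \<bar>r w * \<delta> w\<bar>) \<partial>P)"
      proof -
        have le: "AE w in P. \<bar>(h w + r w) * (weighting_error w * \<delta> w)\<bar> \<le> K * (\<bar>h w * \<delta> w\<bar> + \<bar>r w * \<delta> w\<bar>)"
          using AE_abs_weighting_error_le
        proof eventually_elim
          case (elim w)
          have "\<bar>(h w + r w) * (weighting_error w * \<delta> w)\<bar> = \<bar>weighting_error w\<bar> * \<bar>h w * \<delta> w + r w * \<delta> w\<bar>"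
            by (simp add: algebra_simps flip: abs_mult)
          also have "\<dots> \<le> K * (\<bar>h w * \<delta> w\<bar> + \<bar>r w * \<delta> w\<bar>)"
            using elim K_nonneg by (intro mult_mono) auto
          finally show ?case .
        qed
        have i: "integrable P (\<lambda>w. K * (\<bar>h w * \<delta> w\<bar> + \<bar>r w * \<delta> w\<bar>))" using hr\<delta> by simp
        show ?thesis
          by (rule integral_mono_AE[OF Bochner_Integration.integrable_bound[OF i] i le])
            (use le K_nonneg in \<open>auto elim!: eventually_mono\<close>)
      qed
      also have "\<dots> = K * ((\<integral>w. \<bar>h w * \<delta> w\<bar> \<partial>P) + (\<integral>w. \<bar>r w * \<delta> w\<bar> \<partial>P))" using hr\<delta> by simp
      also have "\<dots> \<le> \<beta> t"
        unfolding \<beta>_def using h\<delta> r\<delta> K_nonneg by (intro mult_left_mono add_mono)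
      finally show ?case by simp
    qed
  qed
  from tendsto_add[OF this main] show ?thesis by simp
qed

section \<open>Gradients of the numerator, the denominator and the ratio\<close>

lemma score_mean: "path_in_model (known_propensity_model \<pi>) P Q h \<Longrightarrow> (\<integral>w. h w \<partial>P) = 0"
  by (rule score_mean_zero[OF prob_space_Q])
    (auto simp: path_in_model_def known_propensity_model_def elim!: eventually_mono)

lemma integral_mult_minus_const:
  fixes T h :: "('d, 'k, 'l) obs \<Rightarrow> real"
  assumes "T \<in> borel_measurable P" "integrable P (\<lambda>w. (T w)\<^sup>2)"
    and "h \<in> borel_measurable P" "integrable P (\<lambda>w. (h w)\<^sup>2)" "(\<integral>w. h w \<partial>P) = 0"
  shows "(\<integral>w. (T w - c) * h w \<partial>P) = (\<integral>w. T w * h w \<partial>P)"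
proof -
  have "integrable P (\<lambda>w. T w * h w)" "integrable P h"
    by (rule integrable_mult_of_squares square_integrable_imp_integrable; use assms in simp)+
  then show ?thesis using assms(5) by (simp add: left_diff_distrib)
qed

lemma L2_minus_const:
  fixes T :: "('d, 'k, 'l) obs \<Rightarrow> real"
  assumes "T \<in> borel_measurable P" "integrable P (\<lambda>w. (T w)\<^sup>2)"
  shows "(\<lambda>w. T w - c) \<in> L2 P"
proof -
  have "integrable P T" by (rule square_integrable_imp_integrable) (use assms in auto)
  then show ?thesis using assms by (simp add: L2_def power2_diff)
qed

lemma pathwise_gradient_num: "pathwise_gradient (known_propensity_model \<pi>) (theta_num \<gamma>) P (phi_num \<gamma> P)"
  unfolding pathwise_gradient_def
proof (intro conjI allI impI)
  show "phi_num \<gamma> P \<in> L2 P"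
    unfolding phi_num_def[abs_def] by (rule L2_minus_const) (use zY_L2 in auto)
  fix Q h assume path: "path_in_model (known_propensity_model \<pi>) P Q h"
  then have reg: "regular_path P Q h" by (simp add: path_in_model_def)
  then have h: "h \<in> borel_measurable P" "integrable P (\<lambda>w. (h w)\<^sup>2)"
    by (auto simp: regular_path_def L2_def)
  \<comment> \<open>Scores have mean zero, so centring the influence function leaves its pairing
    with them unchanged.\<close>
  have "(\<integral>w. phi_num \<gamma> P w * h w \<partial>P) = (\<integral>w. z w * obsY w * h w \<partial>P)"
    unfolding phi_num_def by (rule integral_mult_minus_const) (use zY_L2 h score_mean[OF path] in auto)
  with pathwise_derivative_integral[OF prob_space_Q reg _ zY_L2]
  show "((\<lambda>t. (theta_num \<gamma> (Q t) - theta_num \<gamma> P) / t) \<longlongrightarrow> (\<integral>w. phi_num \<gamma> P w * h w \<partial>P)) (at 0)"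
    by (simp add: theta_num_def)
qed

lemma pathwise_gradient_den: "pathwise_gradient (known_propensity_model \<pi>) (theta_den \<gamma>) P (phi_den \<gamma> \<pi> \<mu> P)"
  unfolding pathwise_gradient_def
proof (intro conjI allI impI)
  show "phi_den \<gamma> \<pi> \<mu> P \<in> L2 P"
    unfolding phi_den_eq[abs_def] by (rule L2_minus_const) (use \<zeta>_L2 in auto)
  fix Q h assume path: "path_in_model (known_propensity_model \<pi>) P Q h"
  then have h: "h \<in> borel_measurable P" "integrable P (\<lambda>w. (h w)\<^sup>2)"
    by (auto simp: path_in_model_def regular_path_def L2_def)
  have "(\<integral>w. phi_den \<gamma> \<pi> \<mu> P w * h w \<partial>P) = (\<integral>w. \<zeta> w * h w \<partial>P)"
    unfolding phi_den_eq by (rule integral_mult_minus_const) (use \<zeta>_L2 h score_mean[OF path] in auto)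
  with theta_den_gradient[OF path]
  show "((\<lambda>t. (theta_den \<gamma> (Q t) - theta_den \<gamma> P) / t) \<longlongrightarrow> (\<integral>w. phi_den \<gamma> \<pi> \<mu> P w * h w \<partial>P)) (at 0)"
    by simp
qed

definition \<phi> :: "('d, 'k, 'l) obs \<Rightarrow> real" where
  "\<phi> w = inverse (theta_den \<gamma> P) * (phi_num \<gamma> P w - theta_ratio \<gamma> P * phi_den \<gamma> \<pi> \<mu> P w)"

lemma phi_L2: "phi_num \<gamma> P \<in> L2 P" "phi_den \<gamma> \<pi> \<mu> P \<in> L2 P"
  using pathwise_gradient_num pathwise_gradient_den by (simp_all add: pathwise_gradient_def)

lemma phi_measurable [measurable]: "phi_num \<gamma> P \<in> borel_measurable borel" "phi_den \<gamma> \<pi> \<mu> P \<in> borel_measurable borel"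
  unfolding phi_num_def[abs_def] phi_den_eq[abs_def] by measurable

lemma \<phi>_measurable [measurable]: "\<phi> \<in> borel_measurable borel"
  unfolding \<phi>_def[abs_def] by measurable

lemma \<phi>_L2: "integrable P (\<lambda>w. (\<phi> w)\<^sup>2)"
proof -
  have "integrable P (\<lambda>w. (phi_num \<gamma> P w - theta_ratio \<gamma> P * phi_den \<gamma> \<pi> \<mu> P w)\<^sup>2)"
  proof -
    have "integrable P (\<lambda>w. phi_num \<gamma> P w * phi_den \<gamma> \<pi> \<mu> P w)"
      by (rule integrable_mult_of_squares) (use phi_L2 in \<open>auto simp: L2_def\<close>)
    then have "integrable P (\<lambda>w. phi_num \<gamma> P w * (theta_ratio \<gamma> P * phi_den \<gamma> \<pi> \<mu> P w))"
      by (simp add: mult.left_commute)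
    then show ?thesis using phi_L2 by (simp add: L2_def power2_diff power_mult_distrib mult.assoc)
  qed
  then show ?thesis by (simp add: \<phi>_def power_mult_distrib)
qed

text \<open>The delta method along a path: since \<open>Q 0 = P\<close>, the difference quotients
  are ordinary derivatives at 0, and the quotient rule produces \<phi>.\<close>

lemma pathwise_gradient_ratio:
  assumes "theta_den \<gamma> P \<noteq> 0"
  shows "pathwise_gradient (known_propensity_model \<pi>) (theta_ratio \<gamma>) P \<phi>"
  unfolding pathwise_gradient_def
proof (intro conjI allI impI)
  show "\<phi> \<in> L2 P" using \<phi>_L2 by (simp add: L2_def)
  fix Q h assume path: "path_in_model (known_propensity_model \<pi>) P Q h"
  then have Q0: "Q 0 = P" and h: "h \<in> borel_measurable P" "integrable P (\<lambda>w. (h w)\<^sup>2)"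
    by (auto simp: path_in_model_def regular_path_def L2_def)
  let ?n = "\<integral>w. phi_num \<gamma> P w * h w \<partial>P" and ?d = "\<integral>w. phi_den \<gamma> \<pi> \<mu> P w * h w \<partial>P"
  have N: "((\<lambda>t. theta_num \<gamma> (Q t)) has_real_derivative ?n) (at 0)"
    using pathwise_gradient_num path Q0 by (simp add: pathwise_gradient_def DERIV_def)
  have D: "((\<lambda>t. theta_den \<gamma> (Q t)) has_real_derivative ?d) (at 0)"
    using pathwise_gradient_den path Q0 by (simp add: pathwise_gradient_def DERIV_def)
  have "((\<lambda>t. theta_ratio \<gamma> (Q t)) has_real_derivative
      (- (inverse (theta_den \<gamma> P) * ?d * inverse (theta_den \<gamma> P))) * theta_num \<gamma> P
        + ?n * inverse (theta_den \<gamma> P)) (at 0)"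
    unfolding theta_ratio_def
    using DERIV_mult[OF DERIV_inverse'[OF D] N] assms Q0 by simp
  moreover have "(- (inverse (theta_den \<gamma> P) * ?d * inverse (theta_den \<gamma> P))) * theta_num \<gamma> P
        + ?n * inverse (theta_den \<gamma> P) = (\<integral>w. \<phi> w * h w \<partial>P)"
  proof -
    have i: "integrable P (\<lambda>w. phi_num \<gamma> P w * h w)" "integrable P (\<lambda>w. phi_den \<gamma> \<pi> \<mu> P w * h w)"
      by (rule integrable_mult_of_squares; use phi_L2 h in \<open>auto simp: L2_def\<close>)+
    have "(\<integral>w. \<phi> w * h w \<partial>P) = (\<integral>w. inverse (theta_den \<gamma> P) *
        (phi_num \<gamma> P w * h w - theta_ratio \<gamma> P * (phi_den \<gamma> \<pi> \<mu> P w * h w)) \<partial>P)"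
      by (simp add: \<phi>_def algebra_simps)
    also have "\<dots> = inverse (theta_den \<gamma> P) * (?n - theta_ratio \<gamma> P * ?d)" using i by simp
    finally show ?thesis by (simp add: theta_ratio_def algebra_simps)
  qed
  ultimately show "((\<lambda>t. (theta_ratio \<gamma> (Q t) - theta_ratio \<gamma> P) / t) \<longlongrightarrow> (\<integral>w. \<phi> w * h w \<partial>P)) (at 0)"
    using Q0 by (simp add: DERIV_def)
qed

section \<open>Orthogonality to the propensity residual and efficiency\<close>

lemma mean_phi: "(\<integral>w. phi_num \<gamma> P w \<partial>P) = 0" "(\<integral>w. phi_den \<gamma> \<pi> \<mu> P w \<partial>P) = 0"
proof -
  have "integrable P (\<lambda>w. z w * obsY w)"
    by (rule square_integrable_imp_integrable[OF _ zY_L2]) simp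
  then show "(\<integral>w. phi_num \<gamma> P w \<partial>P) = 0" by (simp add: phi_num_def theta_num_def prob_space)
  show "(\<integral>w. phi_den \<gamma> \<pi> \<mu> P w \<partial>P) = 0"
    using integrable_\<zeta> by (simp add: phi_den_eq theta_den_eq prob_space)
qed

lemma integrable_phi: "integrable P (phi_num \<gamma> P)" "integrable P (phi_den \<gamma> \<pi> \<mu> P)"
  by (rule square_integrable_imp_integrable; use phi_L2 in \<open>auto simp: L2_def\<close>)+

lemma mean_\<phi>: "(\<integral>w. \<phi> w \<partial>P) = 0"
  using mean_phi integrable_phi by (simp add: \<phi>_def)

lemma integrable_propensity_residual_mult:
  assumes "integrable P f" "b \<in> borel_measurable borel" "\<And>x. \<bar>b x\<bar> \<le> 1"
  shows "integrable P (\<lambda>w. (obsA w - \<pi> (obsX w)) * b (obsX w) * f w)"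
  by (rule integrable_mult_AE_bounded[OF assms(1) _ AE_abs_propensity_residual_le]) (use assms in auto)

text \<open>For binary A one has (A - \<pi>) A / \<pi> = A / \<pi> - A. The product therefore splits
  into regression residuals weighted by functions of X~, and A - \<pi> times a function of X~; both
  are centred at P.\<close>

lemma phi_den_orthogonal:
  assumes b[measurable]: "b \<in> borel_measurable borel" and bb: "\<And>x. \<bar>b x\<bar> \<le> 1"
  shows "(\<integral>w. (obsA w - \<pi> (obsX w)) * b (obsX w) * phi_den \<gamma> \<pi> \<mu> P w \<partial>P) = 0"
proof -
  have bX: "(\<lambda>w. b (obsX w)) \<in> borel_measurable sigma_Xt" by (rule measurable_sigma_Xt_obsX) simp
  have b1: "integrable P (\<lambda>w. b (obsX w))" by (rule integrable_AE_bounded[where c = 1]) (use bb in auto)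
  have bzm: "integrable P (\<lambda>w. b (obsX w) * (z w * mX w))"
    by (rule integrable_mult_AE_bounded[OF integrable_zmX, where c = 1]) (use bb in auto)
  let ?c1 = "\<lambda>w. b (obsX w) * (z w / \<pi> (obsX w))" and ?c2 = "\<lambda>w. b (obsX w) * z w"
  let ?c3 = "\<lambda>w. b (obsX w) * (z w * mX w)"
  have c1: "?c1 \<in> borel_measurable sigma_Xt" "AE w in P. \<bar>?c1 w\<bar> \<le> 1 * (B / \<eta>)"
    and c2: "?c2 \<in> borel_measurable sigma_Xt" "AE w in P. \<bar>?c2 w\<bar> \<le> 1 * B"
    and c3: "?c3 \<in> borel_measurable sigma_Xt"
  proof -
    show "AE w in P. \<bar>?c1 w\<bar> \<le> 1 * (B / \<eta>)"
      using AE_abs_z\<pi>_le by eventually_elim (simp only: abs_mult, intro mult_mono bb, auto)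
    show "AE w in P. \<bar>?c2 w\<bar> \<le> 1 * B"
      using zperp_le(1) by eventually_elim (simp only: abs_mult, intro mult_mono bb, auto)
  qed (intro borel_measurable_times bX z\<pi>_Xt z_Xt mX_Xt)+
  have AM: "AE w in P. \<bar>obsA w * (obsM w - mX w)\<bar> \<le> 1"
    using AE_support mX_bounds by eventually_elim auto
  have i: "integrable P (\<lambda>w. obsA w * (obsM w - mX w) * ?c1 w)" "integrable P (\<lambda>w. obsA w * (obsM w - mX w) * ?c2 w)"
    by (rule integrable_mult_AE_bounded[OF integrable_AE_bounded[OF _ c1(2)] _ AM], simp_all)
      (rule integrable_mult_AE_bounded[OF integrable_AE_bounded[OF _ c2(2)] _ AM], simp_all)
  have i3: "integrable P (\<lambda>w. obsA w * ?c3 w)" "integrable P (\<lambda>w. \<pi> (obsX w) * ?c3 w)"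
    using integrable_mult_AE_bounded[OF bzm _ AE_abs_A_le]
      integrable_mult_AE_bounded[OF bzm, of "\<lambda>w. \<pi> (obsX w)" 1] \<pi>_pos \<pi>_le_1 by (auto simp: abs_of_pos)
  have "(\<integral>w. (obsA w - \<pi> (obsX w)) * b (obsX w) * \<zeta> w \<partial>P)
      = (\<integral>w. (obsA w * (obsM w - mX w) * ?c1 w - obsA w * (obsM w - mX w) * ?c2 w)
          + (obsA w * ?c3 w - \<pi> (obsX w) * ?c3 w) \<partial>P)"
  proof (rule integral_cong_AE)
    show "AE w in P. (obsA w - \<pi> (obsX w)) * b (obsX w) * \<zeta> w
      = (obsA w * (obsM w - mX w) * ?c1 w - obsA w * (obsM w - mX w) * ?c2 w) + (obsA w * ?c3 w - \<pi> (obsX w) * ?c3 w)"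
      using AE_support
    proof eventually_elim
      case (elim w)
      then have "obsA w = 0 \<or> obsA w = 1" by auto
      then show ?case using \<pi>_pos[of "obsX w"] by (auto simp: \<zeta>_def field_simps)
    qed
  qed simp_all
  also have "\<dots> = 0"
    using i i3 residual[OF c1] residual[OF c2] ignorable_integral[OF c3 bzm] by simp
  finally have \<zeta>0: "(\<integral>w. (obsA w - \<pi> (obsX w)) * b (obsX w) * \<zeta> w \<partial>P) = 0" .
  have c0: "(\<integral>w. (obsA w - \<pi> (obsX w)) * b (obsX w) * theta_den \<gamma> P \<partial>P) = 0"
    by (rule propensity_residual_orthogonal) (use b bb in auto)
  show ?thesis
    using \<zeta>0 c0 integrable_propensity_residual_mult[OF integrable_\<zeta> b bb]
      integrable_propensity_residual_mult[OF integrable_const[of "theta_den \<gamma> P"] b bb]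
    by (simp only: phi_den_eq right_diff_distrib Bochner_Integration.integral_diff diff_0_right)
qed

lemma efficient_den:
  "efficient_influence_function (known_propensity_model \<pi>) (theta_den \<gamma>) P (phi_den \<gamma> \<pi> \<mu> P)"
  unfolding efficient_influence_function_def
proof (intro conjI in_model pathwise_gradient_den in_tangent_space)
  show "integrable P (\<lambda>w. (phi_den \<gamma> \<pi> \<mu> P w)\<^sup>2)" using phi_L2 by (simp add: L2_def)
qed (use mean_phi phi_den_orthogonal in auto)

text \<open>The condition under which Z^perp Y is uncorrelated with all (A - \<pi>(X)) b(X). It is
  not supplied by the conditional independences for (C, Z, U, \<open>Mstar\<close>), because the
  baseline outcome does not occur in them.\<close>

definition outcome_ignorable :: bool where
  "outcome_ignorable \<longleftrightarrow>
    (AE w in P. real_cond_exp P sigma_AX (\<lambda>w. z w * obsY w) w = real_cond_exp P sigma_X (\<lambda>w. z w * obsY w) w)"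

lemma phi_num_orthogonal:
  assumes "outcome_ignorable" and b[measurable]: "b \<in> borel_measurable borel" and bb: "\<And>x. \<bar>b x\<bar> \<le> 1"
  shows "(\<integral>w. (obsA w - \<pi> (obsX w)) * b (obsX w) * phi_num \<gamma> P w \<partial>P) = 0"
proof -
  let ?T = "\<lambda>w. z w * obsY w" and ?r = "\<lambda>w. (obsA w - \<pi> (obsX w)) * b (obsX w)"
  have T: "integrable P ?T"
    by (rule square_integrable_imp_integrable[OF _ zY_L2]) simp
  note rT = integrable_propensity_residual_mult[OF T b bb]
  have "(\<integral>w. ?r w * ?T w \<partial>P) = (\<integral>w. ?r w * real_cond_exp P sigma_AX ?T w \<partial>P)"
    by (rule AX.real_cond_exp_intg(2)[symmetric, OF rT propensity_residual_measurable_AX[OF b]]) simp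
  also have "\<dots> = (\<integral>w. ?r w * real_cond_exp P sigma_X ?T w \<partial>P)"
    using assms(1) by (intro integral_cong_AE) (auto elim!: eventually_mono simp: outcome_ignorable_def)
  also have "\<dots> = 0"
    by (rule propensity_residual_orthogonal[OF _ X.real_cond_exp_int(1)[OF T] b bb]) simp
  finally have T0: "(\<integral>w. ?r w * ?T w \<partial>P) = 0" .
  have c0: "(\<integral>w. ?r w * theta_num \<gamma> P \<partial>P) = 0"
    by (rule propensity_residual_orthogonal) (use b bb in auto)
  show ?thesis
    using T0 c0 rT integrable_propensity_residual_mult[OF integrable_const[of "theta_num \<gamma> P"] b bb]
    by (simp only: phi_num_def right_diff_distrib Bochner_Integration.integral_diff diff_0_right)
qed

lemma efficient_num:
  assumes "outcome_ignorable"
  shows "efficient_influence_function (known_propensity_model \<pi>) (theta_num \<gamma>) P (phi_num \<gamma> P)"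
  unfolding efficient_influence_function_def
proof (intro conjI in_model pathwise_gradient_num in_tangent_space)
  show "integrable P (\<lambda>w. (phi_num \<gamma> P w)\<^sup>2)" using phi_L2 by (simp add: L2_def)
qed (use mean_phi phi_num_orthogonal[OF assms] in auto)

lemma efficient_ratio:
  assumes "outcome_ignorable" "theta_den \<gamma> P \<noteq> 0"
  shows "efficient_influence_function (known_propensity_model \<pi>) (theta_ratio \<gamma>) P \<phi>"
  unfolding efficient_influence_function_def
proof (intro conjI in_model pathwise_gradient_ratio assms in_tangent_space)
  fix b :: "real ^ 'k \<Rightarrow> real" assume b: "b \<in> borel_measurable borel" "\<And>x. \<bar>b x\<bar> \<le> 1"
  let ?r = "\<lambda>w. (obsA w - \<pi> (obsX w)) * b (obsX w)"
  have "(\<integral>w. ?r w * \<phi> w \<partial>P) = (\<integral>w. inverse (theta_den \<gamma> P) *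
      (?r w * phi_num \<gamma> P w - theta_ratio \<gamma> P * (?r w * phi_den \<gamma> \<pi> \<mu> P w)) \<partial>P)"
    by (simp add: \<phi>_def algebra_simps)
  also have "\<dots> = 0"
    using phi_num_orthogonal[OF assms(1) b] phi_den_orthogonal[OF b]
      integrable_propensity_residual_mult[OF integrable_phi(1) b]
      integrable_propensity_residual_mult[OF integrable_phi(2) b] by simp
  finally show "(\<integral>w. ?r w * \<phi> w \<partial>P) = 0" .
qed (use \<phi>_L2 mean_\<phi> in auto)

text \<open>An estimated regression error need not be integrable, only its product with the
  weighting error; hence the detour through indicators.\<close>

lemma integral_weighting_error_Xt:
  assumes "g \<in> borel_measurable borel" "integrable P (\<lambda>w. g (obsXt w) * weighting_error w)"
  shows "(\<integral>w. g (obsXt w) * weighting_error w \<partial>P) = 0"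
proof (rule integral_mult_eq_0_of_indicators[OF prob_space_Q _ integrable_AE_bounded[OF _ AE_abs_weighting_error_le] _ assms])
  fix S :: "('d, 'k, 'l) xtilde set" assume S[measurable]: "S \<in> sets borel"
  have "(\<lambda>w. indicator S (obsXt w) :: real) \<in> borel_measurable sigma_Xt"
    by (rule measurable_sigma_Xt_compose) simp
  then have "(\<integral>w. weighting_error w * indicator S (obsXt w) \<partial>P) = 0"
    by (rule integral_weighting_error) (auto intro!: integrable_AE_bounded[where c = 1] simp: indicator_def)
  then show "(\<integral>w. indicator S (obsXt w) * weighting_error w \<partial>P) = 0" by (simp add: mult.commute)
qed simp_all

text \<open>Split A M into the centred residual A (M - \<mu>) and A \<mu>; in the latter E[A | X~] =
  \<pi>(X) cancels the weight. This links the regression form of the denominator to the inverse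
  weighted form from which the latent treatment is recovered.\<close>

lemma integral_annotated_outcome:
  "(\<integral>w. obsA w * obsM w * (z w / \<pi> (obsX w)) \<partial>P) = theta_den \<gamma> P"
proof -
  have AM: "AE w in P. \<bar>obsA w * (obsM w - mX w)\<bar> \<le> 1"
    using AE_support mX_bounds by eventually_elim auto
  have z\<pi>: "integrable P (\<lambda>w. z w / \<pi> (obsX w))" by (rule integrable_AE_bounded[OF _ AE_abs_z\<pi>_le]) simp
  have i1: "integrable P (\<lambda>w. obsA w * (obsM w - mX w) * (z w / \<pi> (obsX w)))"
    by (rule integrable_mult_AE_bounded[OF z\<pi> _ AM]) simp
  have m: "AE w in P. \<bar>mX w\<bar> \<le> 1" using mX_bounds by eventually_elim auto
  have mz: "integrable P (\<lambda>w. mX w * (z w / \<pi> (obsX w)))"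
    by (rule integrable_mult_AE_bounded[OF z\<pi> _ m]) simp
  have i2: "integrable P (\<lambda>w. obsA w * (mX w * (z w / \<pi> (obsX w))))"
    by (rule integrable_mult_AE_bounded[OF mz _ AE_abs_A_le]) simp
  have "(\<integral>w. obsA w * obsM w * (z w / \<pi> (obsX w)) \<partial>P)
      = (\<integral>w. obsA w * (obsM w - mX w) * (z w / \<pi> (obsX w)) + obsA w * (mX w * (z w / \<pi> (obsX w))) \<partial>P)"
    by (intro Bochner_Integration.integral_cong) (auto simp: algebra_simps diff_divide_distrib)
  also have "\<dots> = (\<integral>w. obsA w * (mX w * (z w / \<pi> (obsX w))) \<partial>P)"
    using i1 i2 residual[OF z\<pi>_Xt AE_abs_z\<pi>_le] by simp
  also have "\<dots> = (\<integral>w. \<pi> (obsX w) * (mX w * (z w / \<pi> (obsX w))) \<partial>P)"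
    by (intro ignorable_integral borel_measurable_times mX_Xt z\<pi>_Xt mz)
  also have "\<dots> = (\<integral>w. z w * mX w \<partial>P)"
    using \<pi>_pos by (intro Bochner_Integration.integral_cong) (auto simp: less_imp_neq[THEN not_sym])
  finally show ?thesis by (simp add: theta_den_eq_zmX)
qed

end

subsection \<open>Cross-fitting\<close>

locale cross_fit = law: annotated_law P \<pi> \<eta> \<gamma> \<mu> B + iid_sample M W P
  for P :: "('d::finite, 'k::finite, 'l::finite) obs measure" and \<pi> \<eta> \<gamma> \<mu> B
    and M :: "'a measure" and W +
  fixes I I' :: "nat \<Rightarrow> nat set"
    and muhat :: "nat \<Rightarrow> (nat \<Rightarrow> ('d, 'k, 'l) obs) \<Rightarrow> ('d, 'k, 'l) xtilde \<Rightarrow> real"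
  assumes den_nonzero: "theta_den \<gamma> P \<noteq> 0"
    and split: "\<And>n. finite (I n)" "\<And>n. I n \<inter> I' n = {}"
      "filterlim (\<lambda>n. card (I n)) at_top sequentially"
    and muhat: "\<And>n. (\<lambda>(D, x). muhat n D x) \<in> borel_measurable ((\<Pi>\<^sub>M i\<in>I' n. borel) \<Otimes>\<^sub>M borel)"
    and consistent: "(\<lambda>n. \<integral>\<^sup>+ \<omega>. (\<integral>\<^sup>+ x. ennreal ((muhat n (\<lambda>i\<in>I' n. W i \<omega>) x - \<mu> x)\<^sup>2)
                 \<partial>(distr P borel obsXt)) \<partial>M) \<longlonglongrightarrow> 0"
begin

definition \<theta> :: real where "\<theta> = theta_ratio \<gamma> P"
definition g :: "('d, 'k, 'l) obs \<Rightarrow> real" where "g w = zperp \<gamma> w * obsY w - \<theta> * law.\<zeta> w"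
text \<open>The exact change of \<open>\<zeta>\<close> when \<mu> is replaced by its estimate; no
  linearisation is involved.\<close>

definition \<kappa> :: "nat \<Rightarrow> (nat \<Rightarrow> ('d, 'k, 'l) obs) \<Rightarrow> ('d, 'k, 'l) obs \<Rightarrow> real" where
  "\<kappa> n D w = (muhat n D (obsXt w) - \<mu> (obsXt w)) * law.weighting_error w"
definition train :: "nat \<Rightarrow> 'a \<Rightarrow> nat \<Rightarrow> ('d, 'k, 'l) obs" where
  "train n \<omega> = (\<lambda>i\<in>I' n. W i \<omega>)"
definition G :: "nat \<Rightarrow> 'a \<Rightarrow> real" where
  "G n \<omega> = (\<Sum>i\<in>I n. g (W i \<omega>)) / sqrt (card (I n))"
definition R :: "nat \<Rightarrow> 'a \<Rightarrow> real" where
  "R n \<omega> = (\<Sum>i\<in>I n. \<kappa> n (train n \<omega>) (W i \<omega>)) / sqrt (card (I n))"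
definition D :: "nat \<Rightarrow> 'a \<Rightarrow> real" where
  "D n \<omega> = (\<Sum>i\<in>I n. law.\<zeta> (W i \<omega>) + \<kappa> n (train n \<omega>) (W i \<omega>)) / card (I n)"
definition T :: "nat \<Rightarrow> 'a \<Rightarrow> real" where
  "T n \<omega> = sqrt (card (I n)) * (theta_hat \<gamma> \<pi> (muhat n (train n \<omega>)) (I n) (\<lambda>i. W i \<omega>) - \<theta>)"

lemma g_measurable [measurable]: "g \<in> borel_measurable borel"
  unfolding g_def[abs_def] by measurable

lemma g_eq_\<phi>: "g w = theta_den \<gamma> P * law.\<phi> w"
  using den_nonzero
  by (simp add: g_def law.\<phi>_def phi_num_def law.phi_den_eq \<theta>_def theta_ratio_def field_simps)

lemma g_L2: "integrable P (\<lambda>w. (g w)\<^sup>2)"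
  using law.\<phi>_L2 by (simp add: g_eq_\<phi> power_mult_distrib)

lemma g_mean: "(\<integral>w. g w \<partial>P) = 0"
  using law.mean_\<phi> by (simp add: g_eq_\<phi>)

lemma train_measurable [measurable]: "train n \<in> measurable M (\<Pi>\<^sub>M i\<in>I' n. borel)"
  unfolding train_def[abs_def] by measurable

lemma \<kappa>_measurable: "(\<lambda>(D, w). \<kappa> n D w) \<in> borel_measurable ((\<Pi>\<^sub>M i\<in>I' n. borel) \<Otimes>\<^sub>M borel)"
proof -
  have "(\<lambda>p. (fst p, obsXt (snd p))) \<in> measurable ((\<Pi>\<^sub>M i\<in>I' n. borel) \<Otimes>\<^sub>M borel) ((\<Pi>\<^sub>M i\<in>I' n. borel) \<Otimes>\<^sub>M borel)"
    by measurable
  from measurable_compose[OF this muhat]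
  have [measurable]: "(\<lambda>p. muhat n (fst p) (obsXt (snd p))) \<in> borel_measurable ((\<Pi>\<^sub>M i\<in>I' n. borel) \<Otimes>\<^sub>M borel)"
    by (simp add: case_prod_unfold)
  show ?thesis unfolding \<kappa>_def case_prod_unfold by measurable
qed

lemma \<kappa>_train_measurable [measurable]: "(\<lambda>\<omega>. \<kappa> n (train n \<omega>) (W i \<omega>)) \<in> borel_measurable M"
proof -
  have "(\<lambda>\<omega>. (train n \<omega>, W i \<omega>)) \<in> measurable M ((\<Pi>\<^sub>M i\<in>I' n. borel) \<Otimes>\<^sub>M borel)" by measurable
  from measurable_compose[OF this \<kappa>_measurable] show ?thesis by simp
qed

lemma muhat_train_measurable [measurable]:
  "(\<lambda>\<omega>. muhat n (train n \<omega>) (obsXt (W i \<omega>))) \<in> borel_measurable M"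
proof -
  have "(\<lambda>\<omega>. (train n \<omega>, obsXt (W i \<omega>))) \<in> measurable M ((\<Pi>\<^sub>M i\<in>I' n. borel) \<Otimes>\<^sub>M borel)" by measurable
  from measurable_compose[OF this muhat] show ?thesis by simp
qed

lemma measurable_GRDT [measurable]:
  "G n \<in> borel_measurable M" "R n \<in> borel_measurable M" "D n \<in> borel_measurable M" "T n \<in> borel_measurable M"
  unfolding G_def[abs_def] R_def[abs_def] D_def[abs_def] T_def[abs_def] theta_hat_def by measurable

text \<open>Moving \<theta> over the common denominator makes the leading numerator a sum of
  \<open>g\<close>, which is centred because \<theta> is the ratio of the two means. The regression
  estimate then enters only through \<open>\<kappa>\<close>.\<close>

lemma T_eq: "T n \<omega> = (G n \<omega> - \<theta> * R n \<omega>) / D n \<omega>" if "D n \<omega> \<noteq> 0"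
proof -
  let ?m = "real (card (I n))"
  let ?N = "\<Sum>i\<in>I n. zperp \<gamma> (W i \<omega>) * obsY (W i \<omega>)"
  let ?S = "\<Sum>i\<in>I n. law.\<zeta> (W i \<omega>) + \<kappa> n (train n \<omega>) (W i \<omega>)"
  have den: "(\<Sum>i\<in>I n. zperp \<gamma> (W i \<omega>) * (muhat n (train n \<omega>) (obsXt (W i \<omega>)) + obsA (W i \<omega>) / \<pi> (obsX (W i \<omega>)) *
       (obsM (W i \<omega>) - muhat n (train n \<omega>) (obsXt (W i \<omega>))))) = ?S"
    by (intro sum.cong) (auto simp: law.\<zeta>_def \<kappa>_def law.weighting_error_def algebra_simps diff_divide_distrib)
  have S: "?S \<noteq> 0" and m: "0 < ?m" using that by (auto simp: D_def card_gt_0_iff)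
  have num: "?N - \<theta> * ?S = (\<Sum>i\<in>I n. g (W i \<omega>)) - \<theta> * (\<Sum>i\<in>I n. \<kappa> n (train n \<omega>) (W i \<omega>))"
    by (simp add: g_def sum_subtractf sum.distrib sum_distrib_left algebra_simps)
  have "T n \<omega> = sqrt ?m * ((?N - \<theta> * ?S) / ?S)"
    unfolding T_def theta_hat_def den using S by (simp add: diff_divide_distrib)
  also have "\<dots> = ((?N - \<theta> * ?S) / sqrt ?m) / (?S / ?m)"
  proof -
    have "s * (a / b) = (a / s) / (b / (s * s))" if "s \<noteq> 0" for s a b :: real
      using that by simp
    from this[of "sqrt ?m"] show ?thesis using m by simp
  qed
  finally show ?thesis by (simp add: num D_def G_def R_def diff_divide_distrib)
qed

section \<open>Second moments of the leading term and the remainders\<close>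

lemma G_second_moment: "(\<integral>\<^sup>+\<omega>. ennreal ((G n \<omega>)\<^sup>2) \<partial>M) \<le> ennreal (\<integral>w. (g w)\<^sup>2 \<partial>P)"
\<comment> \<open>The bound is wanted for every n. For an empty fold \<open>G n\<close> is 0 / 0 =
  0.\<close>
proof (cases "card (I n) = 0")
  case False
  have "(\<integral>\<^sup>+\<omega>. ennreal ((G n \<omega>)\<^sup>2) \<partial>M)
      = (\<integral>\<^sup>+\<omega>. ennreal (1 / card (I n)) * ennreal ((\<Sum>i\<in>I n. g (W i \<omega>))\<^sup>2) \<partial>M)"
    by (intro nn_integral_cong) (simp add: G_def power_divide flip: ennreal_mult)
  also have "\<dots> = ennreal (1 / card (I n)) * ennreal (card (I n) * (\<integral>w. (g w)\<^sup>2 \<partial>P))"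
    by (simp add: nn_integral_cmult nn_integral_square_sum g_L2 g_mean split)
  also have "\<dots> = ennreal (\<integral>w. (g w)\<^sup>2 \<partial>P)" using False by (simp flip: ennreal_mult)
  finally show ?thesis by simp
qed (simp add: G_def)

text \<open>Given the training fold, variances add up to \<open>card (I n)\<close> times one
  summand's, which the normalisation cancels. So the regression risk is needed without any rate and
  with no condition relating the two fold sizes.\<close>

lemma R_second_moment:
  "(\<integral>\<^sup>+\<omega>. ennreal ((R n \<omega>)\<^sup>2) \<partial>M) \<le> ennreal (law.K\<^sup>2) *
    (\<integral>\<^sup>+ \<omega>. (\<integral>\<^sup>+ x. ennreal ((muhat n (\<lambda>i\<in>I' n. W i \<omega>) x - \<mu> x)\<^sup>2) \<partial>(distr P borel obsXt)) \<partial>M)"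
    (is "_ \<le> _ * ?e")
proof (cases "card (I n) = 0")
  case False
  let ?m = "card (I n)"
  have sec: "(\<lambda>x. muhat n E x) \<in> borel_measurable borel" if "E \<in> space (\<Pi>\<^sub>M i\<in>I' n. (borel :: ('d, 'k, 'l) obs measure))" for E
    using measurable_compose[OF measurable_Pair1'[OF that] muhat] by simp
  have "(\<integral>\<^sup>+\<omega>. ennreal ((\<Sum>i\<in>I n. \<kappa> n (\<lambda>i\<in>I' n. W i \<omega>) (W i \<omega>))\<^sup>2) \<partial>M)
      \<le> ?m * (\<integral>\<^sup>+\<omega>. (\<integral>\<^sup>+w. ennreal ((\<kappa> n (\<lambda>i\<in>I' n. W i \<omega>) w)\<^sup>2) \<partial>P) \<partial>M)"
  proof (rule nn_integral_square_cross_fit_le[OF \<kappa>_measurable _ split(1,2)])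
    fix E assume E: "E \<in> space (\<Pi>\<^sub>M i\<in>I' n. (borel :: ('d, 'k, 'l) obs measure))"
      and sq: "integrable P (\<lambda>w. (\<kappa> n E w)\<^sup>2)"
    note [measurable] = sec[OF E]
    have "\<kappa> n E \<in> borel_measurable P" unfolding \<kappa>_def[abs_def] by measurable
    \<comment> \<open>On a probability space square integrability gives integrability, as
      conditional centring requires; \<mu>hat itself is not assumed bounded.\<close>
    then have "integrable P (\<kappa> n E)" by (rule law.square_integrable_imp_integrable[OF _ sq])
    then show "(\<integral>w. \<kappa> n E w \<partial>P) = 0"
      unfolding \<kappa>_def[abs_def] by (intro law.integral_weighting_error_Xt[of "\<lambda>x. muhat n E x - \<mu> x"]) simp_all
  qed
  also have "\<dots> \<le> ?m * (\<integral>\<^sup>+\<omega>. ennreal (law.K\<^sup>2) * (\<integral>\<^sup>+ x. ennreal ((muhat n (\<lambda>i\<in>I' n. W i \<omega>) x - \<mu> x)\<^sup>2) \<partial>(distr P borel obsXt)) \<partial>M)"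
  proof (intro mult_left_mono nn_integral_mono)
    fix \<omega> assume "\<omega> \<in> space M"
    let ?E = "\<lambda>i\<in>I' n. W i \<omega>"
    have "?E \<in> space (\<Pi>\<^sub>M i\<in>I' n. (borel :: ('d, 'k, 'l) obs measure))" by (simp add: space_PiM)
    note [measurable] = sec[OF this]
    have "(\<integral>\<^sup>+w. ennreal ((\<kappa> n ?E w)\<^sup>2) \<partial>P)
        \<le> (\<integral>\<^sup>+w. ennreal (law.K\<^sup>2) * ennreal ((muhat n ?E (obsXt w) - \<mu> (obsXt w))\<^sup>2) \<partial>P)"
    proof (rule nn_integral_mono_AE)
      show "AE w in P. ennreal ((\<kappa> n ?E w)\<^sup>2) \<le> ennreal (law.K\<^sup>2) * ennreal ((muhat n ?E (obsXt w) - \<mu> (obsXt w))\<^sup>2)"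
        using law.AE_abs_weighting_error_le
      proof eventually_elim
        case (elim w)
        then have "(law.weighting_error w)\<^sup>2 \<le> law.K\<^sup>2" by (simp flip: abs_le_square_iff add: law.K_nonneg)
        then have "(\<kappa> n ?E w)\<^sup>2 \<le> law.K\<^sup>2 * (muhat n ?E (obsXt w) - \<mu> (obsXt w))\<^sup>2"
          unfolding \<kappa>_def power_mult_distrib by (subst mult.commute) (rule mult_right_mono, simp_all)
        then show ?case by (simp add: ennreal_leI flip: ennreal_mult)
      qed
    qed
    also have "\<dots> = ennreal (law.K\<^sup>2) * (\<integral>\<^sup>+ x. ennreal ((muhat n ?E x - \<mu> x)\<^sup>2) \<partial>(distr P borel obsXt))"
      by (simp add: nn_integral_cmult nn_integral_distr)
    finally show "(\<integral>\<^sup>+w. ennreal ((\<kappa> n ?E w)\<^sup>2) \<partial>P)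
        \<le> ennreal (law.K\<^sup>2) * (\<integral>\<^sup>+ x. ennreal ((muhat n ?E x - \<mu> x)\<^sup>2) \<partial>(distr P borel obsXt))" .
  qed simp
  also have "\<dots> = ?m * (ennreal (law.K\<^sup>2) * ?e)"
  proof -
    interpret Xt: prob_space "distr P borel obsXt" by (rule law.prob_space_distr) simp
    have "(\<lambda>p. ennreal (((case p of (E, x) \<Rightarrow> muhat n E x) - \<mu> (snd p))\<^sup>2)) \<in> borel_measurable ((\<Pi>\<^sub>M i\<in>I' n. borel) \<Otimes>\<^sub>M distr P borel obsXt)"
      using muhat by (auto cong: measurable_cong_sets sets_pair_measure_cong)
    from Xt.borel_measurable_nn_integral_fst[OF this]
    have "(\<lambda>E. \<integral>\<^sup>+ x. ennreal ((muhat n E x - \<mu> x)\<^sup>2) \<partial>(distr P borel obsXt)) \<in> borel_measurable (\<Pi>\<^sub>M i\<in>I' n. borel)"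
      by simp
    from measurable_compose[OF train_measurable this] show ?thesis
      by (subst nn_integral_cmult) (simp_all add: train_def)
  qed
  finally have *: "(\<integral>\<^sup>+\<omega>. ennreal ((\<Sum>i\<in>I n. \<kappa> n (train n \<omega>) (W i \<omega>))\<^sup>2) \<partial>M) \<le> ?m * (ennreal (law.K\<^sup>2) * ?e)"
    by (simp add: train_def)
  have "(\<integral>\<^sup>+\<omega>. ennreal ((R n \<omega>)\<^sup>2) \<partial>M)
      = (\<integral>\<^sup>+\<omega>. ennreal (1 / ?m) * ennreal ((\<Sum>i\<in>I n. \<kappa> n (train n \<omega>) (W i \<omega>))\<^sup>2) \<partial>M)"
    by (intro nn_integral_cong) (simp add: R_def power_divide flip: ennreal_mult)
  also have "\<dots> = ennreal (1 / ?m) * (\<integral>\<^sup>+\<omega>. ennreal ((\<Sum>i\<in>I n. \<kappa> n (train n \<omega>) (W i \<omega>))\<^sup>2) \<partial>M)"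
    by (rule nn_integral_cmult) simp
  also have "\<dots> \<le> ennreal (1 / ?m) * (?m * (ennreal (law.K\<^sup>2) * ?e))"
    by (rule mult_left_mono[OF *]) simp
  also have "\<dots> = (ennreal (1 / ?m) * ennreal ?m) * (ennreal (law.K\<^sup>2) * ?e)"
    by (simp add: mult.assoc ennreal_of_nat_eq_real_of_nat)
  also have "ennreal (1 / ?m) * ennreal ?m = 1"
    using False by (simp flip: ennreal_mult)
  finally show ?thesis by (simp only: mult_1_left)
qed (simp add: R_def)

lemma R_second_moment_tendsto: "(\<lambda>n. \<integral>\<^sup>+\<omega>. ennreal ((R n \<omega>)\<^sup>2) \<partial>M) \<longlonglongrightarrow> 0"
proof (rule tendsto_sandwich[OF _ _ tendsto_const])
  show "(\<lambda>n. ennreal (law.K\<^sup>2) *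
    (\<integral>\<^sup>+ \<omega>. (\<integral>\<^sup>+ x. ennreal ((muhat n (\<lambda>i\<in>I' n. W i \<omega>) x - \<mu> x)\<^sup>2) \<partial>(distr P borel obsXt)) \<partial>M)) \<longlonglongrightarrow> 0"
    using ennreal_tendsto_cmult[OF _ consistent, of "ennreal (law.K\<^sup>2)"] by simp
qed (use R_second_moment in auto)

text \<open>The error of the estimated denominator is an average of centred scores, with variance of
  order 1 / m for fold size m, plus R / sqrt m, which is no larger than R.\<close>

lemma D_second_moment_tendsto: "(\<lambda>n. \<integral>\<^sup>+\<omega>. ennreal ((D n \<omega> - theta_den \<gamma> P)\<^sup>2) \<partial>M) \<longlonglongrightarrow> 0"
proof -
  let ?d = "phi_den \<gamma> \<pi> \<mu> P"
  let ?v = "\<integral>w. (?d w)\<^sup>2 \<partial>P"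
  have d2: "integrable P (\<lambda>w. (?d w)\<^sup>2)" using law.phi_L2 by (simp add: L2_def)
  show ?thesis
  proof (rule tendsto_sandwich[OF _ _ tendsto_const])
    have "(\<lambda>n. inverse (real (card (I n)))) \<longlonglongrightarrow> 0"
      by (rule tendsto_inverse_0_at_top[OF filterlim_compose[OF filterlim_real_sequentially split(3)]])
    then have "(\<lambda>n. ennreal (2 * ?v * inverse (real (card (I n))))) \<longlonglongrightarrow> ennreal 0"
      by (intro tendsto_ennrealI tendsto_mult_right_zero)
    from tendsto_add[OF this ennreal_tendsto_cmult[OF _ R_second_moment_tendsto, of 2]]
    show "(\<lambda>n. ennreal (2 * ?v * inverse (real (card (I n)))) + 2 * (\<integral>\<^sup>+\<omega>. ennreal ((R n \<omega>)\<^sup>2) \<partial>M)) \<longlonglongrightarrow> 0"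
      by simp
    have "\<forall>\<^sub>F n in sequentially. 1 \<le> card (I n)"
      using split(3) by (simp add: filterlim_at_top)
    then show "\<forall>\<^sub>F n in sequentially. (\<integral>\<^sup>+\<omega>. ennreal ((D n \<omega> - theta_den \<gamma> P)\<^sup>2) \<partial>M)
      \<le> ennreal (2 * ?v * inverse (real (card (I n)))) + 2 * (\<integral>\<^sup>+\<omega>. ennreal ((R n \<omega>)\<^sup>2) \<partial>M)"
    proof eventually_elim
      case (elim n)
      let ?m = "real (card (I n))"
      let ?S = "\<lambda>\<omega>. \<Sum>i\<in>I n. ?d (W i \<omega>)"
      have m: "1 \<le> ?m" using elim by simp
      have pw: "(D n \<omega> - theta_den \<gamma> P)\<^sup>2 \<le> 2 / ?m\<^sup>2 * (?S \<omega>)\<^sup>2 + 2 * (R n \<omega>)\<^sup>2" for \<omega>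
      proof -
        have eq: "D n \<omega> - theta_den \<gamma> P = ?S \<omega> / ?m + R n \<omega> / sqrt ?m"
          using m by (simp add: D_def R_def law.phi_den_eq sum.distrib sum_subtractf field_simps)
        have "(R n \<omega> / sqrt ?m)\<^sup>2 = (R n \<omega>)\<^sup>2 / ?m" by (simp add: power_divide)
        also have "\<dots> \<le> (R n \<omega>)\<^sup>2 / 1" using m by (intro divide_left_mono) auto
        finally have R: "(R n \<omega> / sqrt ?m)\<^sup>2 \<le> (R n \<omega>)\<^sup>2" by simp
        have "(?S \<omega> / ?m + R n \<omega> / sqrt ?m)\<^sup>2 \<le> 2 * ((?S \<omega> / ?m)\<^sup>2 + (R n \<omega> / sqrt ?m)\<^sup>2)"
          using sum_squares_bound[of "?S \<omega> / ?m" "R n \<omega> / sqrt ?m"] by (simp add: power2_sum)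
        also have "\<dots> \<le> 2 * ((?S \<omega> / ?m)\<^sup>2 + (R n \<omega>)\<^sup>2)" using R by simp
        finally show ?thesis unfolding eq by (simp add: power_divide)
      qed
      have "(\<integral>\<^sup>+\<omega>. ennreal ((D n \<omega> - theta_den \<gamma> P)\<^sup>2) \<partial>M)
          \<le> (\<integral>\<^sup>+\<omega>. ennreal (2 / ?m\<^sup>2) * ennreal ((?S \<omega>)\<^sup>2) + 2 * ennreal ((R n \<omega>)\<^sup>2) \<partial>M)"
      proof (rule nn_integral_mono)
        fix \<omega>
        have "ennreal ((D n \<omega> - theta_den \<gamma> P)\<^sup>2) \<le> ennreal (2 / ?m\<^sup>2 * (?S \<omega>)\<^sup>2 + 2 * (R n \<omega>)\<^sup>2)"
          by (rule ennreal_leI[OF pw])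
        then show "ennreal ((D n \<omega> - theta_den \<gamma> P)\<^sup>2) \<le> ennreal (2 / ?m\<^sup>2) * ennreal ((?S \<omega>)\<^sup>2) + 2 * ennreal ((R n \<omega>)\<^sup>2)"
          by (subst (asm) ennreal_plus, simp, simp, subst (asm) (1 2) ennreal_mult) simp_all
      qed
      also have "\<dots> = ennreal (2 / ?m\<^sup>2) * ennreal (?m * ?v) + 2 * (\<integral>\<^sup>+\<omega>. ennreal ((R n \<omega>)\<^sup>2) \<partial>M)"
        using d2 law.mean_phi(2) split(1)
        by (simp add: nn_integral_add nn_integral_cmult nn_integral_square_sum)
      also have "ennreal (2 / ?m\<^sup>2) * ennreal (?m * ?v) = ennreal (2 * ?v * inverse ?m)"
        using m by (simp add: power2_eq_square field_simps flip: ennreal_mult)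
      finally show ?case .
    qed
  qed simp
qed

text \<open>Since \<open>g\<close> is \<open>theta_den\<close> times \<phi>, the leading term
  \<open>G / theta_den\<close> is a normalised sum of \<phi>, and the ratio argument shows that T
  differs from it negligibly.\<close>

lemma asymptotic_normality:
  "weak_conv_m (\<lambda>n. distr M borel (T n)) (normal_law 0 (\<integral>w. (law.\<phi> w)\<^sup>2 \<partial>P))"
proof (rule weak_conv_m_converging_together)
  show "real_distribution (normal_law 0 (\<integral>w. (law.\<phi> w)\<^sup>2 \<partial>P))"
    by (rule real_distribution_normal_law) simp
  have "weak_conv_m (\<lambda>n. distr M borel (\<lambda>\<omega>. (\<Sum>i\<in>I n. law.\<phi> (W i \<omega>)) / sqrt (card (I n))))
      (normal_law 0 (\<integral>w. (law.\<phi> w)\<^sup>2 \<partial>P))"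
    by (rule central_limit_index_sets[OF law.\<phi>_measurable law.\<phi>_L2 law.mean_\<phi> split(1,3)])
  moreover have "(\<Sum>i\<in>I n. law.\<phi> (W i \<omega>)) / sqrt (card (I n)) = G n \<omega> / theta_den \<gamma> P" for n \<omega>
    using den_nonzero by (simp add: G_def g_eq_\<phi> flip: sum_distrib_left)
  ultimately show "weak_conv_m (\<lambda>n. distr M borel (\<lambda>\<omega>. G n \<omega> / theta_den \<gamma> P))
      (normal_law 0 (\<integral>w. (law.\<phi> w)\<^sup>2 \<partial>P))" by simp
  show "tendsto_zero_in_prob M (\<lambda>n \<omega>. T n \<omega> - G n \<omega> / theta_den \<gamma> P)"
  proof (rule tendsto_zero_in_prob_ratio[where a = \<theta> and R = R and D = D])
    show "tendsto_zero_in_prob M (\<lambda>n \<omega>. D n \<omega> - theta_den \<gamma> P)"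
      by (rule tendsto_zero_in_prob_of_second_moment[OF _ D_second_moment_tendsto]) simp
    show "tendsto_zero_in_prob M R"
      by (rule tendsto_zero_in_prob_of_second_moment[OF _ R_second_moment_tendsto]) simp
  qed (use den_nonzero T_eq G_second_moment in auto)
qed simp_all

end

subsection \<open>Identification\<close>

lemma obs_tuple [simp]:
  "obsY (y, m, c, z, a, x, u) = y" "obsM (y, m, c, z, a, x, u) = m" "obsC (y, m, c, z, a, x, u) = c"
  "obsZ (y, m, c, z, a, x, u) = z" "obsA (y, m, c, z, a, x, u) = a" "obsX (y, m, c, z, a, x, u) = x"
  "obsXt (y, m, c, z, a, x, u) = (x, u, z, c)"
  by (simp_all add: obsY_def obsM_def obsC_def obsZ_def obsA_def obsX_def obsXt_def)

text \<open>The contraction property of conditional independence. The variable \<open>H\<close> encodes the pair \<open>(X, V)\<close>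
  through \<open>r\<close>, and \<open>q\<close> reads \<open>p(X)\<close> off it, so that the tupling of \<open>(X, V)\<close> is left to the user.\<close>

lemma contraction_integral:
  fixes A :: "'a \<Rightarrow> real" and p :: "'x \<Rightarrow> real" and g :: "'t \<times> 'h \<Rightarrow> real"
  assumes M: "prob_space M"
    and X[measurable]: "X \<in> measurable M NX" and V[measurable]: "V \<in> measurable M NV"
    and T[measurable]: "T \<in> measurable M NT" and H[measurable]: "H \<in> measurable M NH"
    and swap: "r \<in> measurable (NV \<Otimes>\<^sub>M NX) NH" "\<And>\<omega>. H \<omega> = r (V \<omega>, X \<omega>)"
    and A[measurable]: "A \<in> borel_measurable M" and A_int: "integrable M A"
    and p[measurable]: "p \<in> borel_measurable NX" and p_int: "integrable M (\<lambda>\<omega>. p (X \<omega>))"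
    and pH: "q \<in> borel_measurable NH" "\<And>\<omega>. q (H \<omega>) = p (X \<omega>)"
    and propensity: "AE \<omega> in M. real_cond_exp M (sigma_of M NX X) A \<omega> = p (X \<omega>)"
    and ci1: "cond_indep M NT T borel A NH H"
    and ci2: "cond_indep M NV V borel A NX X"
    and g: "g \<in> borel_measurable (NT \<Otimes>\<^sub>M NH)"
    and gA: "integrable M (\<lambda>\<omega>. g (T \<omega>, H \<omega>) * A \<omega>)" and gp: "integrable M (\<lambda>\<omega>. g (T \<omega>, H \<omega>) * p (X \<omega>))"
  shows "(\<integral>\<omega>. g (T \<omega>, H \<omega>) * A \<omega> \<partial>M) = (\<integral>\<omega>. g (T \<omega>, H \<omega>) * p (X \<omega>) \<partial>M)"
proof -
  note [measurable] = swap(1) pH(1)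
  \<comment> \<open>By \<open>ci2\<close>, V does not help to predict A beyond X, so given the pair
    (X, V) the mean of A is still p(X).\<close>
  have step1: "AE \<omega> in M. real_cond_exp M (sigma_of M NH H) A \<omega> = q (H \<omega>)"
  proof (rule real_cond_exp_sigma_of_charact[OF M H A_int])
    show "integrable M (\<lambda>\<omega>. q (H \<omega>))" using p_int by (simp add: pH(2))
    show "(\<lambda>\<omega>. q (H \<omega>)) \<in> borel_measurable (sigma_of M NH H)"
      by (rule measurable_sigma_of_compose) measurable
    fix S assume S[measurable]: "S \<in> sets NH"
    \<comment> \<open>The event of H written as an event of (V, X), the order in which the
      conditional independence lemma takes them.\<close>
    define S' where "S' = r -` S \<inter> space (NV \<Otimes>\<^sub>M NX)"
    have S'[measurable]: "S' \<in> sets (NV \<Otimes>\<^sub>M NX)" unfolding S'_def by measurable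
    have sp: "(V \<omega>, X \<omega>) \<in> space (NV \<Otimes>\<^sub>M NX)" if "\<omega> \<in> space M" for \<omega>
      using measurable_space[OF V that] measurable_space[OF X that] by (simp add: space_pair_measure)
    have eq: "indicator S (H \<omega>) = (indicator S' (V \<omega>, X \<omega>) :: real)" if "\<omega> \<in> space M" for \<omega>
      using sp[OF that] by (simp add: indicator_def S'_def swap(2))
    have "(\<integral>\<omega>. indicator S (H \<omega>) * A \<omega> \<partial>M) = (\<integral>\<omega>. indicator S' (V \<omega>, X \<omega>) * A \<omega> \<partial>M)"
      by (intro Bochner_Integration.integral_cong) (simp_all add: eq)
    also have "\<dots> = (\<integral>\<omega>. indicator S' (V \<omega>, X \<omega>) * real_cond_exp M (sigma_of M NX X) A \<omega> \<partial>M)"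
      using cond_indep_integral_indicator[OF M cond_indep_commute[OF ci2] A V X, of "\<lambda>x. x" S'] A_int by simp
    also have "\<dots> = (\<integral>\<omega>. indicator S' (V \<omega>, X \<omega>) * p (X \<omega>) \<partial>M)"
    proof (rule integral_cong_AE)
      interpret sigma_finite_subalgebra M "sigma_of M NX X"
        by (rule sigma_finite_subalgebra_sigma_of[OF M X])
      show "(\<lambda>\<omega>. indicator S' (V \<omega>, X \<omega>) * real_cond_exp M (sigma_of M NX X) A \<omega>) \<in> borel_measurable M"
        by measurable
      show "(\<lambda>\<omega>. indicator S' (V \<omega>, X \<omega>) * p (X \<omega>)) \<in> borel_measurable M" by measurable
      show "AE \<omega> in M. indicator S' (V \<omega>, X \<omega>) * real_cond_exp M (sigma_of M NX X) A \<omega> = indicator S' (V \<omega>, X \<omega>) * p (X \<omega>)"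
        using propensity by eventually_elim simp
    qed
    also have "\<dots> = (\<integral>\<omega>. indicator S (H \<omega>) * q (H \<omega>) \<partial>M)"
      by (intro Bochner_Integration.integral_cong) (simp_all add: eq pH(2))
    finally show "(\<integral>\<omega>. indicator S (H \<omega>) * A \<omega> \<partial>M) = (\<integral>\<omega>. indicator S (H \<omega>) * q (H \<omega>) \<partial>M)" .
  qed
  have d: "integrable M (\<lambda>\<omega>. A \<omega> - p (X \<omega>))" using A_int p_int by simp
  have TH: "(\<lambda>\<omega>. (T \<omega>, H \<omega>)) \<in> measurable M (NT \<Otimes>\<^sub>M NH)" by measurable
  \<comment> \<open>Now T joins the conditioning. By \<open>ci1\<close> it does not change the mean
    of A given H, just found to be p(X).\<close>
  have "(\<integral>\<omega>. g (T \<omega>, H \<omega>) * (A \<omega> - p (X \<omega>)) \<partial>M) = 0"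
  proof (rule integral_mult_eq_0_of_indicators[OF M TH d _ g])
    show "integrable M (\<lambda>\<omega>. g (T \<omega>, H \<omega>) * (A \<omega> - p (X \<omega>)))"
      using gA gp by (simp add: right_diff_distrib)
    fix S assume S[measurable]: "S \<in> sets (NT \<Otimes>\<^sub>M NH)"
    have "(\<integral>\<omega>. indicator S (T \<omega>, H \<omega>) * A \<omega> \<partial>M)
        = (\<integral>\<omega>. indicator S (T \<omega>, H \<omega>) * real_cond_exp M (sigma_of M NH H) A \<omega> \<partial>M)"
      using cond_indep_integral_indicator[OF M cond_indep_commute[OF ci1] A T H, of "\<lambda>x. x" S] A_int by simp
    also have "\<dots> = (\<integral>\<omega>. indicator S (T \<omega>, H \<omega>) * p (X \<omega>) \<partial>M)"
    proof (rule integral_cong_AE)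
      interpret sigma_finite_subalgebra M "sigma_of M NH H"
        by (rule sigma_finite_subalgebra_sigma_of[OF M H])
      show "(\<lambda>\<omega>. indicator S (T \<omega>, H \<omega>) * real_cond_exp M (sigma_of M NH H) A \<omega>) \<in> borel_measurable M"
        by measurable
      show "(\<lambda>\<omega>. indicator S (T \<omega>, H \<omega>) * p (X \<omega>)) \<in> borel_measurable M" by measurable
      show "AE \<omega> in M. indicator S (T \<omega>, H \<omega>) * real_cond_exp M (sigma_of M NH H) A \<omega> = indicator S (T \<omega>, H \<omega>) * p (X \<omega>)"
        using step1 by eventually_elim (simp add: pH(2))
    qed
    finally show "(\<integral>\<omega>. indicator S (T \<omega>, H \<omega>) * (A \<omega> - p (X \<omega>)) \<partial>M) = 0"
      using integrable_mult_indicator_of[OF A_int TH S] integrable_mult_indicator_of[OF p_int TH S]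
      by (simp add: right_diff_distrib)
  qed
  then show ?thesis using gA gp by (simp add: right_diff_distrib)
qed

text \<open>Given \<open>C\<close>, the outcome under no treatment is uncorrelated with the instrument, and its conditional
  mean is linear in \<open>C\<close>; both parts of it are orthogonal to the projection residual.\<close>

lemma residual_orthogonal_to_baseline:
  fixes Y0 Z :: "'a \<Rightarrow> real" and C :: "'a \<Rightarrow> real ^ 'd::finite"
  assumes M: "prob_space M"
    and V[measurable]: "V \<in> measurable M NV" and f[measurable]: "f \<in> borel_measurable NV"
    and Z[measurable]: "Z \<in> borel_measurable M" and C[measurable]: "C \<in> borel_measurable M"
    and ci: "cond_indep M NV V borel Z borel C" and fV: "\<And>\<omega>. f (V \<omega>) = Y0 \<omega>"
    and int: "integrable M Y0"
    and lin: "AE \<omega> in M. real_cond_exp M (sigma_of M borel C) Y0 \<omega> = \<beta> \<bullet> C \<omega>"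
    and bound: "AE \<omega> in M. \<bar>Z \<omega> - \<gamma> \<bullet> C \<omega>\<bar> \<le> b"
    and orth: "(\<integral>\<omega>. (Z \<omega> - \<gamma> \<bullet> C \<omega>) * (\<beta> \<bullet> C \<omega>) \<partial>M) = 0"
  shows "(\<integral>\<omega>. (Z \<omega> - \<gamma> \<bullet> C \<omega>) * Y0 \<omega> \<partial>M) = 0"
proof -
  interpret prob_space M by fact
  interpret C: sigma_finite_subalgebra M "sigma_of M borel C"
    by (rule sigma_finite_subalgebra_sigma_of[OF M C])
  let ?q = "real_cond_exp M (sigma_of M borel C) Y0"
  have q: "integrable M ?q" by (rule C.real_cond_exp_int(1)[OF int])
  have Y0[measurable]: "Y0 \<in> borel_measurable M" using int by simp
  \<comment> \<open>Integrability of the linear function is inherited from the conditional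
    expectation that it equals almost surely.\<close>
  have lin_int: "integrable M (\<lambda>\<omega>. \<beta> \<bullet> C \<omega>)"
    using q lin by (subst integrable_cong_AE[of _ _ ?q]) (auto elim!: eventually_mono)
  let ?d = "\<lambda>\<omega>. Y0 \<omega> - \<beta> \<bullet> C \<omega>"
  have d: "integrable M ?d" using int lin_int by simp
  let ?g = "\<lambda>(z, c). z - \<gamma> \<bullet> c"
  have ZC: "(\<lambda>\<omega>. (Z \<omega>, C \<omega>)) \<in> measurable M (borel \<Otimes>\<^sub>M borel)" by measurable
  have mult: "integrable M (\<lambda>\<omega>. (Z \<omega> - \<gamma> \<bullet> C \<omega>) * h \<omega>)" if "integrable M h" for h
    by (rule integrable_mult_AE_bounded[OF that _ bound]) measurable
  have "(\<integral>\<omega>. ?g (Z \<omega>, C \<omega>) * ?d \<omega> \<partial>M) = 0"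
  proof (rule integral_mult_eq_0_of_indicators[OF M ZC d])
    show "?g \<in> borel_measurable (borel \<Otimes>\<^sub>M borel)" by measurable
    show "integrable M (\<lambda>\<omega>. ?g (Z \<omega>, C \<omega>) * ?d \<omega>)" using mult[OF d] by simp
    fix S :: "(real \<times> (real ^ 'd)) set" assume S[measurable]: "S \<in> sets (borel \<Otimes>\<^sub>M borel)"
    \<comment> \<open>Exogeneity: conditioning the baseline outcome on (Z, C) gives no more than
      conditioning on C, where it is linear.\<close>
    have "(\<integral>\<omega>. indicator S (Z \<omega>, C \<omega>) * Y0 \<omega> \<partial>M) = (\<integral>\<omega>. indicator S (Z \<omega>, C \<omega>) * ?q \<omega> \<partial>M)"
      using cond_indep_integral_indicator[OF M ci V Z C f _ S] int by (simp add: fV)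
    also have "\<dots> = (\<integral>\<omega>. indicator S (Z \<omega>, C \<omega>) * (\<beta> \<bullet> C \<omega>) \<partial>M)"
      by (rule integral_cong_AE) (use lin in \<open>auto elim!: eventually_mono\<close>)
    finally show "(\<integral>\<omega>. indicator S (Z \<omega>, C \<omega>) * ?d \<omega> \<partial>M) = 0"
      using integrable_mult_indicator_of[OF int ZC S] integrable_mult_indicator_of[OF lin_int ZC S]
      by (simp add: right_diff_distrib)
  qed
  then have "(\<integral>\<omega>. (Z \<omega> - \<gamma> \<bullet> C \<omega>) * Y0 \<omega> - (Z \<omega> - \<gamma> \<bullet> C \<omega>) * (\<beta> \<bullet> C \<omega>) \<partial>M) = 0"
    by (simp add: right_diff_distrib)
  then show ?thesis using mult[OF int] mult[OF lin_int] orth by simp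
qed

text \<open>Efficiency of the numerator and the ratio stands behind an implication because
  membership in the tangent space amounts to the displayed equality of conditional means. The limit
  law, both gradients and efficiency of the denominator hold outright.\<close>

theorem proposition5:
  fixes Pr :: "'a measure"
    and Y M A Z Mstar :: "nat \<Rightarrow> 'a \<Rightarrow> real"
    and C :: "nat \<Rightarrow> 'a \<Rightarrow> real ^ 'd::finite"
    and X :: "nat \<Rightarrow> 'a \<Rightarrow> real ^ 'k::finite"
    and U :: "nat \<Rightarrow> 'a \<Rightarrow> real ^ 'l::finite"
    and Ypot Mpot :: "nat \<Rightarrow> real \<Rightarrow> 'a \<Rightarrow> real"
    and W :: "nat \<Rightarrow> 'a \<Rightarrow> ('d, 'k, 'l) obs"
    and P :: "('d, 'k, 'l) obs measure"
    and \<gamma> :: "real ^ 'd"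
    and \<pi> :: "real ^ 'k \<Rightarrow> real"
    and \<mu> :: "('d, 'k, 'l) xtilde \<Rightarrow> real"
    and muhat :: "nat \<Rightarrow> (nat \<Rightarrow> ('d, 'k, 'l) obs) \<Rightarrow> ('d, 'k, 'l) xtilde \<Rightarrow> real"
    and I I' :: "nat \<Rightarrow> nat set"
    and \<theta> \<eta> :: real
    and \<phi> :: "('d, 'k, 'l) obs \<Rightarrow> real"
  defines "W \<equiv> (\<lambda>i \<omega>. (Y i \<omega>, M i \<omega>, C i \<omega>, Z i \<omega>, A i \<omega>, X i \<omega>, U i \<omega>))"
    and "\<phi> \<equiv> (\<lambda>w. inverse (theta_den \<gamma> P) * (phi_num \<gamma> P w - \<theta> * phi_den \<gamma> \<pi> \<mu> P w))"
  assumes prob: "prob_space Pr"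
    and iid: "prob_space.indep_vars Pr (\<lambda>_. borel) W UNIV" "\<And>i. distr Pr borel (W i) = P"
    and Mstar_rv: "\<And>i. Mstar i \<in> borel_measurable Pr"
    and Ypot_rv: "\<And>i m. m \<in> {0, 1} \<Longrightarrow> Ypot i m \<in> borel_measurable Pr"
    and Mpot_rv: "\<And>i z. Mpot i z \<in> borel_measurable Pr"
    and Mstar_binary: "\<And>i. AE \<omega> in Pr. Mstar i \<omega> \<in> {0, 1}"
    and theta: "\<And>i. \<theta> = (\<integral>\<omega>. Ypot i 1 \<omega> - Ypot i 0 \<omega> \<partial>Pr)"
    and C_const: "\<exists>j. AE w in P. obsC w $ j = 1"
    and proj: "linear_projection P \<gamma>"
    and zperp_bounded: "\<exists>B. AE w in P. \<bar>zperp \<gamma> w\<bar> \<le> B"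
    and finite_variance: "integrable P (\<lambda>w. (zperp \<gamma> w * obsY w)\<^sup>2)"
    and consistency_Y: "\<And>i. AE \<omega> in Pr. Y i \<omega> = (\<Sum>m\<in>{0, 1}. of_bool (Mstar i \<omega> = m) * Ypot i m \<omega>)"
    and consistency_M: "\<And>i. AE \<omega> in Pr. Mstar i \<omega> = Mpot i (Z i \<omega>) \<omega>"
    and exogeneity: "\<And>i. cond_indep Pr
          (borel \<Otimes>\<^sub>M borel \<Otimes>\<^sub>M (\<Pi>\<^sub>M z\<in>UNIV. borel)) (\<lambda>\<omega>. (Ypot i 0 \<omega>, Ypot i 1 \<omega>, \<lambda>z. Mpot i z \<omega>))
          borel (Z i) borel (C i)"
    and relevance: "\<And>i. (\<integral>\<omega>. zperp \<gamma> (W i \<omega>) * Mstar i \<omega> \<partial>Pr) \<noteq> 0"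
    and homogeneity: "\<And>i. \<exists>\<tau>. AE \<omega> in Pr. Ypot i 1 \<omega> - Ypot i 0 \<omega> = \<tau>"
    and linearity: "\<And>i. integrable Pr (Ypot i 0)"
      "\<And>i. \<exists>\<beta>. AE \<omega> in Pr. real_cond_exp Pr (sigma_of Pr borel (C i)) (Ypot i 0) \<omega> = \<beta> \<bullet> C i \<omega>"
    and a0: "\<And>i. cond_indep Pr borel (\<lambda>\<omega>. (C i \<omega>, Z i \<omega>)) borel (A i)
          borel (\<lambda>\<omega>. (X i \<omega>, U i \<omega>, Mstar i \<omega>))"
    and a1: "\<And>i. AE \<omega> in Pr. M i \<omega> = A i \<omega> * Mstar i \<omega> \<and> A i \<omega> \<in> {0, 1}"
    and a2: "\<And>i. cond_indep Pr borel (\<lambda>\<omega>. (U i \<omega>, Mstar i \<omega>)) borel (A i) borel (X i)"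
    and a3: "is_propensity P \<pi>" "0 < \<eta>" "\<eta> < 1" "\<And>x. \<pi> x \<in> {\<eta>..1}"
    and mu: "is_mu P \<mu>"
    and split: "\<And>n. finite (I n)" "\<And>n. finite (I' n)" "\<And>n. I n \<inter> I' n = {}"
      "filterlim (\<lambda>n. card (I n)) at_top sequentially"
      "filterlim (\<lambda>n. card (I' n)) at_top sequentially"
    and muhat_rv: "\<And>n. (\<lambda>(D, x). muhat n D x) \<in> borel_measurable ((\<Pi>\<^sub>M i\<in>I' n. borel) \<Otimes>\<^sub>M borel)"
    and a4: "(\<lambda>n. \<integral>\<^sup>+ \<omega>. (\<integral>\<^sup>+ x. ennreal ((muhat n (\<lambda>i\<in>I' n. W i \<omega>) x - \<mu> x)\<^sup>2)
                 \<partial>(distr P borel obsXt)) \<partial>Pr) \<longlonglongrightarrow> 0"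
  shows
    "(\<forall>i. \<theta> = inverse (\<integral>\<omega>. zperp \<gamma> (W i \<omega>) * Mstar i \<omega> \<partial>Pr) * (\<integral>\<omega>. zperp \<gamma> (W i \<omega>) * Y i \<omega> \<partial>Pr)) \<and>
     theta_den \<gamma> P \<noteq> 0 \<and> \<theta> = theta_ratio \<gamma> P \<and>
     weak_conv_m
       (\<lambda>n. distr Pr borel (\<lambda>\<omega>. sqrt (real (card (I n))) *
          (theta_hat \<gamma> \<pi> (muhat n (\<lambda>i\<in>I' n. W i \<omega>)) (I n) (\<lambda>i. W i \<omega>) - \<theta>)))
       (normal_law 0 (\<integral>w. (\<phi> w - (\<integral>v. \<phi> v \<partial>P))\<^sup>2 \<partial>P)) \<and>
     pathwise_gradient (known_propensity_model \<pi>) (theta_num \<gamma>) P (phi_num \<gamma> P) \<and>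
     efficient_influence_function (known_propensity_model \<pi>) (theta_den \<gamma>) P (phi_den \<gamma> \<pi> \<mu> P) \<and>
     pathwise_gradient (known_propensity_model \<pi>) (theta_ratio \<gamma>) P \<phi> \<and>
     ((AE w in P.
         real_cond_exp P (sigma_of P borel (\<lambda>w. (obsA w, obsX w))) (\<lambda>w. zperp \<gamma> w * obsY w) w =
         real_cond_exp P (sigma_of P borel obsX) (\<lambda>w. zperp \<gamma> w * obsY w) w) \<longrightarrow>
       efficient_influence_function (known_propensity_model \<pi>) (theta_num \<gamma>) P (phi_num \<gamma> P) \<and>
       efficient_influence_function (known_propensity_model \<pi>) (theta_ratio \<gamma>) P \<phi>)"
proof -
  interpret Pr: prob_space Pr by (rule prob)
  interpret sample: iid_sample Pr W P by unfold_locales (use iid in auto)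
  have obs_W [simp]: "obsY (W i \<omega>) = Y i \<omega>" "obsM (W i \<omega>) = M i \<omega>" "obsC (W i \<omega>) = C i \<omega>"
    "obsZ (W i \<omega>) = Z i \<omega>" "obsA (W i \<omega>) = A i \<omega>" "obsX (W i \<omega>) = X i \<omega>"
    "obsXt (W i \<omega>) = (X i \<omega>, U i \<omega>, Z i \<omega>, C i \<omega>)" for i \<omega>
    by (simp_all add: W_def)
  have zW: "zperp \<gamma> (W i \<omega>) = Z i \<omega> - \<gamma> \<bullet> C i \<omega>" for i \<omega> by (simp add: zperp_def)
  have rv: "f \<in> borel_measurable borel \<Longrightarrow> (\<lambda>\<omega>. f (W i \<omega>)) \<in> borel_measurable Pr"
    for f :: "('d, 'k, 'l) obs \<Rightarrow> 'e::topological_space" and i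
    by (rule measurable_compose[OF sample.W_rv])
  have [measurable]: "Y i \<in> borel_measurable Pr" "M i \<in> borel_measurable Pr" "C i \<in> borel_measurable Pr"
    "Z i \<in> borel_measurable Pr" "A i \<in> borel_measurable Pr" "X i \<in> borel_measurable Pr" for i
    using rv[OF measurable_obs(1), of i] rv[OF measurable_obs(2), of i] rv[OF measurable_obs(3), of i]
      rv[OF measurable_obs(4), of i] rv[OF measurable_obs(5), of i] rv[OF measurable_obs(6), of i] by simp_all
  have [measurable]: "U i \<in> borel_measurable Pr" for i
  proof -
    have "(\<lambda>(x, u, z, c). u) \<in> borel_measurable (borel :: ('d, 'k, 'l) xtilde measure)"
      by (intro borel_measurable_continuous_onI) (simp add: case_prod_unfold continuous_intros)
    from measurable_compose[OF rv[OF measurable_obs(7)] this] show ?thesis by simp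
  qed
  note [measurable] = Mstar_rv
  have \<pi>_meas[measurable]: "\<pi> \<in> borel_measurable borel" using a3(1) by (simp add: is_propensity_def)
  have \<mu>_meas[measurable]: "\<mu> \<in> borel_measurable borel" using mu by (simp add: is_mu_def)
  have \<pi>: "0 < \<pi> x" "\<pi> x \<le> 1" "\<eta> \<le> \<pi> x" for x using a3(2) a3(4)[of x] by auto
  have A01: "AE \<omega> in Pr. A i \<omega> \<in> {0, 1}" for i using a1[of i] by eventually_elim simp
  have A_le: "AE \<omega> in Pr. \<bar>A i \<omega>\<bar> \<le> 1" for i using A01[of i] by eventually_elim auto
  have A_int: "integrable Pr (A i)" for i
    by (rule Pr.integrable_const_bound[where B = 1]) (use A_le[of i] in auto)
  have \<pi>_int: "integrable Pr (\<lambda>\<omega>. \<pi> (X i \<omega>))" for i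
    by (rule Pr.integrable_const_bound[where B = 1]) (use \<pi> in \<open>auto simp: abs_of_pos\<close>)
  have AE_A_P: "AE w in P. obsA w \<in> {0, 1}"
    using A01[of 0] by (subst sample.AE_W[symmetric, where i = 0]) auto
  \<comment> \<open>The propensity is specified under the law of an observation, the independences
    on the sample space; this carries the former to the latter.\<close>
  have propX: "AE \<omega> in Pr. real_cond_exp Pr (sigma_of Pr borel (X i)) (A i) \<omega> = \<pi> (X i \<omega>)" for i
  proof (rule real_cond_exp_sigma_of_charact[OF prob _ A_int \<pi>_int])
    show "(\<lambda>\<omega>. \<pi> (X i \<omega>)) \<in> borel_measurable (sigma_of Pr borel (X i))"
      by (rule measurable_sigma_of_compose) measurable
    fix S :: "(real ^ 'k) set" assume S[measurable]: "S \<in> sets borel"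
    interpret PX: sigma_finite_subalgebra P "sigma_of P borel obsX"
      by (rule sigma_finite_subalgebra_sigma_of[OF sample.prob_space_P]) measurable
    interpret P: prob_space P by (rule sample.prob_space_P)
    let ?I = "indicator {w. obsA w = 1} :: _ \<Rightarrow> real"
    have Im: "?I \<in> borel_measurable P" by measurable
    have SX: "(\<lambda>w. indicator S (obsX w) :: real) \<in> borel_measurable (sigma_of P borel obsX)"
      by (rule measurable_sigma_of_compose) measurable
    have "(\<integral>\<omega>. indicator S (X i \<omega>) * A i \<omega> \<partial>Pr) = (\<integral>w. indicator S (obsX w) * obsA w \<partial>P)"
      using sample.integral_W[of "\<lambda>w. indicator S (obsX w) * obsA w" i] by simp
    also have "\<dots> = (\<integral>w. indicator S (obsX w) * ?I w \<partial>P)"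
      by (rule integral_cong_AE) (use AE_A_P in \<open>auto elim!: eventually_mono simp: indicator_def\<close>)
    also have "\<dots> = (\<integral>w. indicator S (obsX w) * real_cond_exp P (sigma_of P borel obsX) ?I w \<partial>P)"
    proof (rule PX.real_cond_exp_intg(2)[symmetric, OF _ SX Im])
      show "integrable P (\<lambda>w. indicator S (obsX w) * ?I w)"
        by (rule P.integrable_const_bound[where B = 1]) (auto simp: indicator_def)
    qed
    also have "\<dots> = (\<integral>w. indicator S (obsX w) * \<pi> (obsX w) \<partial>P)"
      using a3(1) by (intro integral_cong_AE) (auto elim!: eventually_mono simp: is_propensity_def)
    also have "\<dots> = (\<integral>\<omega>. indicator S (X i \<omega>) * \<pi> (X i \<omega>) \<partial>Pr)"
      using sample.integral_W[of "\<lambda>w. indicator S (obsX w) * \<pi> (obsX w)" i] by simp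
    finally show "(\<integral>\<omega>. indicator S (X i \<omega>) * A i \<omega> \<partial>Pr) = (\<integral>\<omega>. indicator S (X i \<omega>) * \<pi> (X i \<omega>) \<partial>Pr)" .
  qed measurable
  \<comment> \<open>Contraction of \<open>a2\<close> and \<open>a0\<close>. The latent treatment is
    kept among the arguments of g, since identification needs it; functions of X~ are a special
    case.\<close>
  have key: "(\<integral>\<omega>. g ((C i \<omega>, Z i \<omega>), (X i \<omega>, U i \<omega>, Mstar i \<omega>)) * A i \<omega> \<partial>Pr)
      = (\<integral>\<omega>. g ((C i \<omega>, Z i \<omega>), (X i \<omega>, U i \<omega>, Mstar i \<omega>)) * \<pi> (X i \<omega>) \<partial>Pr)"
    if g[measurable]: "g \<in> borel_measurable borel"
      and int: "integrable Pr (\<lambda>\<omega>. g ((C i \<omega>, Z i \<omega>), (X i \<omega>, U i \<omega>, Mstar i \<omega>)))"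
    for g and i
  proof (rule contraction_integral[OF prob, where NX = borel and NV = borel and NT = borel and NH = borel
        and X = "X i" and V = "\<lambda>\<omega>. (U i \<omega>, Mstar i \<omega>)" and T = "\<lambda>\<omega>. (C i \<omega>, Z i \<omega>)"
        and H = "\<lambda>\<omega>. (X i \<omega>, U i \<omega>, Mstar i \<omega>)" and r = "\<lambda>(v, x). (x, fst v, snd v)" and q = "\<lambda>h. \<pi> (fst h)"])
    show "(\<lambda>(v, x). (x, fst v, snd v)) \<in> borel \<Otimes>\<^sub>M borel \<rightarrow>\<^sub>M
      (borel :: ((real ^ 'k) \<times> (real ^ 'l) \<times> real) measure)"
      unfolding borel_prod by (intro borel_measurable_continuous_onI) (simp add: case_prod_unfold continuous_intros)
    show "(\<lambda>h. \<pi> (fst h)) \<in> borel_measurable (borel :: ((real ^ 'k) \<times> (real ^ 'l) \<times> real) measure)"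
      by (rule measurable_compose[OF _ \<pi>_meas]) (intro borel_measurable_continuous_onI continuous_intros)
    show "g \<in> borel_measurable (borel \<Otimes>\<^sub>M borel)" using g by (simp add: borel_prod)
    show "integrable Pr (\<lambda>\<omega>. g ((C i \<omega>, Z i \<omega>), X i \<omega>, U i \<omega>, Mstar i \<omega>) * A i \<omega>)"
      using integrable_mult_AE_bounded[OF int _ A_le, of i] by (simp add: mult.commute)
    show "integrable Pr (\<lambda>\<omega>. g ((C i \<omega>, Z i \<omega>), X i \<omega>, U i \<omega>, Mstar i \<omega>) * \<pi> (X i \<omega>))"
      using integrable_mult_AE_bounded[OF int, of "\<lambda>\<omega>. \<pi> (X i \<omega>)" 1] \<pi>
      by (auto simp: mult.commute abs_of_pos)
  qed (use A_int \<pi>_int propX a0[of i] a2[of i] in auto)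
  have keyXt: "(\<integral>w. g (obsXt w) * obsA w \<partial>P) = (\<integral>w. g (obsXt w) * \<pi> (obsX w) \<partial>P)"
    if g[measurable]: "g \<in> borel_measurable borel" and int: "integrable P (\<lambda>w. g (obsXt w))" for g
  proof -
    have "(\<lambda>((c, z), (x, u, m)). (x, u, z, c)) \<in> measurable borel
      (borel :: ('d, 'k, 'l) xtilde measure)"
      by (intro borel_measurable_continuous_onI) (simp add: case_prod_unfold continuous_intros)
    from measurable_compose[OF this g]
    have m: "(\<lambda>p. g ((\<lambda>((c, z), (x, u, m)). (x, u, z, c)) p)) \<in> borel_measurable
      (borel :: (((real ^ 'd) \<times> real) \<times> ((real ^ 'k) \<times> (real ^ 'l) \<times> real)) measure)" .
    have "(\<integral>w. g (obsXt w) * obsA w \<partial>P) = (\<integral>\<omega>. g (obsXt (W 0 \<omega>)) * A 0 \<omega> \<partial>Pr)"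
      using sample.integral_W[of "\<lambda>w. g (obsXt w) * obsA w" 0] by simp
    also have "\<dots> = (\<integral>\<omega>. g (obsXt (W 0 \<omega>)) * \<pi> (X 0 \<omega>) \<partial>Pr)"
      using key[OF m, of 0] int sample.integrable_W[of "\<lambda>w. g (obsXt w)" 0] by simp
    also have "\<dots> = (\<integral>w. g (obsXt w) * \<pi> (obsX w) \<partial>P)"
      using sample.integral_W[of "\<lambda>w. g (obsXt w) * \<pi> (obsX w)" 0] by simp
    finally show ?thesis .
  qed
  interpret P: prob_space P by (rule sample.prob_space_P)
  have AE_AM_P: "AE w in P. obsA w \<in> {0, 1} \<and> obsM w \<in> {0, obsA w}"
  proof -
    have "AE \<omega> in Pr. obsA (W 0 \<omega>) \<in> {0, 1} \<and> obsM (W 0 \<omega>) \<in> {0, obsA (W 0 \<omega>)}"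
      using a1[of 0] Mstar_binary[of 0] by eventually_elim auto
    moreover have "{w :: ('d, 'k, 'l) obs. obsA w \<in> {0, 1} \<and> obsM w \<in> {0, obsA w}} \<in> sets borel"
    proof -
      have "{w :: ('d, 'k, 'l) obs. obsA w \<in> {0, 1} \<and> obsM w \<in> {0, obsA w}}
        = {w. (obsA w = 0 \<or> obsA w = 1) \<and> (obsM w = 0 \<or> obsM w = obsA w)}" by auto
      also have "\<dots> \<in> sets borel" by measurable
      finally show ?thesis .
    qed
    ultimately show ?thesis by (rule sample.AE_W[THEN iffD1, rotated])
  qed
  have obsA_int: "integrable P obsA"
    by (rule P.integrable_const_bound[where B = 1]) (use AE_A_P in \<open>auto elim!: eventually_mono\<close>)
  have ign: "AE w in P. real_cond_exp P (sigma_of P borel obsXt) obsA w = \<pi> (obsX w)"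
  proof (rule real_cond_exp_sigma_of_charact[OF sample.prob_space_P _ obsA_int])
    show "integrable P (\<lambda>w. \<pi> (obsX w))"
      by (rule P.integrable_const_bound[where B = 1]) (use \<pi> in \<open>auto simp: abs_of_pos\<close>)
    show "(\<lambda>w. \<pi> (obsX w)) \<in> borel_measurable (sigma_of P borel obsXt)"
      using measurable_sigma_Xt_obsX[OF \<pi>_meas] by simp
    fix S :: "('d, 'k, 'l) xtilde set" assume S[measurable]: "S \<in> sets borel"
    have "integrable P (\<lambda>w. indicator S (obsXt w) :: real)"
      by (rule P.integrable_const_bound[where B = 1]) (auto simp: indicator_def)
    then show "(\<integral>w. indicator S (obsXt w) * obsA w \<partial>P) = (\<integral>w. indicator S (obsXt w) * \<pi> (obsX w) \<partial>P)"
      by (intro keyXt) auto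
  qed measurable
  have "P \<in> known_propensity_model \<pi>"
    unfolding known_propensity_model_def
  proof (intro CollectI conjI sample.prob_space_P sample.sets_P AE_AM_P a3(1))
    interpret PXt: sigma_finite_subalgebra P "sigma_of P borel obsXt"
      by (rule sigma_finite_subalgebra_sigma_of[OF sample.prob_space_P]) measurable
    have "AE w in P. real_cond_exp P (sigma_of P borel obsXt) (indicator {w. obsA w = 1}) w
        = real_cond_exp P (sigma_of P borel obsXt) obsA w"
    proof (rule PXt.real_cond_exp_cong)
      show "AE w in P. indicator {w. obsA w = 1} w = obsA w"
        using AE_A_P by eventually_elim (auto simp: indicator_def)
    qed measurable
    with ign show "AE w in P. 0 < real_cond_exp P (sigma_of P borel obsXt) (indicator {w. obsA w = 1}) w"
      by eventually_elim (simp add: \<pi>)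
  qed
  obtain B where B: "AE w in P. \<bar>zperp \<gamma> w\<bar> \<le> B" using zperp_bounded by blast
  interpret law: annotated_law P \<pi> \<eta> \<gamma> \<mu> "max B 0"
  proof
    show "P \<in> known_propensity_model \<pi>" by fact
    show "AE w in P. \<bar>zperp \<gamma> w\<bar> \<le> max B 0" using B by eventually_elim simp
    show "AE w in P. real_cond_exp P sigma_Xt obsA w = \<pi> (obsX w)" using ign by simp
  qed (use a3 mu finite_variance in auto)
  have z_bd: "AE \<omega> in Pr. \<bar>zperp \<gamma> (W i \<omega>)\<bar> \<le> max B 0" for i
    using law.zperp_le(1) by (subst sample.AE_W) auto
  have z_rv[measurable]: "(\<lambda>\<omega>. zperp \<gamma> (W i \<omega>)) \<in> borel_measurable Pr" for i
    by measurable
  have Mstar_int: "integrable Pr (Mstar i)" for i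
    by (rule Pr.integrable_const_bound[where B = 1]) (use Mstar_binary[of i] in \<open>auto elim!: eventually_mono\<close>)
  have zMstar_int: "integrable Pr (\<lambda>\<omega>. zperp \<gamma> (W i \<omega>) * Mstar i \<omega>)" for i
    by (rule integrable_mult_AE_bounded[OF Mstar_int z_rv z_bd])
  \<comment> \<open>The latent treatment is seen only when annotated: dividing by \<pi> and
    exchanging \<pi> for A expresses its weighted mean through observed data.\<close>
  have den: "(\<integral>\<omega>. zperp \<gamma> (W i \<omega>) * Mstar i \<omega> \<partial>Pr) = theta_den \<gamma> P" for i
  proof -
    let ?g = "\<lambda>((c, z), (x, u, m)). (z - \<gamma> \<bullet> c) * m / \<pi> x :: real"
    have g: "?g \<in> borel_measurable (borel :: (((real ^ 'd) \<times> real) \<times> ((real ^ 'k) \<times> (real ^ 'l) \<times> real)) measure)"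
    proof -
      have "(\<lambda>p. snd (fst p) - \<gamma> \<bullet> fst (fst p)) \<in> borel_measurable (borel :: (((real ^ 'd) \<times> real) \<times> ((real ^ 'k) \<times> (real ^ 'l) \<times> real)) measure)"
        "(\<lambda>p. snd (snd (snd p))) \<in> borel_measurable (borel :: (((real ^ 'd) \<times> real) \<times> ((real ^ 'k) \<times> (real ^ 'l) \<times> real)) measure)"
        "(\<lambda>p. fst (snd p)) \<in> borel_measurable (borel :: (((real ^ 'd) \<times> real) \<times> ((real ^ 'k) \<times> (real ^ 'l) \<times> real)) measure)"
        by (intro borel_measurable_continuous_onI continuous_intros)+
      from borel_measurable_divide[OF borel_measurable_times[OF this(1,2)] measurable_compose[OF this(3) \<pi>_meas]]
      show ?thesis by (simp add: case_prod_unfold)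
    qed
    have inv_\<pi>: "AE \<omega> in Pr. \<bar>1 / \<pi> (X i \<omega>)\<bar> \<le> 1 / \<eta>"
      using \<pi> a3(2) by (intro AE_I2) (auto simp: abs_of_pos frac_le)
    have int: "integrable Pr (\<lambda>\<omega>. zperp \<gamma> (W i \<omega>) * Mstar i \<omega> / \<pi> (X i \<omega>))"
      using integrable_mult_AE_bounded[OF zMstar_int _ inv_\<pi>, of i] by simp
    have "(\<integral>\<omega>. zperp \<gamma> (W i \<omega>) * Mstar i \<omega> \<partial>Pr)
        = (\<integral>\<omega>. zperp \<gamma> (W i \<omega>) * Mstar i \<omega> / \<pi> (X i \<omega>) * \<pi> (X i \<omega>) \<partial>Pr)"
      using \<pi>(1) by (simp add: less_imp_neq[THEN not_sym])
    also have "\<dots> = (\<integral>\<omega>. zperp \<gamma> (W i \<omega>) * Mstar i \<omega> / \<pi> (X i \<omega>) * A i \<omega> \<partial>Pr)"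
      using key[OF g, of i] int by (simp add: zW)
    also have "\<dots> = (\<integral>\<omega>. obsA (W i \<omega>) * obsM (W i \<omega>) * (zperp \<gamma> (W i \<omega>) / \<pi> (obsX (W i \<omega>))) \<partial>Pr)"
    proof (rule integral_cong_AE)
      \<comment> \<open>On annotated units the latent treatment is the recorded one; on the others
        both sides are zero.\<close>
      show "AE \<omega> in Pr. zperp \<gamma> (W i \<omega>) * Mstar i \<omega> / \<pi> (X i \<omega>) * A i \<omega>
          = obsA (W i \<omega>) * obsM (W i \<omega>) * (zperp \<gamma> (W i \<omega>) / \<pi> (obsX (W i \<omega>)))"
        using a1[of i] by eventually_elim auto
    qed (use int in measurable)
    also have "\<dots> = (\<integral>w. obsA w * obsM w * (zperp \<gamma> w / \<pi> (obsX w)) \<partial>P)"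
      by (rule sample.integral_W[of "\<lambda>w. obsA w * obsM w * (zperp \<gamma> w / \<pi> (obsX w))" i]) measurable
    also have "\<dots> = theta_den \<gamma> P"
      by (rule law.integral_annotated_outcome)
    finally show ?thesis .
  qed
  \<comment> \<open>Consistency and a constant effect give Y = Y0 + \<theta> \<open>Mstar\<close>,
    and the projection residual is orthogonal to the baseline Y0.\<close>
  have num: "(\<integral>\<omega>. zperp \<gamma> (W i \<omega>) * Y i \<omega> \<partial>Pr) = \<theta> * (\<integral>\<omega>. zperp \<gamma> (W i \<omega>) * Mstar i \<omega> \<partial>Pr)" for i
  proof -
    obtain \<tau> where \<tau>: "AE \<omega> in Pr. Ypot i 1 \<omega> - Ypot i 0 \<omega> = \<tau>" using homogeneity[of i] by blast
    have Yp[measurable]: "Ypot i 0 \<in> borel_measurable Pr" "Ypot i 1 \<in> borel_measurable Pr" using Ypot_rv by auto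
    have "\<theta> = (\<integral>\<omega>. \<tau> \<partial>Pr)"
      unfolding theta[of i] by (rule integral_cong_AE) (use \<tau> in auto)
    then have \<theta>\<tau>: "\<theta> = \<tau>" by (simp add: Pr.prob_space)
    obtain \<beta> where \<beta>: "AE \<omega> in Pr. real_cond_exp Pr (sigma_of Pr borel (C i)) (Ypot i 0) \<omega> = \<beta> \<bullet> C i \<omega>"
      using linearity(2)[of i] by blast
    have base: "(\<integral>\<omega>. (Z i \<omega> - \<gamma> \<bullet> C i \<omega>) * Ypot i 0 \<omega> \<partial>Pr) = 0"
    proof (rule residual_orthogonal_to_baseline[OF prob _ _ _ _ exogeneity[of i] _ linearity(1) \<beta>, where f = fst])
      \<comment> \<open>Potential treatments are indexed by all reals, so the last component lies in
        an uncountable product and is measurable coordinate by coordinate.\<close>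
      show "(\<lambda>\<omega>. (Ypot i 0 \<omega>, Ypot i 1 \<omega>, \<lambda>z. Mpot i z \<omega>)) \<in> Pr \<rightarrow>\<^sub>M borel \<Otimes>\<^sub>M borel \<Otimes>\<^sub>M (\<Pi>\<^sub>M z\<in>UNIV. borel)"
        using Mpot_rv by (intro measurable_Pair Yp measurable_PiM_single') (auto simp: PiE_def)
      show "AE \<omega> in Pr. \<bar>Z i \<omega> - \<gamma> \<bullet> C i \<omega>\<bar> \<le> max B 0" using z_bd[of i] by (simp add: zW)
      have "(\<integral>\<omega>. (Z i \<omega> - \<gamma> \<bullet> C i \<omega>) * (\<beta> \<bullet> C i \<omega>) \<partial>Pr) = (\<integral>w. (obsZ w - \<gamma> \<bullet> obsC w) * (\<beta> \<bullet> obsC w) \<partial>P)"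
        using sample.integral_W[of "\<lambda>w. (obsZ w - \<gamma> \<bullet> obsC w) * (\<beta> \<bullet> obsC w)" i] by simp
      then show "(\<integral>\<omega>. (Z i \<omega> - \<gamma> \<bullet> C i \<omega>) * (\<beta> \<bullet> C i \<omega>) \<partial>Pr) = 0"
        using proj by (simp add: linear_projection_def)
    qed simp_all
    have zY0: "integrable Pr (\<lambda>\<omega>. zperp \<gamma> (W i \<omega>) * Ypot i 0 \<omega>)"
      by (rule integrable_mult_AE_bounded[OF linearity(1) z_rv z_bd])
    have "(\<integral>\<omega>. zperp \<gamma> (W i \<omega>) * Y i \<omega> \<partial>Pr)
        = (\<integral>\<omega>. zperp \<gamma> (W i \<omega>) * Ypot i 0 \<omega> + \<theta> * (zperp \<gamma> (W i \<omega>) * Mstar i \<omega>) \<partial>Pr)"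
    proof (rule integral_cong_AE)
      show "AE \<omega> in Pr. zperp \<gamma> (W i \<omega>) * Y i \<omega>
          = zperp \<gamma> (W i \<omega>) * Ypot i 0 \<omega> + \<theta> * (zperp \<gamma> (W i \<omega>) * Mstar i \<omega>)"
        using consistency_Y[of i] \<tau> Mstar_binary[of i]
      proof eventually_elim
        case (elim \<omega>)
        then have "Ypot i 1 \<omega> = Ypot i 0 \<omega> + \<theta>" "Mstar i \<omega> = 0 \<or> Mstar i \<omega> = 1" by (auto simp: \<theta>\<tau>)
        then show ?case using elim(1) by (auto simp: algebra_simps)
      qed
    qed measurable
    also have "\<dots> = \<theta> * (\<integral>\<omega>. zperp \<gamma> (W i \<omega>) * Mstar i \<omega> \<partial>Pr)"
      using zY0 zMstar_int[of i] base by (simp add: zW)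
    finally show ?thesis .
  qed
  have den0: "theta_den \<gamma> P \<noteq> 0" using relevance[of 0] by (simp add: den)
  have id: "\<theta> = inverse (\<integral>\<omega>. zperp \<gamma> (W i \<omega>) * Mstar i \<omega> \<partial>Pr) * (\<integral>\<omega>. zperp \<gamma> (W i \<omega>) * Y i \<omega> \<partial>Pr)" for i
    using den0 by (simp add: num den)
  have num_eq: "(\<integral>\<omega>. zperp \<gamma> (W i \<omega>) * Y i \<omega> \<partial>Pr) = theta_num \<gamma> P" for i
    using sample.integral_W[of "\<lambda>w. zperp \<gamma> w * obsY w" i] by (simp add: theta_num_def)
  have ratio: "\<theta> = theta_ratio \<gamma> P"
    using id[of 0] by (simp add: theta_ratio_def den num_eq)
  have \<phi>: "\<phi> = law.\<phi>" by (simp add: \<phi>_def law.\<phi>_def ratio fun_eq_iff)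
  interpret fit: cross_fit P \<pi> \<eta> \<gamma> \<mu> "max B 0" Pr W I I' muhat
    by unfold_locales (use den0 split muhat_rv a4 in auto)
  have "weak_conv_m
       (\<lambda>n. distr Pr borel (\<lambda>\<omega>. sqrt (real (card (I n))) *
          (theta_hat \<gamma> \<pi> (muhat n (\<lambda>i\<in>I' n. W i \<omega>)) (I n) (\<lambda>i. W i \<omega>) - \<theta>)))
       (normal_law 0 (\<integral>w. (\<phi> w - (\<integral>v. \<phi> v \<partial>P))\<^sup>2 \<partial>P))"
    \<comment> \<open>\<phi> is centred, so its variance is its second moment.\<close>
    using fit.asymptotic_normality
    by (simp add: \<phi> law.mean_\<phi> fit.T_def[abs_def] fit.train_def fit.\<theta>_def ratio)
  moreover have "law.outcome_ignorable"
    if "AE w in P.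
         real_cond_exp P (sigma_of P borel (\<lambda>w. (obsA w, obsX w))) (\<lambda>w. zperp \<gamma> w * obsY w) w =
         real_cond_exp P (sigma_of P borel obsX) (\<lambda>w. zperp \<gamma> w * obsY w) w"
    using that by (simp add: law.outcome_ignorable_def)
  ultimately show ?thesis
    using id den0 ratio law.pathwise_gradient_num law.efficient_den law.pathwise_gradient_ratio[OF den0]
      law.efficient_num law.efficient_ratio[OF _ den0] unfolding \<phi> by blast
qed

end
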